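(* Let $r$ be a positive integer and let $(a_0,\dots,a_b)$ be a path in $T(n)$ of length $b$ with $0\le b\le r$. Assume that $a_0$ is a sink of $\Omega$ if $r$ is even, and a source of $\Omega$ if $r$ is odd. Then there is a regular indecomposable representation $M$ of $(T(n),\Omega)$ which is the sink module of smallest radius in its shift orbit (i.e. $M=M_0$) and satisfies $r_0(M)=r$ and $\pi(M)=(a_0,\dots,a_b)$.
   Context: Let $k$ be a field and $n\ge 3$ an integer. $T(n)$ denotes the $n$-regular tree (every vertex has exactly $n$ neighbours). A path of length $t\ge 0$ is a sequence $(a_0,\dots,a_t)$ of vertices with $a_{i-1},a_i$ neighbours and $a_{i-1}\neq a_{i+1}$; $d(a,a')$ is the length of the unique path from $a$ to $a'$. A path of length $2r$ has center $a_r$ and radius $r$; a path of length $2r+1$ has center the edge $\{a_r,a_{r+1}\}$ and radius $r$. Fix a bipartite orientation $\Omega$ of $T(n)$ (every vertex is a sink or a source) and let $\sigma\Omega$ be the opposite orientation. A module is a finite-dimensional $k$-representation of $(T(n),\Omega)$ or $(T(n),\sigma\Omega)$. The shift functor $\sigma$ is the composition of the Bernstein–Gelfand–Ponomarev reflection functors at all sinks (mapping representations of $(T(n),\Omega)$ to those of $(T(n),\sigma\Omega)$ and vice versa); $\sigma^-$ is its left adjoint and $\sigma^t=(\sigma^-)^{-t}$ for $t<0$. An indecomposable module $M$ is regular if $\sigma^tM\neq0$ for all $t\in\mathbb Z$; its shift orbit is $\{\sigma^tM:t\in\mathbb Z\}$. The support $T(M)$ of an indecomposable $M$ is the full subgraph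 on vertices $a$ with $M_a\ne 0$; a diameter path is a path in $T(M)$ of maximal length $d(M)$; all diameter paths have a common center (the center of $M$), and $r(M)=\lfloor d(M)/2\rfloor$. $M$ is a sink (resp. source) module if its diameter paths start and end in sinks (resp. sources) of the orientation of its quiver, and a flow module if $d(M)$ is odd. Fact (structure of shift orbits): for regular indecomposable $M$, the shift orbit contains a unique sink module $M_0$ of smallest radius; put $r_0(M)=r(M_0)$ and $M_i=\sigma^iM_0$; there is $b\ge 0$ such that $M_1,\dots,M_b$ are exactly the flow modules in the orbit and $M_{b+1}$ is a source module, the modules $M_i$, $i\le 0$, are sink modules with center $a_0$, $M_i$ ($1\le i\le b$) has center an edge $\{a_{i-1},a_i\}$, and the modules $M_{i}$, $i\ge b+1$, are source modules with center $a_b$, where $(a_0,\dots,a_b)$ is a path. This path is the center path $\pi(M)$. *)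

theory Defs
  imports Main
begin

text \<open>Vertices of T(n) are reduced words over the alphabet {0..<n} (no two consecutive
letters equal), i.e. the Cayley graph of the free product of n copies of Z/2.
Two vertices are neighbours iff one arises from the other by appending one letter.\<close>

definition valid :: "nat \<Rightarrow> nat list \<Rightarrow> bool" where
  "valid n v \<longleftrightarrow> (\<forall>x\<in>set v. x < n) \<and> (\<forall>i. Suc i < length v \<longrightarrow> v ! i \<noteq> v ! Suc i)"

definition adj :: "nat \<Rightarrow> nat list \<Rightarrow> nat list \<Rightarrow> bool" where
  "adj n v w \<longleftrightarrow> valid n v \<and> valid n w \<and> (\<exists>i. w = v @ [i] \<or> v = w @ [i])"

definition nbrs :: "nat \<Rightarrow> nat list \<Rightarrow> nat list set" where
  "nbrs n v = {w. adj n v w}"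

definition is_path :: "nat \<Rightarrow> nat list list \<Rightarrow> bool" where
  "is_path n p \<longleftrightarrow> p \<noteq> [] \<and> (\<forall>a\<in>set p. valid n a)
     \<and> (\<forall>i. Suc i < length p \<longrightarrow> adj n (p ! i) (p ! Suc i))
     \<and> (\<forall>i. Suc (Suc i) < length p \<longrightarrow> p ! i \<noteq> p ! Suc (Suc i))"

definition plen :: "nat list list \<Rightarrow> nat" where
  "plen p = length p - 1"

definition path_center :: "nat list list \<Rightarrow> nat list set" where
  "path_center p = (if even (plen p) then {p ! (plen p div 2)}
                    else {p ! (plen p div 2), p ! Suc (plen p div 2)})"

text \<open>A bipartite orientation is encoded by a boolean o: the sinks are the vertices whose
word length has parity "even = o"; all other vertices are sources. The opposite
orientation is encoded by the negated boolean.\<close>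

definition is_sink :: "bool \<Rightarrow> nat list \<Rightarrow> bool" where
  "is_sink ori v \<longleftrightarrow> (even (length v) = ori)"

definition arrow :: "nat \<Rightarrow> bool \<Rightarrow> nat list \<Rightarrow> nat list \<Rightarrow> bool" where
  "arrow n ori x y \<longleftrightarrow> adj n x y \<and> is_sink ori y"

text \<open>The space at a vertex of dimension d is k^d, realised as functions nat => k vanishing
from index d on. A linear map k^ds -> k^dt is given by a matrix (entries (i,j), i<dt, j<ds).\<close>

definition V :: "nat \<Rightarrow> (nat \<Rightarrow> 'a::field) set" where
  "V d = {x. \<forall>i\<ge>d. x i = 0}"

definition vzero :: "nat \<Rightarrow> 'a::field" where
  "vzero = (\<lambda>_. 0)"

definition lin :: "nat \<Rightarrow> nat \<Rightarrow> (nat \<Rightarrow> nat \<Rightarrow> 'a::field) \<Rightarrow> (nat \<Rightarrow> 'a) \<Rightarrow> (nat \<Rightarrow> 'a)" where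
  "lin dt ds A x = (\<lambda>i. if i < dt then (\<Sum>j<ds. A i j * x j) else 0)"

text \<open>A module: its orientation, its dimension vector, and for each arrow x -> y of that
orientation the matrix of the map M_x -> M_y (rmap M x y).\<close>

record 'a qrep =
  rori :: bool
  rdim :: "nat list \<Rightarrow> nat"
  rmap :: "nat list \<Rightarrow> nat list \<Rightarrow> nat \<Rightarrow> nat \<Rightarrow> 'a"

definition is_rep :: "nat \<Rightarrow> ('a::field) qrep \<Rightarrow> bool" where
  "is_rep n M \<longleftrightarrow> finite {v. rdim M v \<noteq> 0} \<and> (\<forall>v. rdim M v \<noteq> 0 \<longrightarrow> valid n v)"

definition is_zero :: "('a::field) qrep \<Rightarrow> bool" where
  "is_zero M \<longleftrightarrow> (\<forall>v. rdim M v = 0)"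

definition supp :: "('a::field) qrep \<Rightarrow> nat list set" where
  "supp M = {v. rdim M v \<noteq> 0}"

definition subspace_of :: "nat \<Rightarrow> (nat \<Rightarrow> 'a::field) set \<Rightarrow> bool" where
  "subspace_of d U \<longleftrightarrow> U \<subseteq> V d \<and> vzero \<in> U \<and> (\<forall>x\<in>U. \<forall>y\<in>U. (\<lambda>i. x i + y i) \<in> U)
      \<and> (\<forall>c. \<forall>x\<in>U. (\<lambda>i. c * x i) \<in> U)"

definition subrep :: "nat \<Rightarrow> ('a::field) qrep \<Rightarrow> (nat list \<Rightarrow> (nat \<Rightarrow> 'a) set) \<Rightarrow> bool" where
  "subrep n M U \<longleftrightarrow> (\<forall>v. subspace_of (rdim M v) (U v))
     \<and> (\<forall>x y. arrow n (rori M) x y \<longrightarrow>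
          (\<forall>u\<in>U x. lin (rdim M y) (rdim M x) (rmap M x y) u \<in> U y))"

definition indecomposable :: "nat \<Rightarrow> ('a::field) qrep \<Rightarrow> bool" where
  "indecomposable n M \<longleftrightarrow> \<not> is_zero M \<and>
     (\<forall>U W. subrep n M U \<and> subrep n M W \<and>
        (\<forall>v. U v \<inter> W v = {vzero} \<and> (\<forall>x\<in>V (rdim M v). \<exists>u\<in>U v. \<exists>w\<in>W v. x = (\<lambda>i. u i + w i)))
        \<longrightarrow> (\<forall>v. U v = {vzero}) \<or> (\<forall>v. W v = {vzero}))"

section \<open>The shift functors (BGP reflections at all sinks, resp. all sources)\<close>

text \<open>shift_rel n M N: N is (a realisation of) sigma M. The sources of M keep their spaces;
at each sink v of M, the space N_v together with the maps N_v -> M_w (w neighbour of v)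
is the kernel of the map (sum over w of M_w) -> M_v.\<close>

definition shift_rel :: "nat \<Rightarrow> ('a::field) qrep \<Rightarrow> 'a qrep \<Rightarrow> bool" where
  "shift_rel n M N \<longleftrightarrow> is_rep n M \<and> is_rep n N \<and> rori N = (\<not> rori M) \<and>
    (\<forall>w. \<not> is_sink (rori M) w \<longrightarrow> rdim N w = rdim M w) \<and>
    (\<forall>v. valid n v \<and> is_sink (rori M) v \<longrightarrow>
       (\<forall>x\<in>V (rdim N v).
          (\<lambda>i. \<Sum>w\<in>nbrs n v. lin (rdim M v) (rdim M w) (rmap M w v)
                  (lin (rdim M w) (rdim N v) (rmap N v w) x) i) = vzero) \<and>
       (\<forall>x\<in>V (rdim N v).
          (\<forall>w\<in>nbrs n v. lin (rdim M w) (rdim N v) (rmap N v w) x = vzero) \<longrightarrow> x = vzero) \<and>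
       (\<forall>y. (\<forall>w\<in>nbrs n v. y w \<in> V (rdim M w)) \<longrightarrow>
          (\<lambda>i. \<Sum>w\<in>nbrs n v. lin (rdim M v) (rdim M w) (rmap M w v) (y w) i) = vzero \<longrightarrow>
          (\<exists>x\<in>V (rdim N v). \<forall>w\<in>nbrs n v. lin (rdim M w) (rdim N v) (rmap N v w) x = y w)))"

text \<open>shiftm_rel n M N: N is (a realisation of) sigma^- M. The sinks of M keep their spaces;
at each source v of M, the space N_v together with the maps M_w -> N_v (w neighbour of v)
is the cokernel of the map M_v -> (sum over w of M_w).\<close>

definition shiftm_rel :: "nat \<Rightarrow> ('a::field) qrep \<Rightarrow> 'a qrep \<Rightarrow> bool" where
  "shiftm_rel n M N \<longleftrightarrow> is_rep n M \<and> is_rep n N \<and> rori N = (\<not> rori M) \<and>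
    (\<forall>w. is_sink (rori M) w \<longrightarrow> rdim N w = rdim M w) \<and>
    (\<forall>v. valid n v \<and> \<not> is_sink (rori M) v \<longrightarrow>
       (\<forall>x\<in>V (rdim M v).
          (\<lambda>i. \<Sum>w\<in>nbrs n v. lin (rdim N v) (rdim M w) (rmap N w v)
                  (lin (rdim M w) (rdim M v) (rmap M v w) x) i) = vzero) \<and>
       (\<forall>z\<in>V (rdim N v). \<exists>y. (\<forall>w\<in>nbrs n v. y w \<in> V (rdim M w)) \<and>
          (\<lambda>i. \<Sum>w\<in>nbrs n v. lin (rdim N v) (rdim M w) (rmap N w v) (y w) i) = z) \<and>
       (\<forall>y. (\<forall>w\<in>nbrs n v. y w \<in> V (rdim M w)) \<longrightarrow>
          (\<lambda>i. \<Sum>w\<in>nbrs n v. lin (rdim N v) (rdim M w) (rmap N w v) (y w) i) = vzero \<longrightarrow>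
          (\<exists>x\<in>V (rdim M v). \<forall>w\<in>nbrs n v. lin (rdim M w) (rdim M v) (rmap M v w) x = y w)))"

definition sig :: "nat \<Rightarrow> ('a::field) qrep \<Rightarrow> 'a qrep" where
  "sig n M = (SOME N. shift_rel n M N)"

definition sigm :: "nat \<Rightarrow> ('a::field) qrep \<Rightarrow> 'a qrep" where
  "sigm n M = (SOME N. shiftm_rel n M N)"

definition sigt :: "nat \<Rightarrow> int \<Rightarrow> ('a::field) qrep \<Rightarrow> 'a qrep" where
  "sigt n t M = (if 0 \<le> t then (sig n ^^ nat t) M else (sigm n ^^ nat (- t)) M)"

definition regular :: "nat \<Rightarrow> ('a::field) qrep \<Rightarrow> bool" where
  "regular n M \<longleftrightarrow> is_rep n M \<and> indecomposable n M \<and> (\<forall>t::int. \<not> is_zero (sigt n t M))"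

definition spaths :: "nat \<Rightarrow> ('a::field) qrep \<Rightarrow> nat list list set" where
  "spaths n M = {p. is_path n p \<and> set p \<subseteq> supp M}"

definition diam :: "nat \<Rightarrow> ('a::field) qrep \<Rightarrow> nat" where
  "diam n M = Max (plen ` spaths n M)"

definition diam_path :: "nat \<Rightarrow> ('a::field) qrep \<Rightarrow> nat list list \<Rightarrow> bool" where
  "diam_path n M p \<longleftrightarrow> p \<in> spaths n M \<and> plen p = diam n M"

definition radius :: "nat \<Rightarrow> ('a::field) qrep \<Rightarrow> nat" where
  "radius n M = diam n M div 2"

definition has_center :: "nat \<Rightarrow> ('a::field) qrep \<Rightarrow> nat list set \<Rightarrow> bool" where
  "has_center n M C \<longleftrightarrow> (\<forall>p. diam_path n M p \<longrightarrow> path_center p = C)"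

definition sink_module :: "nat \<Rightarrow> ('a::field) qrep \<Rightarrow> bool" where
  "sink_module n M \<longleftrightarrow> (\<forall>p. diam_path n M p \<longrightarrow>
      is_sink (rori M) (hd p) \<and> is_sink (rori M) (last p))"

definition source_module :: "nat \<Rightarrow> ('a::field) qrep \<Rightarrow> bool" where
  "source_module n M \<longleftrightarrow> (\<forall>p. diam_path n M p \<longrightarrow>
      \<not> is_sink (rori M) (hd p) \<and> \<not> is_sink (rori M) (last p))"

definition flow_module :: "nat \<Rightarrow> ('a::field) qrep \<Rightarrow> bool" where
  "flow_module n M \<longleftrightarrow> odd (diam n M)"

definition is_M0 :: "nat \<Rightarrow> ('a::field) qrep \<Rightarrow> bool" where
  "is_M0 n M \<longleftrightarrow> sink_module n M \<and>
     (\<forall>t::int. sink_module n (sigt n t M) \<longrightarrow> radius n M \<le> radius n (sigt n t M))"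

text \<open>Center path of an orbit, read off from M = M_0 (cf. the structure Fact):
p = (a_0,...,a_b) is the center path iff M_0 has center a_0, the modules M_1..M_b are flow
modules with centers {a_(i-1), a_i}, and M_(b+1) is a source module.\<close>

definition center_path :: "nat \<Rightarrow> ('a::field) qrep \<Rightarrow> nat list list \<Rightarrow> bool" where
  "center_path n M p \<longleftrightarrow> p \<noteq> [] \<and> has_center n M {p ! 0} \<and>
     (\<forall>i. 1 \<le> i \<and> i \<le> plen p \<longrightarrow>
        flow_module n (sigt n (int i) M) \<and> has_center n (sigt n (int i) M) {p ! (i - 1), p ! i}) \<and>
     source_module n (sigt n (int (plen p + 1)) M) \<and> \<not> flow_module n (sigt n (int (plen p + 1)) M)"

end

theory Submission
  imports Defs Complex_Main
begin

text \<open>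
Under the shift functors the dimension vector of an indecomposable module with at least two
vertices in its support changes by reflection, and indecomposability is preserved. Write \<open>P j a\<close> for
the \<open>j\<close>-fold inverse shift of the simple projective at the sink \<open>a\<close>: it lives on the ball of radius \<open>j\<close> around \<open>a\<close>,
with dimension one on the boundary, and the \<open>j\<close>-fold shift of the simple injective at a source has
the same dimensions. Take \<open>P (r - 1) (p ! 0)\<close> and attach one-dimensional spaces at sources \<open>y\<close> at distance \<open>r\<close>
from \<open>p ! 0\<close> which lie beyond the end of the path \<open>p\<close> (two of them, or only the end point itself when \<open>p\<close> has length \<open>r\<close>).
Shifting this module \<open>t\<close> times, the ball around \<open>p ! 0\<close> shrinks while the balls around the
\<open>y\<close> grow, so the center of the support moves along \<open>p\<close>. The module \<open>M\<close> is the inverse shift of it.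
Only \<open>r = 1\<close> with a path of length 0 needs another module: three lines in a plane.
\<close>

section \<open>The regular tree\<close>

text \<open>The shifts are Hilbert choices, so the maps of a shifted module are out of reach. Only
  orientation, dimension vector and indecomposability are tracked. This suffices on a tree: an
  indecomposable module has connected support, and the support determines the diameter paths.
  Matrices are written down only for \<open>M_1\<close>, whose dimension vector is a sum without
  cancellation; \<open>M_0\<close> already loses a dimension at each \<open>y\<close>. The radii: in
  \<open>M_(t+1)\<close> the ball around \<open>p ! 0\<close> has radius \<open>r - 1 - t\<close>,
  those around the \<open>y\<close> have radius \<open>t\<close>. Since \<open>y\<close> is
  \<open>r\<close> away from \<open>p ! 0\<close>, the diameter is \<open>2 * r - 1\<close> and the
  center is the edge from \<open>p ! t\<close> to \<open>p ! Suc t\<close>. After \<open>b\<close>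
  steps, balls of radius \<open>b\<close> around two points \<open>y\<close> that are
  \<open>2 * (r - b)\<close> apart give diameter \<open>2 * r\<close> around \<open>p ! b\<close>;
  for \<open>b = r\<close> one ball of radius \<open>r\<close> around the end point does. Besides,
  \<open>M_0\<close> must keep two antipodal boundary vertices outside the set of the
  \<open>y\<close>. For \<open>r = 1\<close> and \<open>b = 0\<close> this would take four
  neighbours of \<open>p ! 0\<close>, too many when \<open>n = 3\<close>; hence the extra
  module.\<close>

lemma valid_snoc: "valid n (v @ [i]) \<longleftrightarrow> valid n v \<and> i < n \<and> (v \<noteq> [] \<longrightarrow> last v \<noteq> i)"
proof -
  have "(\<forall>k. Suc k < length (v @ [i]) \<longrightarrow> (v @ [i]) ! k \<noteq> (v @ [i]) ! Suc k) \<longleftrightarrow>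
     (\<forall>k. Suc k < length v \<longrightarrow> v ! k \<noteq> v ! Suc k) \<and> (v \<noteq> [] \<longrightarrow> last v \<noteq> i)"
    (is "?l \<longleftrightarrow> ?a \<and> ?b")
  proof
    assume l: ?l
    have ?a
    proof (intro allI impI)
      fix k assume k: "Suc k < length v"
      with l[rule_format, of k] show "v ! k \<noteq> v ! Suc k" by (simp add: nth_append)
    qed
    moreover have ?b
      using l[rule_format, of "length v - 1"]
      by (cases v rule: rev_cases) (auto simp: nth_append)
    ultimately show "?a \<and> ?b" ..
  next
    assume "?a \<and> ?b"
    then show ?l
      by (cases v rule: rev_cases) (auto simp: nth_append less_Suc_eq split: if_splits)
  qed
  then show ?thesis unfolding valid_def by auto
qed

lemma valid_Nil [simp]: "valid n []"
  by (simp add: valid_def)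

lemma valid_append: "valid n (v @ w) \<Longrightarrow> valid n v"
  by (induction w rule: rev_induct) (simp_all add: valid_snoc flip: append_assoc)

lemma adj_sym: "adj n v w \<Longrightarrow> adj n w v"
  by (auto simp: adj_def)

lemma adj_valid: "adj n v w \<Longrightarrow> valid n v \<and> valid n w"
  by (auto simp: adj_def)

lemma adj_parity: "adj n v w \<Longrightarrow> even (length w) \<longleftrightarrow> odd (length v)"
  by (auto simp: adj_def)

lemma adj_is_sink: "adj n v w \<Longrightarrow> is_sink ori w \<longleftrightarrow> \<not> is_sink ori v"
  using adj_parity by (auto simp: is_sink_def)

text \<open>Right multiplication by the letter \<open>i\<close> in the free product of copies of
  Z/2: an equal last letter is cancelled, otherwise \<open>i\<close> is appended. So the alphabet
  indexes the neighbours, which makes the tree \<open>n\<close>-regular.\<close>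

lemma nbrs_eq_image:
  assumes "valid n v"
  shows "nbrs n v = (\<lambda>i. if v \<noteq> [] \<and> last v = i then butlast v else v @ [i]) ` {..<n}"
    (is "_ = ?f ` _")
proof (cases v rule: rev_cases)
  case Nil
  then show ?thesis by (auto simp: nbrs_def adj_def valid_snoc[of _ "[]", simplified])
next
  case (snoc u k)
  have k: "k < n" "valid n u" using assms by (auto simp: snoc valid_snoc)
  show ?thesis
  proof (intro set_eqI iffI)
    fix w assume "w \<in> nbrs n v"
    then have "valid n w" and "(\<exists>i. w = v @ [i]) \<or> (\<exists>i. v = w @ [i])"
      by (auto simp: nbrs_def adj_def)
    then show "w \<in> ?f ` {..<n}"
    proof (elim disjE exE)
      fix i assume "valid n w" "w = v @ [i]"
      then show ?thesis by (intro image_eqI[of _ _ i]) (auto simp: valid_snoc)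
    next
      fix i assume "v = w @ [i]"
      then show ?thesis using k snoc by (intro image_eqI[of _ _ k]) auto
    qed
  next
    fix w assume "w \<in> ?f ` {..<n}"
    then show "w \<in> nbrs n v" using assms k snoc
      by (auto simp: nbrs_def adj_def valid_snoc[of _ "u @ [k]", simplified]
          valid_snoc[of _ "[k]", simplified] valid_snoc[of _ "[]", simplified])
  qed
qed

lemma finite_nbrs [simp]: "finite (nbrs n v)"
proof (cases "valid n v")
  case True
  then show ?thesis by (simp add: nbrs_eq_image)
next
  case False
  then have "nbrs n v = {}" by (auto simp: nbrs_def adj_def)
  then show ?thesis by simp
qed

lemma card_nbrs:
  assumes "valid n v"
  shows "card (nbrs n v) = n"
proof -
  have "inj_on (\<lambda>i. if v \<noteq> [] \<and> last v = i then butlast v else v @ [i]) {..<n}"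
  proof (rule inj_onI)
    fix i j
    assume "(if v \<noteq> [] \<and> last v = i then butlast v else v @ [i])
          = (if v \<noteq> [] \<and> last v = j then butlast v else v @ [j])"
    moreover have "butlast v \<noteq> v @ [k]" for k
    proof
      assume "butlast v = v @ [k]"
      then have "length (butlast v) = Suc (length v)" by simp
      then show False by simp
    qed
    then have "v @ [k] \<noteq> butlast v" for k by metis
    ultimately show "i = j" using \<open>\<And>k. butlast v \<noteq> v @ [k]\<close>
      by (cases "v \<noteq> [] \<and> last v = i"; cases "v \<noteq> [] \<and> last v = j") simp_all
  qed
  from card_image[OF this] show ?thesis unfolding nbrs_eq_image[OF assms] by simp
qed

section \<open>Distance in the tree\<close>

fun tdist :: "nat list \<Rightarrow> nat list \<Rightarrow> nat" where
  "tdist [] v = length v"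
| "tdist (x # u) [] = Suc (length u)"
| "tdist (x # u) (y # v) = (if x = y then tdist u v else Suc (Suc (length u + length v)))"

lemma tdist_Nil2 [simp]: "tdist u [] = length u"
  by (cases u) auto

lemma tdist_refl [simp]: "tdist u u = 0"
  by (induction u) auto

lemma tdist_eq_0: "tdist u v = 0 \<longleftrightarrow> u = v"
  by (induction u v rule: tdist.induct) auto

lemma tdist_sym: "tdist u v = tdist v u"
  by (induction u v rule: tdist.induct) auto

lemma tdist_snoc_prefix: "tdist (v @ i # z) v = Suc (tdist (v @ i # z) (v @ [i]))"
  by (induction v) auto

lemma tdist_snoc_not_prefix: "\<nexists>z. c = v @ i # z \<Longrightarrow> tdist c (v @ [i]) = Suc (tdist c v)"
  proof (induction c v rule: tdist.induct)
  case (2 x u)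
  then show ?case by auto
next
  case (3 x u y v)
  then show ?case by auto
qed simp

lemma tdist_adj: "adj n v w \<Longrightarrow> tdist c w = Suc (tdist c v) \<or> tdist c v = Suc (tdist c w)"
  unfolding adj_def by (metis tdist_snoc_prefix tdist_snoc_not_prefix)

lemma tdist_adj_1: "adj n v w \<Longrightarrow> tdist v w = 1"
  using tdist_adj[of n v w v] by auto

text \<open>Acyclicity of the tree. Appending a letter leads towards \<open>c\<close> only if the
  longer word is a prefix of \<open>c\<close>; deleting one leads towards \<open>c\<close> only if
  the longer word is not a prefix of \<open>c\<close>. So the letter to append is determined, and
  the two kinds of step exclude each other.\<close>

lemma tdist_descent_unique:
  assumes "adj n v w" "adj n v w'" "tdist c v = Suc (tdist c w)" "tdist c v = Suc (tdist c w')"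
  shows "w = w'"
proof -
  have up: "\<exists>z. c = u @ i # z" if "tdist c u = Suc (tdist c (u @ [i]))" for u i
    using tdist_snoc_not_prefix[of c u i] that by force
  have down: "\<nexists>z. c = u @ i # z" if "tdist c (u @ [i]) = Suc (tdist c u)" for u i
    using tdist_snoc_prefix[of u i] that by fastforce
  have "(\<exists>i. w = v @ [i]) \<or> (\<exists>i. v = w @ [i])" "(\<exists>i. w' = v @ [i]) \<or> (\<exists>i. v = w' @ [i])"
    using assms(1,2) by (auto simp: adj_def)
  then show ?thesis
  proof (elim disjE exE)
    fix i j assume "w = v @ [i]" "w' = v @ [j]"
    then show ?thesis using up[of v i] up[of v j] assms(3,4) by auto
  next
    fix i j assume *: "w = v @ [i]" "v = w' @ [j]"
    then show ?thesis using up[of v i] down[of w' j] assms(3,4) by auto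
  next
    fix i j assume *: "v = w @ [i]" "w' = v @ [j]"
    then show ?thesis using up[of v j] down[of w i] assms(3,4) by auto
  qed auto
qed

lemma tdist_descent_exists:
  assumes "valid n v" "valid n c" "v \<noteq> c"
  obtains w where "adj n v w" "tdist c v = Suc (tdist c w)"
proof (cases "\<exists>i z. c = v @ i # z")
  case True
  then obtain i z where c: "c = v @ i # z" by auto
  then have "valid n (v @ [i])" using valid_append[of n "v @ [i]" z] assms(2) by simp
  then show ?thesis using that[of "v @ [i]"] tdist_snoc_prefix[of v i z] c assms(1)
    by (auto simp: adj_def)
next
  case False
  show ?thesis
  proof (cases v rule: rev_cases)
    case Nil
    then show ?thesis using False assms(3) by (cases c) auto
  next
    case (snoc u i)
    have "\<nexists>z. c = u @ i # z"
    proof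
      assume "\<exists>z. c = u @ i # z"
      then obtain z where z: "c = u @ i # z" ..
      then show False using False assms(3) snoc by (cases z) auto
    qed
    then have "tdist c v = Suc (tdist c u)" using tdist_snoc_not_prefix snoc by blast
    moreover have "adj n v u" using snoc assms(1) by (auto simp: adj_def valid_snoc)
    ultimately show ?thesis using that by blast
  qed
qed

lemma tdist_triangle:
  assumes "valid n v" "valid n w"
  shows "tdist a w \<le> tdist a v + tdist v w"
  using assms
proof (induction "tdist v w" arbitrary: w)
  case 0
  then show ?case by (auto simp: tdist_eq_0)
next
  case (Suc k)
  then have "w \<noteq> v" by auto
  then obtain x where x: "adj n w x" "tdist v w = Suc (tdist v x)"
    using tdist_descent_exists[of n w v] Suc.prems by blast
  have "tdist a x \<le> tdist a v + tdist v x" using Suc.hyps x adj_valid[OF x(1)] Suc.prems by auto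
  then show ?case using tdist_adj[OF x(1), of a] x(2) by auto
qed

text \<open>At most one neighbour of \<open>c\<close> is closer to \<open>a\<close> and at most one
  is closer to \<open>a'\<close>; degree 3 leaves a neighbour that is further from both.\<close>

lemma tdist_extend1:
  assumes "n \<ge> 3" "valid n c"
  obtains x where "adj n c x" "tdist a x = Suc (tdist a c)" "tdist a' x = Suc (tdist a' c)"
proof -
  define B where "B a = {w. adj n c w \<and> tdist a c = Suc (tdist a w)}" for a
  have B: "finite (B a) \<and> card (B a) \<le> 1" for a
  proof (cases "B a = {}")
    case False
    then obtain w where "w \<in> B a" by blast
    then have "B a = {w}" using tdist_descent_unique unfolding B_def by blast
    then show ?thesis by simp
  qed simp
  have "card (B a \<union> B a') \<le> 2"
    using card_Un_le[of "B a" "B a'"] B[of a] B[of a'] by linarith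
  then have "\<not> nbrs n c \<subseteq> B a \<union> B a'"
    using card_nbrs[OF assms(2)] assms(1) B card_mono[of "B a \<union> B a'" "nbrs n c"] by fastforce
  then obtain x where "adj n c x" "x \<notin> B a" "x \<notin> B a'" by (auto simp: nbrs_def)
  then show ?thesis using that[of x] tdist_adj[of n c x] unfolding B_def by blast
qed

text \<open>Beyond \<open>c\<close>, the directions towards \<open>c\<close>, \<open>a\<close> and \<open>a'\<close> coincide, so degree 3 suffices.\<close>

lemma tdist_extend:
  assumes "n \<ge> 3" "valid n c" "valid n a" "valid n a'"
  obtains x where "valid n x" "tdist c x = m" "tdist a x = tdist a c + m" "tdist a' x = tdist a' c + m"
proof -
  have "\<exists>x. valid n x \<and> tdist c x = m \<and> tdist a x = tdist a c + m \<and> tdist a' x = tdist a' c + m"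
  proof (induction m)
    case 0
    then show ?case using assms by auto
  next
    case (Suc m)
    then obtain x where x: "valid n x" "tdist c x = m" "tdist a x = tdist a c + m" "tdist a' x = tdist a' c + m"
      by blast
    obtain y where y: "adj n x y" "tdist a y = Suc (tdist a x)" "tdist a' y = Suc (tdist a' x)"
      using tdist_extend1[OF assms(1) x(1)] .
    \<comment> \<open>If \<open>y\<close> were closer to \<open>c\<close> than \<open>x\<close> is,
      the detour through \<open>c\<close> would put it too close to \<open>a\<close>.\<close>
    have "tdist c y = Suc (tdist c x)"
      using tdist_adj[OF y(1), of c] tdist_triangle[of n c y a] adj_valid[OF y(1)] assms(2) x y by auto
    then show ?case using x y adj_valid[OF y(1)] by (intro exI[of _ y]) auto
  qed
  then show ?thesis using that by blast
qed

section \<open>Distance from a fixed vertex along a path\<close>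

lemma path_ascending:
  assumes "is_path n p" "Suc i < length p" "tdist c (p ! Suc i) = Suc (tdist c (p ! i))"
    and "i < j" "j < length p"
  shows "tdist c (p ! j) = Suc (tdist c (p ! (j - 1)))"
  using assms(4,5)
proof (induction j)
  case (Suc j)
  show ?case
  proof (cases "i = j")
    case True
    then show ?thesis using assms by simp
  next
    case False
    then obtain k where k: "j = Suc k" using Suc.prems by (cases j) auto
    have IH: "tdist c (p ! j) = Suc (tdist c (p ! k))" using Suc False k by auto
    have a: "adj n (p ! k) (p ! j)" "adj n (p ! j) (p ! Suc j)" "p ! k \<noteq> p ! Suc j"
      using assms(1) Suc.prems k unfolding is_path_def by auto
    \<comment> \<open>The only neighbour of \<open>p ! j\<close> closer to \<open>c\<close> is
      \<open>p ! k\<close>, and a path does not turn back to it.\<close>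
    show ?thesis
      using tdist_adj[OF a(2), of c] tdist_descent_unique[OF adj_sym[OF a(1)] a(2) IH] a(3) by auto
  qed
qed simp

text \<open>Once the distance to \<open>c\<close> has started to grow along a path it keeps growing.
  So it falls with slope one up to some index \<open>m\<close> and rises with slope one from there;
  \<open>p ! m\<close> is the vertex of the path nearest to \<open>c\<close>. The length estimates
  below all rest on this.\<close>

lemma path_valley:
  assumes p: "is_path n p"
  obtains m where "m < length p"
    "\<And>i. i \<le> m \<Longrightarrow> tdist c (p ! i) = tdist c (p ! m) + (m - i)"
    "\<And>i. m \<le> i \<Longrightarrow> i < length p \<Longrightarrow> tdist c (p ! i) = tdist c (p ! m) + (i - m)"
proof -
  \<comment> \<open>Holds where the path ends or the distance is about to rise; the bottom of the
    valley is the first such index.\<close>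
  define Q where "Q m \<longleftrightarrow> Suc m = length p \<or> (Suc m < length p \<and> tdist c (p ! Suc m) = Suc (tdist c (p ! m)))" for m
  define m where "m = (LEAST m. Q m)"
  have ne: "p \<noteq> []" using p by (simp add: is_path_def)
  have "Q (length p - 1)" using ne by (simp add: Q_def)
  then have Qm: "Q m" and low: "\<And>i. i < m \<Longrightarrow> \<not> Q i"
    unfolding m_def by (auto intro: LeastI dest: not_less_Least)
  have m: "m < length p" using Qm by (auto simp: Q_def)
  have down: "tdist c (p ! i) = Suc (tdist c (p ! Suc i))" if "i < m" for i
  proof -
    have "adj n (p ! i) (p ! Suc i)" using that m p by (auto simp: is_path_def)
    from tdist_adj[OF this, of c] show ?thesis using low[OF that] that m unfolding Q_def by auto
  qed
  have 1: "tdist c (p ! i) = tdist c (p ! m) + (m - i)" if "i \<le> m" for i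
    using that
  proof (induction "m - i" arbitrary: i)
    case (Suc k)
    then have "tdist c (p ! Suc i) = tdist c (p ! m) + (m - Suc i)" "i < m" by auto
    then show ?case using down[of i] by auto
  qed auto
  have 2: "tdist c (p ! i) = tdist c (p ! m) + (i - m)" if "m \<le> i" "i < length p" for i
    using that
  proof (induction "i - m" arbitrary: i)
    case (Suc k)
    then obtain i' where i: "i = Suc i'" by (cases i) auto
    then have "tdist c (p ! i') = tdist c (p ! m) + (i' - m)" using Suc by auto
    moreover have "tdist c (p ! i) = Suc (tdist c (p ! (i - 1)))"
      using path_ascending[OF p, of m c i] Qm Suc.prems Suc.hyps(2) unfolding Q_def by auto
    ultimately show ?case using i Suc.hyps(2) by auto
  qed auto
  show ?thesis using that m 1 2 by blast
qed

text \<open>The distance from \<open>p ! i\<close> vanishes at index \<open>i\<close>, which must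
  therefore be the bottom of the valley.\<close>

lemma path_tdist:
  assumes p: "is_path n p" and ij: "i \<le> j" "j < length p"
  shows "tdist (p ! i) (p ! j) = j - i"
proof -
  obtain m where m: "m < length p"
    "\<And>k. k \<le> m \<Longrightarrow> tdist (p ! i) (p ! k) = tdist (p ! i) (p ! m) + (m - k)"
    "\<And>k. m \<le> k \<Longrightarrow> k < length p \<Longrightarrow> tdist (p ! i) (p ! k) = tdist (p ! i) (p ! m) + (k - m)"
    using path_valley[OF p, of "p ! i"] by blast
  show ?thesis
  proof (cases "i \<le> m")
    case True
    then have "m = i" using m(2)[of i] by auto
    then show ?thesis using m(3)[of j] ij by auto
  next
    case False
    then show ?thesis using m(3)[of i] ij by auto
  qed
qed

lemma path_plen:
  assumes "is_path n p"
  shows "plen p = tdist (hd p) (last p)"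
  using path_tdist[OF assms, of 0 "length p - 1"] assms
  by (auto simp: is_path_def plen_def hd_conv_nth last_conv_nth)

text \<open>The ends lie above the nearest vertex \<open>p ! m\<close> by their distance along the
  path, so the length is at most the sum of their distances to \<open>c\<close>. Length
  \<open>2 * \<rho>\<close> forces \<open>p ! m\<close> to be \<open>c\<close> and to sit in the
  middle.\<close>

lemma path_ball:
  assumes p: "is_path n p" and "tdist c (hd p) \<le> \<rho>" "tdist c (last p) \<le> \<rho>"
  shows "plen p \<le> 2 * \<rho>"
    and "plen p = 2 * \<rho> \<Longrightarrow> path_center p = {c} \<and> tdist c (hd p) = \<rho> \<and> tdist c (last p) = \<rho>"
proof -
  obtain m where m: "m < length p"
    "\<And>k. k \<le> m \<Longrightarrow> tdist c (p ! k) = tdist c (p ! m) + (m - k)"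
    "\<And>k. m \<le> k \<Longrightarrow> k < length p \<Longrightarrow> tdist c (p ! k) = tdist c (p ! m) + (k - m)"
    using path_valley[OF p, of c] by blast
  have ne: "p \<noteq> []" using p by (simp add: is_path_def)
  have h: "tdist c (hd p) = tdist c (p ! m) + m" "tdist c (last p) = tdist c (p ! m) + (length p - 1 - m)"
    using m(2)[of 0] m(3)[of "length p - 1"] m(1) ne by (auto simp: hd_conv_nth last_conv_nth)
  then show "plen p \<le> 2 * \<rho>" using assms m(1) unfolding plen_def by auto
  show "path_center p = {c} \<and> tdist c (hd p) = \<rho> \<and> tdist c (last p) = \<rho>" if L: "plen p = 2 * \<rho>"
  proof -
    have "tdist c (p ! m) = 0" "m = \<rho>" "tdist c (hd p) = \<rho>" "tdist c (last p) = \<rho>"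
      using h L assms(2,3) m(1) unfolding plen_def by auto
    then show ?thesis using L by (auto simp: path_center_def tdist_eq_0)
  qed
qed

lemma path_through:
  assumes p: "is_path n p" and eq: "plen p = tdist c (hd p) + tdist c (last p)"
  shows "p ! tdist c (hd p) = c"
proof -
  obtain m where m: "m < length p"
    "\<And>k. k \<le> m \<Longrightarrow> tdist c (p ! k) = tdist c (p ! m) + (m - k)"
    "\<And>k. m \<le> k \<Longrightarrow> k < length p \<Longrightarrow> tdist c (p ! k) = tdist c (p ! m) + (k - m)"
    using path_valley[OF p, of c] by blast
  have ne: "p \<noteq> []" using p by (simp add: is_path_def)
  have h: "tdist c (hd p) = tdist c (p ! m) + m" "tdist c (last p) = tdist c (p ! m) + (length p - 1 - m)"
    using m(2)[of 0] m(3)[of "length p - 1"] m(1) ne by (auto simp: hd_conv_nth last_conv_nth)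
  then have "tdist c (p ! m) = 0" using eq m(1) unfolding plen_def by auto
  then show ?thesis using h by (simp add: tdist_eq_0)
qed

text \<open>The distances of a vertex from \<open>c\<close> and \<open>c'\<close> differ by one, so
  each end is within \<open>\<rho>\<close> of one of the two. Maximal length forces the ends to
  opposite sides of the edge, and equality in the triangle inequality then puts both
  \<open>c\<close> and \<open>c'\<close> on the path.\<close>

lemma path_edge_ball:
  assumes p: "is_path n p" and cc: "adj n c c'"
    and "tdist c (hd p) \<le> Suc \<rho>" "tdist c (last p) \<le> Suc \<rho>" "tdist c' (hd p) \<le> Suc \<rho>" "tdist c' (last p) \<le> Suc \<rho>"
  shows "plen p \<le> Suc (2 * \<rho>)"
    and "plen p = Suc (2 * \<rho>) \<Longrightarrow> path_center p = {c, c'}"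
proof -
  have pl: "plen p \<le> tdist z (hd p) + tdist z (last p)" if "valid n z" for z
  proof -
    have "valid n (hd p)" "valid n (last p)" using p by (auto simp: is_path_def)
    then show ?thesis
      using tdist_triangle[OF that \<open>valid n (last p)\<close>, of "hd p"] path_plen[OF p] tdist_sym by metis
  qed
  have v: "valid n c" "valid n c'" using adj_valid[OF cc] by auto
  have step: "tdist c x = Suc (tdist c' x) \<or> tdist c' x = Suc (tdist c x)" for x
    using tdist_adj[OF cc, of x] tdist_sym by metis
  note facts = pl[OF v(1)] pl[OF v(2)] step[of "hd p"] step[of "last p"] assms(3-6)
  show "plen p \<le> Suc (2 * \<rho>)" using facts by linarith
  assume L: "plen p = Suc (2 * \<rho>)"
  have "plen p = tdist c (hd p) + tdist c (last p) \<and> plen p = tdist c' (hd p) + tdist c' (last p)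
     \<and> (tdist c (hd p) = \<rho> \<and> tdist c' (hd p) = Suc \<rho> \<or> tdist c (hd p) = Suc \<rho> \<and> tdist c' (hd p) = \<rho>)"
    using facts L by linarith
  then have "p ! \<rho> = c \<and> p ! Suc \<rho> = c' \<or> p ! Suc \<rho> = c \<and> p ! \<rho> = c'"
    using path_through[OF p, of c] path_through[OF p, of c'] by fastforce
  then show "path_center p = {c, c'}" unfolding path_center_def L by auto
qed

lemma path_tl:
  assumes "is_path n (x # p)" "p \<noteq> []"
  shows "is_path n p"
  using assms unfolding is_path_def by force

lemma path_Cons:
  assumes "is_path n p" "adj n x (hd p)" "length p \<ge> 2 \<Longrightarrow> p ! 1 \<noteq> x"
  shows "is_path n (x # p)"
proof -
  have ne: "p \<noteq> []" using assms(1) by (simp add: is_path_def)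
  show ?thesis
    using assms adj_valid[OF assms(2)] ne unfolding is_path_def
    by (auto simp: nth_Cons hd_conv_nth split: nat.splits)
qed

text \<open>A step back to the second vertex of the path is absorbed by dropping the head, so a walk
  becomes a non-backtracking path inside the same set.\<close>

lemma path_of_rtrancl:
  assumes "(u, v) \<in> {(x, y). adj n x y \<and> x \<in> S \<and> y \<in> S}\<^sup>*" "v \<in> S" "valid n v"
  obtains p where "is_path n p" "set p \<subseteq> S" "hd p = u" "last p = v"
proof -
  have "\<exists>p. is_path n p \<and> set p \<subseteq> S \<and> hd p = u \<and> last p = v"
    using assms(1)
  proof (induction rule: converse_rtrancl_induct)
    case base
    then show ?case using assms by (intro exI[of _ "[v]"]) (auto simp: is_path_def)
  next
    case (step x y)
    then obtain p where p: "is_path n p" "set p \<subseteq> S" "hd p = y" "last p = v" by blast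
    have ne: "p \<noteq> []" using p by (simp add: is_path_def)
    show ?case
    proof (cases "length p \<ge> 2 \<and> p ! 1 = x")
      case True
      then obtain z q where q: "p = z # q" "q \<noteq> []"
        by (cases p; cases "tl p") auto
      then show ?thesis using p True path_tl[of n z q] by (intro exI[of _ q]) (auto simp: hd_conv_nth)
    next
      case False
      then have "is_path n (x # p)" using path_Cons[OF p(1)] step p(3) by auto
      then show ?thesis using p step ne by (intro exI[of _ "x # p"]) auto
    qed
  qed
  then show ?thesis using that by blast
qed

section \<open>Linear algebra of finitely supported functions\<close>

text \<open>The coordinate space \<open>k^S\<close> over an arbitrary index type. Direct sums are
  again of this form, indexed by pairs or by a sum type.\<close>

definition fun_supp :: "'b set \<Rightarrow> ('b \<Rightarrow> 'a::field) set" where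
  "fun_supp S = {x. \<forall>b. b \<notin> S \<longrightarrow> x b = 0}"

definition subsp :: "('b \<Rightarrow> 'a::field) set \<Rightarrow> bool" where
  "subsp U \<longleftrightarrow> (\<lambda>_. 0) \<in> U \<and> (\<forall>x\<in>U. \<forall>y\<in>U. (\<lambda>b. x b + y b) \<in> U) \<and> (\<forall>c. \<forall>x\<in>U. (\<lambda>b. c * x b) \<in> U)"

definition linmap :: "(('b \<Rightarrow> 'a::field) \<Rightarrow> ('c \<Rightarrow> 'a)) \<Rightarrow> bool" where
  "linmap f \<longleftrightarrow> (\<forall>x y. f (\<lambda>b. x b + y b) = (\<lambda>c. f x c + f y c)) \<and> (\<forall>k x. f (\<lambda>b. k * x b) = (\<lambda>c. k * f x c))"

lemma linmap_add: "linmap f \<Longrightarrow> f (\<lambda>b. x b + y b) = (\<lambda>c. f x c + f y c)"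
  and linmap_scale: "linmap f \<Longrightarrow> f (\<lambda>b. k * x b) = (\<lambda>c. k * f x c)"
  by (simp_all add: linmap_def)

lemma linmap_zero: "linmap f \<Longrightarrow> f (\<lambda>_. 0) = (\<lambda>_. 0)"
  using linmap_scale[of f 0 "\<lambda>_. 0"] by simp

lemma linmap_diff: "linmap f \<Longrightarrow> f (\<lambda>b. x b - y b) = (\<lambda>c. f x c - f y c)"
  using linmap_add[of f x "\<lambda>b. -1 * y b"] linmap_scale[of f "-1" y] by simp

lemma linmap_sum:
  "linmap f \<Longrightarrow> f (\<lambda>b. \<Sum>j\<in>J. k j * e j b) = (\<lambda>c. \<Sum>j\<in>J. k j * f (e j) c)"
proof (induction J rule: infinite_finite_induct)
  case (insert j J)
  then show ?case
    using linmap_add[of f "\<lambda>b. k j * e j b" "\<lambda>b. \<Sum>j\<in>J. k j * e j b"] linmap_scale[of f "k j" "e j"]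
    by simp
qed (simp_all add: linmap_zero)

lemma subsp_zero: "subsp U \<Longrightarrow> (\<lambda>_. 0) \<in> U"
  and subsp_add: "subsp U \<Longrightarrow> x \<in> U \<Longrightarrow> y \<in> U \<Longrightarrow> (\<lambda>b. x b + y b) \<in> U"
  and subsp_scale: "subsp U \<Longrightarrow> x \<in> U \<Longrightarrow> (\<lambda>b. c * x b) \<in> U"
  by (simp_all add: subsp_def)

lemma subsp_diff: "subsp U \<Longrightarrow> x \<in> U \<Longrightarrow> y \<in> U \<Longrightarrow> (\<lambda>b. x b - k * y b) \<in> U"
  using subsp_add[of U x "\<lambda>b. (- k) * y b"] subsp_scale[of U y "- k"] by simp

lemma fun_supp_mono: "S \<subseteq> T \<Longrightarrow> fun_supp S \<subseteq> fun_supp T"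
  by (auto simp: fun_supp_def)

text \<open>The columns of \<open>A\<close> are a basis. One coordinate \<open>s\<close> is
  eliminated at a time: either \<open>U\<close> vanishes at \<open>s\<close>, or a vector
  \<open>u0\<close> with \<open>u0 s \<noteq> 0\<close> spans a complement of the part of
  \<open>U\<close> that vanishes there.\<close>

lemma subspace_basis:
  fixes U :: "('b \<Rightarrow> 'a::field) set"
  assumes "finite S" "subsp U" "U \<subseteq> fun_supp S"
  obtains q :: nat and A :: "'b \<Rightarrow> nat \<Rightarrow> 'a"
  where "\<And>x. (\<lambda>b. \<Sum>j<q. A b j * x j) \<in> U"
    "\<And>u. u \<in> U \<Longrightarrow> \<exists>x\<in>fun_supp {..<q}. u = (\<lambda>b. \<Sum>j<q. A b j * x j)"
    "\<And>x. x \<in> fun_supp {..<q} \<Longrightarrow> (\<lambda>b. \<Sum>j<q. A b j * x j) = (\<lambda>_. 0) \<Longrightarrow> x = (\<lambda>_. 0)"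
proof -
  have "\<exists>(q::nat) (A :: 'b \<Rightarrow> nat \<Rightarrow> 'a). (\<forall>x. (\<lambda>b. \<Sum>j<q. A b j * x j) \<in> U) \<and>
      (\<forall>u\<in>U. \<exists>x\<in>fun_supp {..<q}. u = (\<lambda>b. \<Sum>j<q. A b j * x j)) \<and>
      (\<forall>x\<in>fun_supp {..<q}. (\<lambda>b. \<Sum>j<q. A b j * x j) = (\<lambda>_. 0) \<longrightarrow> x = (\<lambda>_. 0))"
    using assms
  proof (induction S arbitrary: U rule: finite_induct)
    case empty
    then have "U = {\<lambda>_. 0}" by (auto simp: fun_supp_def subsp_def)
    then show ?case by (intro exI[of _ 0]) (auto simp: fun_supp_def)
  next
    case (insert s S)
    define U' where "U' = U \<inter> fun_supp S"
    have "subsp U'" "U' \<subseteq> fun_supp S" using insert.prems unfolding U'_def subsp_def fun_supp_def by auto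
    from insert.IH[OF this] obtain q and A :: "'b \<Rightarrow> nat \<Rightarrow> 'a" where
      A: "\<forall>x. (\<lambda>b. \<Sum>j<q. A b j * x j) \<in> U'"
      "\<forall>u\<in>U'. \<exists>x\<in>fun_supp {..<q}. u = (\<lambda>b. \<Sum>j<q. A b j * x j)"
      "\<forall>x\<in>fun_supp {..<q}. (\<lambda>b. \<Sum>j<q. A b j * x j) = (\<lambda>_. 0) \<longrightarrow> x = (\<lambda>_. 0)"
      by blast
    show ?case
    proof (cases "\<forall>u\<in>U. u s = 0")
      case True
      then have "U' = U" using insert.prems unfolding U'_def fun_supp_def by fastforce
      then show ?thesis using A by blast
    next
      case False
      then obtain u0 where u0: "u0 \<in> U" "u0 s \<noteq> 0" by blast
      define A' where "A' b j = (if j = q then u0 b else A b j)" for b j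
      have A': "(\<lambda>b. \<Sum>j<Suc q. A' b j * x j) = (\<lambda>b. (\<Sum>j<q. A b j * x j) - (- x q) * u0 b)" for x
        by (auto simp: A'_def)
      have As: "(\<Sum>j<q. A s j * x j) = 0" for x
        using A(1)[rule_format, of x] insert.hyps unfolding U'_def fun_supp_def by auto
      have 1: "(\<lambda>b. \<Sum>j<Suc q. A' b j * x j) \<in> U" for x
        unfolding A' using A(1) u0 insert.prems unfolding U'_def by (intro subsp_diff) auto
      have 2: "\<exists>x\<in>fun_supp {..<Suc q}. u = (\<lambda>b. \<Sum>j<Suc q. A' b j * x j)" if u: "u \<in> U" for u
      proof -
        define k where "k = u s / u0 s"
        have "(\<lambda>b. u b - k * u0 b) \<in> U" using subsp_diff u u0 insert.prems by blast
        moreover have "(\<lambda>b. u b - k * u0 b) \<in> fun_supp S"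
        proof -
          have "u b - k * u0 b = 0" if "b \<notin> S" for b
          proof (cases "b = s")
            case True
            then show ?thesis using u0 by (simp add: k_def)
          next
            case False
            then have "u b = 0" "u0 b = 0" using that u u0 insert.prems(2) unfolding fun_supp_def by auto
            then show ?thesis by simp
          qed
          then show ?thesis by (simp add: fun_supp_def)
        qed
        ultimately obtain x where x: "x \<in> fun_supp {..<q}" "(\<lambda>b. u b - k * u0 b) = (\<lambda>b. \<Sum>j<q. A b j * x j)"
          using A(2) unfolding U'_def by blast
        define x' where "x' = x(q := k)"
        have "u b = (\<Sum>j<Suc q. A' b j * x' j)" for b
        proof -
          have "(\<Sum>j<q. A' b j * x' j) = (\<Sum>j<q. A b j * x j)"
            by (rule sum.cong) (auto simp: A'_def x'_def)
          then show ?thesis using fun_cong[OF x(2), of b] by (simp add: A'_def x'_def algebra_simps)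
        qed
        moreover have "x' \<in> fun_supp {..<Suc q}" using x(1) by (auto simp: x'_def fun_supp_def)
        ultimately show ?thesis by blast
      qed
      have 3: "x = (\<lambda>_. 0)" if x: "x \<in> fun_supp {..<Suc q}" "(\<lambda>b. \<Sum>j<Suc q. A' b j * x j) = (\<lambda>_. 0)" for x
      proof -
        have eq: "(\<Sum>j<q. A b j * x j) + x q * u0 b = 0" for b
          using fun_cong[OF trans[OF A'[symmetric] x(2)], of b] by simp
        have q0: "x q = 0" using eq[of s] As u0 by simp
        then have "x \<in> fun_supp {..<q}" using x(1) unfolding fun_supp_def by (auto simp: not_less less_Suc_eq)
        moreover have "(\<lambda>b. \<Sum>j<q. A b j * x j) = (\<lambda>_. 0)" using eq q0 by auto
        ultimately show ?thesis using A(3) by blast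
      qed
      show ?thesis using 1 2 3 by (intro exI[of _ "Suc q"] exI[of _ A']) blast
    qed
  qed
  then show ?thesis using that by blast
qed

text \<open>Dual to \<open>subspace_basis\<close>: \<open>B\<close> is a surjection with kernel
  \<open>U\<close>. If \<open>U\<close> vanishes at the new coordinate \<open>s\<close>, that
  coordinate becomes one more row; otherwise vectors are first moved along some \<open>u0\<close> in
  \<open>U\<close> until they vanish at \<open>s\<close>.\<close>

lemma quotient_map:
  fixes U :: "('b \<Rightarrow> 'a::field) set"
  assumes "finite S" "subsp U" "U \<subseteq> fun_supp S"
  obtains q :: nat and B :: "nat \<Rightarrow> 'b \<Rightarrow> 'a"
  where "\<And>z. \<exists>y\<in>fun_supp S. \<forall>i<q. (\<Sum>b\<in>S. B i b * y b) = z i"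
    "\<And>y. y \<in> fun_supp S \<Longrightarrow> y \<in> U \<longleftrightarrow> (\<forall>i<q. (\<Sum>b\<in>S. B i b * y b) = 0)"
proof -
  have "\<exists>(q::nat) (B :: nat \<Rightarrow> 'b \<Rightarrow> 'a). (\<forall>z. \<exists>y\<in>fun_supp S. \<forall>i<q. (\<Sum>b\<in>S. B i b * y b) = z i) \<and>
      (\<forall>y\<in>fun_supp S. y \<in> U \<longleftrightarrow> (\<forall>i<q. (\<Sum>b\<in>S. B i b * y b) = 0))"
    using assms
  proof (induction S arbitrary: U rule: finite_induct)
    case empty
    then have "U = {\<lambda>_. 0}" by (auto simp: fun_supp_def subsp_def)
    then show ?case by (intro exI[of _ 0]) (auto simp: fun_supp_def)
  next
    case (insert s S)
    define U' where "U' = U \<inter> fun_supp S"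
    have "subsp U'" "U' \<subseteq> fun_supp S" using insert.prems unfolding U'_def subsp_def fun_supp_def by auto
    from insert.IH[OF this] obtain q and B :: "nat \<Rightarrow> 'b \<Rightarrow> 'a" where
      B: "\<And>z. \<exists>y\<in>fun_supp S. \<forall>i<q. (\<Sum>b\<in>S. B i b * y b) = z i"
      "\<And>y. y \<in> fun_supp S \<Longrightarrow> y \<in> U' \<longleftrightarrow> (\<forall>i<q. (\<Sum>b\<in>S. B i b * y b) = 0)"
      by blast
    have sub: "fun_supp S \<subseteq> fun_supp (insert s S)" by (rule fun_supp_mono) auto
    have S_sum: "(\<Sum>b\<in>S. f b * (y(s := c)) b) = (\<Sum>b\<in>S. f b * y b)" for f y and c :: 'a
      using insert.hyps by (intro sum.cong) auto
    show ?case
    proof (cases "\<forall>u\<in>U. u s = 0")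
      case True
      then have UU: "U' = U" using insert.prems unfolding U'_def fun_supp_def by fastforce
      define B' where "B' i b = (if i = q then (if b = s then 1 else 0) else if b = s then 0 else B i b)" for i b
      have B'q: "(\<Sum>b\<in>insert s S. B' q b * y b) = y s" for y
      proof -
        have "(\<Sum>b\<in>S. B' q b * y b) = 0" using insert.hyps by (intro sum.neutral) (auto simp: B'_def)
        then show ?thesis using insert.hyps by (simp add: B'_def)
      qed
      have B'i: "(\<Sum>b\<in>insert s S. B' i b * y b) = (\<Sum>b\<in>S. B i b * y b)" if "i < q" for i y
      proof -
        have "(\<Sum>b\<in>S. B' i b * y b) = (\<Sum>b\<in>S. B i b * y b)"
          using insert.hyps that by (intro sum.cong) (auto simp: B'_def)
        then show ?thesis using insert.hyps that by (simp add: B'_def)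
      qed
      have 1: "\<exists>y\<in>fun_supp (insert s S). \<forall>i<Suc q. (\<Sum>b\<in>insert s S. B' i b * y b) = z i" for z
      proof -
        obtain y where y: "y \<in> fun_supp S" "\<forall>i<q. (\<Sum>b\<in>S. B i b * y b) = z i" using B(1) by blast
        show ?thesis
        proof (intro bexI[of _ "y(s := z q)"] allI impI)
          fix i assume "i < Suc q"
          then show "(\<Sum>b\<in>insert s S. B' i b * (y(s := z q)) b) = z i"
            using y B'q B'i by (cases "i = q") (simp_all only: S_sum, auto)
        qed (use y in \<open>auto simp: fun_supp_def\<close>)
      qed
      have 2: "y \<in> U \<longleftrightarrow> (\<forall>i<Suc q. (\<Sum>b\<in>insert s S. B' i b * y b) = 0)" if y: "y \<in> fun_supp (insert s S)" for y
      proof -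
        have "(\<forall>i<Suc q. (\<Sum>b\<in>insert s S. B' i b * y b) = 0) \<longleftrightarrow> y s = 0 \<and> (\<forall>i<q. (\<Sum>b\<in>S. B i b * y b) = 0)"
          unfolding All_less_Suc using B'q[of y] B'i[of _ y] by auto
        also have "\<dots> \<longleftrightarrow> y s = 0 \<and> y \<in> U"
        proof (cases "y s = 0")
          case True
          then have "y \<in> fun_supp S" using y by (auto simp: fun_supp_def)
          then show ?thesis using B(2) UU by blast
        qed simp
        finally show ?thesis using True by blast
      qed
      show ?thesis using 1 2 by (intro exI[of _ "Suc q"] exI[of _ B']) blast
    next
      case False
      then obtain u0 where u0: "u0 \<in> U" "u0 s \<noteq> 0" by blast
      \<comment> \<open>The entry at \<open>s\<close> is the one that makes \<open>B'\<close> the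
        composition of \<open>B\<close> with the projection \<open>\<pi>\<close> along
        \<open>u0\<close>.\<close>
      define B' where "B' i b = (if b = s then - (\<Sum>c\<in>S. B i c * u0 c) / u0 s else B i b)" for i b
      define \<pi> where "\<pi> y = (\<lambda>b. y b - (y s / u0 s) * u0 b)" for y
      have \<pi>: "\<pi> y \<in> fun_supp S" if "y \<in> fun_supp (insert s S)" for y
      proof -
        have "\<pi> y b = 0" if "b \<notin> S" for b
          using \<open>y \<in> fun_supp (insert s S)\<close> u0 insert.prems(2) that unfolding \<pi>_def fun_supp_def
          by (cases "b = s") auto
        then show ?thesis by (simp add: fun_supp_def)
      qed
      have B': "(\<Sum>b\<in>insert s S. B' i b * y b) = (\<Sum>b\<in>S. B i b * \<pi> y b)" for i y
      proof -
        have "(\<Sum>b\<in>S. B' i b * y b) = (\<Sum>b\<in>S. B i b * y b)"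
          using insert.hyps by (intro sum.cong) (auto simp: B'_def)
        moreover have "(\<Sum>b\<in>S. B i b * \<pi> y b)
          = (\<Sum>b\<in>S. B i b * y b) - (y s / u0 s) * (\<Sum>b\<in>S. B i b * u0 b)"
          unfolding \<pi>_def sum_distrib_left sum_subtractf[symmetric]
          by (intro sum.cong) (auto simp: algebra_simps)
        ultimately show ?thesis using insert.hyps by (simp add: B'_def)
      qed
      have 1: "\<exists>y\<in>fun_supp (insert s S). \<forall>i<q. (\<Sum>b\<in>insert s S. B' i b * y b) = z i" for z
      proof -
        obtain y where y: "y \<in> fun_supp S" "\<forall>i<q. (\<Sum>b\<in>S. B i b * y b) = z i" using B(1) by blast
        then have "\<pi> y = y" using insert.hyps by (auto simp: \<pi>_def fun_supp_def)
        then have "\<forall>i<q. (\<Sum>b\<in>insert s S. B' i b * y b) = z i" using y B'[of _ y] by simp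
        then show ?thesis using y(1) sub by blast
      qed
      have 2: "y \<in> U \<longleftrightarrow> (\<forall>i<q. (\<Sum>b\<in>insert s S. B' i b * y b) = 0)" if y: "y \<in> fun_supp (insert s S)" for y
      proof -
        have "y \<in> U" if "\<pi> y \<in> U"
          using subsp_diff[OF insert.prems(1) that u0(1), of "- (y s / u0 s)"] by (simp add: \<pi>_def)
        moreover have "\<pi> y \<in> U" if "y \<in> U"
          unfolding \<pi>_def using subsp_diff[OF insert.prems(1) that u0(1)] .
        ultimately have "y \<in> U \<longleftrightarrow> \<pi> y \<in> U'" using \<pi>[OF y] unfolding U'_def by blast
        then show ?thesis using B(2)[OF \<pi>[OF y]] B' by simp
      qed
      show ?thesis using 1 2 by (intro exI[of _ q] exI[of _ B']) blast
    qed
  qed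
  then show ?thesis using that by blast
qed

text \<open>Some row of the quotient map by \<open>U\<close> is nonzero on \<open>x\<close>; it only
  has to be normalised.\<close>

lemma separating_functional:
  fixes U :: "('b \<Rightarrow> 'a::field) set"
  assumes "finite S" "subsp U" "U \<subseteq> fun_supp S" "x \<in> fun_supp S" "x \<notin> U"
  obtains \<phi> :: "'b \<Rightarrow> 'a" where "\<And>u. u \<in> U \<Longrightarrow> (\<Sum>b\<in>S. \<phi> b * u b) = 0" "(\<Sum>b\<in>S. \<phi> b * x b) = 1"
proof -
  obtain q and B :: "nat \<Rightarrow> 'b \<Rightarrow> 'a" where
    B: "\<And>y. y \<in> fun_supp S \<Longrightarrow> y \<in> U \<longleftrightarrow> (\<forall>i<q. (\<Sum>b\<in>S. B i b * y b) = 0)"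
    using quotient_map[OF assms(1-3)] by metis
  then obtain i where i: "i < q" "(\<Sum>b\<in>S. B i b * x b) \<noteq> 0" using assms(4,5) by blast
  show ?thesis
  proof (rule that[of "\<lambda>b. B i b / (\<Sum>b\<in>S. B i b * x b)"])
    fix u assume "u \<in> U"
    then have "(\<Sum>b\<in>S. B i b * u b) = 0" using B assms(3) i(1) by blast
    then show "(\<Sum>b\<in>S. B i b / (\<Sum>b\<in>S. B i b * x b) * u b) = 0"
      by (simp flip: sum_divide_distrib)
  qed (use i(2) in \<open>simp flip: sum_divide_distrib\<close>)
qed

text \<open>Dimension comparison by elimination. If the coordinate \<open>t\<close> of the target is
  not always zero, some unit vector has \<open>f (e s) t \<noteq> 0\<close>; subtracting multiples
  of it removes \<open>t\<close> from the target at the price of \<open>s\<close> in the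
  source.\<close>

lemma card_le_of_linear_injection:
  fixes f :: "('b \<Rightarrow> 'a::field) \<Rightarrow> ('c \<Rightarrow> 'a)"
  assumes "finite T" "finite S" "linmap f" "\<And>x. x \<in> fun_supp S \<Longrightarrow> f x \<in> fun_supp T"
    "\<And>x. x \<in> fun_supp S \<Longrightarrow> f x = (\<lambda>_. 0) \<Longrightarrow> x = (\<lambda>_. 0)"
  shows "card S \<le> card T"
  using assms
proof (induction T arbitrary: S f rule: finite_induct)
  case empty
  have "S = {}"
  proof (rule ccontr)
    assume "S \<noteq> {}"
    then obtain s where s: "s \<in> S" by blast
    define x :: "'b \<Rightarrow> 'a" where "x = (\<lambda>b. if b = s then 1 else 0)"
    have "x \<in> fun_supp S" using s by (auto simp: x_def fun_supp_def)
    then have "x = (\<lambda>_. 0)" using empty.prems(3,4)[of x] by (auto simp: fun_supp_def)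
    then show False by (auto simp: x_def dest: fun_cong[of _ _ s])
  qed
  then show ?case by simp
next
  case (insert t T)
  define e :: "'b \<Rightarrow> 'b \<Rightarrow> 'a" where "e s = (\<lambda>b. if b = s then 1 else 0)" for s
  show ?case
  proof (cases "\<forall>x\<in>fun_supp S. f x t = 0")
    case True
    have "f x \<in> fun_supp T" if "x \<in> fun_supp S" for x
      using insert.prems(3)[OF that] True that unfolding fun_supp_def by auto
    then have "card S \<le> card T" using insert.IH[of S f] insert.prems by blast
    then show ?thesis using insert.hyps by simp
  next
    case False
    then obtain x where x: "x \<in> fun_supp S" "f x t \<noteq> 0" by blast
    have "x = (\<lambda>b. \<Sum>s\<in>S. x s * e s b)"
    proof
      fix b
      show "x b = (\<Sum>s\<in>S. x s * e s b)"
        using x(1) insert.prems(1) by (cases "b \<in> S") (auto simp: e_def fun_supp_def if_distrib sum.delta cong: if_cong)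
    qed
    then have "f x = (\<lambda>c. \<Sum>s\<in>S. x s * f (e s) c)" using linmap_sum[OF insert.prems(2)] by metis
    then have "\<exists>s\<in>S. f (e s) t \<noteq> 0" using x(2) by (metis (mono_tags, lifting) mult_zero_right sum.neutral)
    then obtain s where s: "s \<in> S" "f (e s) t \<noteq> 0" by blast
    define g where "g x = f (\<lambda>b. x b - (f x t / f (e s) t) * e s b)" for x
    have g: "g x = (\<lambda>c. f x c - (f x t / f (e s) t) * f (e s) c)" for x
      unfolding g_def linmap_diff[OF insert.prems(2)] linmap_scale[OF insert.prems(2)] ..
    have "linmap g" unfolding linmap_def g linmap_add[OF insert.prems(2)] linmap_scale[OF insert.prems(2)]
      by (simp add: fun_eq_iff add_divide_distrib algebra_simps)
    moreover have proj: "(\<lambda>b. x b - k * e s b) \<in> fun_supp S" if "x \<in> fun_supp (S - {s})" for x k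
      using that s(1) by (auto simp: fun_supp_def e_def)
    have "g x \<in> fun_supp T" if "x \<in> fun_supp (S - {s})" for x
    proof -
      have "g x \<in> fun_supp (insert t T)" unfolding g_def using insert.prems(3) proj[OF that] by blast
      moreover have "g x t = 0" using s(2) unfolding g by simp
      ultimately show ?thesis by (auto simp: fun_supp_def)
    qed
    moreover have "x = (\<lambda>_. 0)" if x: "x \<in> fun_supp (S - {s})" "g x = (\<lambda>_. 0)" for x
    proof -
      have z: "(\<lambda>b. x b - (f x t / f (e s) t) * e s b) = (\<lambda>_. 0)"
        using insert.prems(4)[OF proj[OF x(1)]] x(2) unfolding g_def by blast
      have "x s = 0" using x(1) by (auto simp: fun_supp_def)
      then have fx0: "f x t / f (e s) t = 0" using fun_cong[OF z, of s] by (simp add: e_def)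
      show ?thesis
      proof
        fix b show "x b = 0"
          using fun_cong[OF z, of b] unfolding fx0 by simp
      qed
    qed
    ultimately have "card (S - {s}) \<le> card T" using insert.IH[of "S - {s}" g] insert.prems(1) by blast
    then show ?thesis using s(1) insert.hyps insert.prems(1) by (simp add: card_Diff_singleton)
  qed
qed

text \<open>A section \<open>l\<close> of \<open>g\<close>, chosen on unit vectors, makes
  \<open>h\<close> a bijection from the coordinate space on the disjoint sum of \<open>R\<close> and
  \<open>T\<close> to the one on \<open>S\<close>. The injection bound is applied twice, to
  \<open>h\<close> and to a linear right inverse \<open>k\<close> of \<open>h\<close>.\<close>

lemma card_eq_of_exact:
  fixes f :: "('b \<Rightarrow> 'a::field) \<Rightarrow> ('c \<Rightarrow> 'a)" and g :: "('c \<Rightarrow> 'a) \<Rightarrow> ('d \<Rightarrow> 'a)"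
  assumes fin: "finite R" "finite S" "finite T" and lin: "linmap f" "linmap g"
    and f: "\<And>x. x \<in> fun_supp R \<Longrightarrow> f x \<in> fun_supp S" "\<And>x. x \<in> fun_supp R \<Longrightarrow> f x = (\<lambda>_. 0) \<Longrightarrow> x = (\<lambda>_. 0)"
    and g: "\<And>y. y \<in> fun_supp S \<Longrightarrow> g y \<in> fun_supp T" "\<And>z. z \<in> fun_supp T \<Longrightarrow> \<exists>y\<in>fun_supp S. g y = z"
    and gf: "\<And>x. x \<in> fun_supp R \<Longrightarrow> g (f x) = (\<lambda>_. 0)"
    and ex: "\<And>y. y \<in> fun_supp S \<Longrightarrow> g y = (\<lambda>_. 0) \<Longrightarrow> \<exists>x\<in>fun_supp R. f x = y"
  shows "card S = card R + card T"
proof -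
  define e :: "'d \<Rightarrow> 'd \<Rightarrow> 'a" where "e t = (\<lambda>b. if b = t then 1 else 0)" for t
  have "\<exists>y\<in>fun_supp S. g y = e t" if "t \<in> T" for t
    using that by (intro g(2)) (auto simp: fun_supp_def e_def)
  then obtain l where l: "\<And>t. t \<in> T \<Longrightarrow> l t \<in> fun_supp S" "\<And>t. t \<in> T \<Longrightarrow> g (l t) = e t" by metis
  define h :: "('b + 'd \<Rightarrow> 'a) \<Rightarrow> ('c \<Rightarrow> 'a)"
    where "h x = (\<lambda>c. f (\<lambda>b. x (Inl b)) c + (\<Sum>t\<in>T. x (Inr t) * l t c))" for x
  have hlin: "linmap h" unfolding linmap_def h_def
    using linmap_add[OF lin(1)] linmap_scale[OF lin(1)]
    by (simp add: fun_eq_iff sum.distrib sum_distrib_left algebra_simps)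
  define I where "I = Inl ` R \<union> Inr ` T"
  have fI: "finite I" using fin by (simp add: I_def)
  have "card I = card (Inl ` R :: ('b + 'd) set) + card (Inr ` T :: ('b + 'd) set)"
    unfolding I_def using fin by (intro card_Un_disjoint) auto
  then have cI: "card I = card R + card T" by (simp add: card_image)
  have left: "(\<lambda>b. x (Inl b)) \<in> fun_supp R" if "x \<in> fun_supp I" for x :: "'b + 'd \<Rightarrow> 'a"
    using that by (auto simp: fun_supp_def I_def)
  have gh: "g (h x) = (\<lambda>d. if d \<in> T then x (Inr d) else 0)" if "x \<in> fun_supp I" for x
  proof -
    have "g (h x) = (\<lambda>d. \<Sum>t\<in>T. x (Inr t) * g (l t) d)"
      unfolding h_def linmap_add[OF lin(2)] gf[OF left[OF that]] linmap_sum[OF lin(2)] by simp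
    also have "\<dots> = (\<lambda>d. \<Sum>t\<in>T. x (Inr t) * e t d)" using l(2) by (auto intro!: sum.cong)
    also have "\<dots> = (\<lambda>d. if d \<in> T then x (Inr d) else 0)"
      using fin(3) by (auto simp: e_def if_distrib sum.delta' cong: if_cong)
    finally show ?thesis .
  qed
  have hfs: "h x \<in> fun_supp S" if "x \<in> fun_supp I" for x
  proof -
    have "f (\<lambda>b. x (Inl b)) c = 0" if "c \<notin> S" for c using f(1)[OF left[OF \<open>x \<in> fun_supp I\<close>]] that by (auto simp: fun_supp_def)
    moreover have "(\<Sum>t\<in>T. x (Inr t) * l t c) = 0" if "c \<notin> S" for c
      using l(1) that by (intro sum.neutral) (auto simp: fun_supp_def)
    ultimately show ?thesis by (simp add: fun_supp_def h_def)
  qed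
  have hinj: "x = (\<lambda>_. 0)" if x: "x \<in> fun_supp I" "h x = (\<lambda>_. 0)" for x
  proof -
    have r: "x (Inr d) = 0" for d
    proof (cases "d \<in> T")
      case True
      have "g (h x) d = 0" using linmap_zero[OF lin(2)] x(2) by simp
      then show ?thesis using gh[OF x(1)] True by simp
    next
      case False
      then show ?thesis using x(1) by (auto simp: fun_supp_def I_def)
    qed
    then have "f (\<lambda>b. x (Inl b)) = (\<lambda>_. 0)" using x(2) unfolding h_def by simp
    then have "(\<lambda>b. x (Inl b)) = (\<lambda>_. 0)" using f(2) left x by blast
    then have "x (Inl b) = 0" for b by (auto dest: fun_cong)
    then have "x c = 0" for c using r by (cases c) auto
    then show ?thesis by auto
  qed
  have hsurj: "\<exists>x\<in>fun_supp I. h x = y" if y: "y \<in> fun_supp S" for y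
  proof -
    \<comment> \<open>Subtracting the lift of \<open>g y\<close> leaves an element of the kernel of
      \<open>g\<close>, which exactness puts into the image of \<open>f\<close>.\<close>
    define z where "z = (\<lambda>c. y c - (\<Sum>t\<in>T. g y t * l t c))"
    have "(\<Sum>t\<in>T. g y t * l t c) = 0" if "c \<notin> S" for c
      using l(1) that by (intro sum.neutral) (auto simp: fun_supp_def)
    then have zS: "z \<in> fun_supp S" using y by (auto simp: z_def fun_supp_def)
    have "g z = (\<lambda>d. g y d - (\<Sum>t\<in>T. g y t * g (l t) d))"
      unfolding z_def linmap_diff[OF lin(2)] linmap_sum[OF lin(2)] ..
    also have "\<dots> = (\<lambda>d. g y d - (\<Sum>t\<in>T. g y t * e t d))" using l(2) by (auto intro!: sum.cong)
    also have "\<dots> = (\<lambda>_. 0)"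
      using fin(3) g(1)[OF y] by (auto simp: e_def fun_supp_def if_distrib sum.delta' fun_eq_iff cong: if_cong)
    finally obtain x where x: "x \<in> fun_supp R" "f x = z" using ex zS by blast
    define w where "w = (\<lambda>c. case c of Inl b \<Rightarrow> x b | Inr t \<Rightarrow> g y t)"
    have "w \<in> fun_supp I" using x(1) g(1)[OF y] unfolding w_def fun_supp_def I_def by (auto split: sum.splits)
    moreover have "h w = y" unfolding h_def w_def using x(2) by (simp add: z_def)
    ultimately show ?thesis by blast
  qed
  have le: "card I \<le> card S"
    using card_le_of_linear_injection[OF fin(2) fI hlin hfs hinj] .
  define e' :: "'c \<Rightarrow> 'c \<Rightarrow> 'a" where "e' s = (\<lambda>b. if b = s then 1 else 0)" for s
  have "\<exists>x\<in>fun_supp I. h x = e' s" if "s \<in> S" for s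
    using that by (intro hsurj) (auto simp: fun_supp_def e'_def)
  then obtain m where m: "\<And>s. s \<in> S \<Longrightarrow> m s \<in> fun_supp I" "\<And>s. s \<in> S \<Longrightarrow> h (m s) = e' s" by metis
  define k where "k y = (\<lambda>i. \<Sum>s\<in>S. y s * m s i)" for y
  have "linmap k" unfolding linmap_def k_def
    by (simp add: fun_eq_iff sum.distrib sum_distrib_left algebra_simps)
  moreover have "k y \<in> fun_supp I" for y
    using m(1) unfolding k_def fun_supp_def by (auto intro!: sum.neutral)
  moreover have "y = (\<lambda>_. 0)" if y: "y \<in> fun_supp S" "k y = (\<lambda>_. 0)" for y
  proof -
    have "h (k y) = (\<lambda>c. \<Sum>s\<in>S. y s * h (m s) c)" unfolding k_def linmap_sum[OF hlin] ..
    also have "\<dots> = (\<lambda>c. \<Sum>s\<in>S. y s * e' s c)" using m(2) by (auto intro!: sum.cong)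
    also have "\<dots> = y" using y(1) fin(2) by (auto simp: e'_def fun_supp_def if_distrib sum.delta' cong: if_cong)
    finally show ?thesis using y(2) linmap_zero[OF hlin] by simp
  qed
  ultimately have "card S \<le> card I" using card_le_of_linear_injection[OF fI fin(2)] by blast
  then show ?thesis using le cI by simp
qed

section \<open>Exact sequences of coordinate spaces\<close>

lemma vzero_eq: "vzero = (\<lambda>_. 0)"
  by (simp add: vzero_def)

lemma V_eq_fun_supp: "V d = fun_supp {..<d}"
  by (auto simp: V_def fun_supp_def)

lemma V_0: "V 0 = {vzero}"
  by (auto simp: V_def vzero_def)

lemma vzero_in_V [simp]: "vzero \<in> V d"
  by (simp add: V_def vzero_def)

lemma V_eq_vzero_iff: "V d = {vzero :: nat \<Rightarrow> 'a::field} \<longleftrightarrow> d = 0"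
proof
  assume V: "V d = {vzero :: nat \<Rightarrow> 'a}"
  show "d = 0"
  proof (rule ccontr)
    assume "d \<noteq> 0"
    then have "(\<lambda>i. if i = 0 then 1 else 0 :: 'a) \<in> V d" by (auto simp: V_def)
    then have "(\<lambda>i. if i = 0 then 1 else 0 :: 'a) = vzero" unfolding V by blast
    from fun_cong[OF this, of 0] show False by (simp add: vzero_def)
  qed
qed (simp add: V_0)

lemma subspace_of_iff: "subspace_of d U \<longleftrightarrow> U \<subseteq> V d \<and> subsp U"
  by (simp add: subspace_of_def subsp_def vzero_def conj_assoc)

lemma subsp_V: "subsp (V d)"
  by (simp add: subsp_def V_def)

lemma subsp_minus: "subsp U \<Longrightarrow> x \<in> U \<Longrightarrow> y \<in> U \<Longrightarrow> (\<lambda>i. x i - y i) \<in> U"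
  using subsp_diff[of U x y 1] by simp

lemma lin_in_V [simp]: "lin dt ds A x \<in> V dt"
  by (simp add: lin_def V_def)

lemma lin_add: "lin dt ds A (\<lambda>i. x i + y i) = (\<lambda>i. lin dt ds A x i + lin dt ds A y i)"
  by (auto simp: lin_def sum.distrib distrib_left fun_eq_iff)

lemma lin_scale: "lin dt ds A (\<lambda>i. c * x i) = (\<lambda>i. c * lin dt ds A x i)"
  by (auto simp: lin_def sum_distrib_left fun_eq_iff intro!: sum.cong)

lemma linmap_lin: "linmap (lin dt ds A)"
  by (simp add: linmap_def lin_add lin_scale)

lemma lin_diff: "lin dt ds A (\<lambda>i. x i - y i) = (\<lambda>i. lin dt ds A x i - lin dt ds A y i)"
  by (rule linmap_diff[OF linmap_lin])

lemma lin_vzero [simp]: "lin dt ds A vzero = vzero"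
  by (simp add: lin_def vzero_def fun_eq_iff)

text \<open>The map with blocks \<open>G w\<close> from the direct sum of the \<open>k^(b w)\<close>
  to \<open>k^c\<close>, at a family \<open>y\<close>. The same expression occurs in
  \<open>shift_rel\<close> and \<open>shiftm_rel\<close>, which thereby become exactness
  statements.\<close>

definition wsum :: "'w set \<Rightarrow> ('w \<Rightarrow> nat) \<Rightarrow> nat \<Rightarrow> ('w \<Rightarrow> nat \<Rightarrow> nat \<Rightarrow> 'a::field) \<Rightarrow> ('w \<Rightarrow> nat \<Rightarrow> 'a) \<Rightarrow> nat \<Rightarrow> 'a" where
  "wsum W b c G y = (\<lambda>i. \<Sum>w\<in>W. lin c (b w) (G w) (y w) i)"

lemma wsum_add: "wsum W b c G (\<lambda>w i. y w i + z w i) = (\<lambda>i. wsum W b c G y i + wsum W b c G z i)"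
  by (simp add: wsum_def lin_add sum.distrib)

lemma wsum_scale: "wsum W b c G (\<lambda>w i. k * y w i) = (\<lambda>i. k * wsum W b c G y i)"
  by (simp add: wsum_def lin_scale sum_distrib_left)

lemma wsum_diff: "wsum W b c G (\<lambda>w i. y w i - z w i) = (\<lambda>i. wsum W b c G y i - wsum W b c G z i)"
  by (simp add: wsum_def lin_diff sum_subtractf)

lemma wsum_cong: "(\<And>w. w \<in> W \<Longrightarrow> y w = z w) \<Longrightarrow> wsum W b c G y = wsum W b c G z"
  by (simp add: wsum_def)

lemma wsum_vzero: "(\<And>w. w \<in> W \<Longrightarrow> y w = vzero) \<Longrightarrow> wsum W b c G y = vzero"
  by (simp add: wsum_def) (simp add: vzero_def)

lemma wsum_in_V [simp]: "wsum W b c G y \<in> V c"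
  by (simp add: wsum_def V_def lin_def)

lemma wsum_single:
  assumes "finite W" "w \<in> W"
  shows "wsum W b c G (\<lambda>w'. if w' = w then u else vzero) = lin c (b w) (G w) u"
proof
  fix i
  have "(\<Sum>w'\<in>W. lin c (b w') (G w') (if w' = w then u else vzero) i)
      = (\<Sum>w'\<in>W. if w' = w then lin c (b w) (G w) u i else 0)"
    by (intro sum.cong) (auto simp: vzero_def lin_def)
  then show "wsum W b c G (\<lambda>w'. if w' = w then u else vzero) i = lin c (b w) (G w) u i"
    using assms by (simp add: wsum_def)
qed

text \<open>\<open>0 \<rightarrow> k^a \<rightarrow> \<Oplus>\<^sub>w k^(b w) \<rightarrow> k^c \<rightarrow> 0\<close>: a complex exact in the middle, left exact, right exact.\<close>

definition mid_exact where
  "mid_exact W b a c F G \<longleftrightarrow>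
     (\<forall>x\<in>V a. wsum W b c G (\<lambda>w. lin (b w) a (F w) x) = vzero) \<and>
     (\<forall>y. (\<forall>w\<in>W. y w \<in> V (b w)) \<longrightarrow> wsum W b c G y = vzero \<longrightarrow>
        (\<exists>x\<in>V a. \<forall>w\<in>W. lin (b w) a (F w) x = y w))"

definition left_exact where
  "left_exact W b a F \<longleftrightarrow> (\<forall>x\<in>V a. (\<forall>w\<in>W. lin (b w) a (F w) x = vzero) \<longrightarrow> x = vzero)"

definition right_exact where
  "right_exact W b c G \<longleftrightarrow> (\<forall>z\<in>V c. \<exists>y. (\<forall>w\<in>W. y w \<in> V (b w)) \<and> wsum W b c G y = z)"

text \<open>The direct sum over \<open>W\<close> is the coordinate space on the pairs
  \<open>(w, i)\<close> with \<open>i < b w\<close>, to which \<open>card_eq_of_exact\<close>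
  applies.\<close>

lemma exact_dims:
  fixes F G :: "'w \<Rightarrow> nat \<Rightarrow> nat \<Rightarrow> 'a::field"
  assumes W: "finite W" and ex: "mid_exact W b a c F G" "left_exact W b a F" "right_exact W b c G"
  shows "(\<Sum>w\<in>W. b w) = a + c"
proof -
  define S where "S = Sigma W (\<lambda>w. {..<b w})"
  define f :: "(nat \<Rightarrow> 'a) \<Rightarrow> ('w \<times> nat \<Rightarrow> 'a)"
    where "f x = (\<lambda>(w, i). if w \<in> W then lin (b w) a (F w) x i else 0)" for x
  define g :: "('w \<times> nat \<Rightarrow> 'a) \<Rightarrow> (nat \<Rightarrow> 'a)"
    where "g y = wsum W b c G (\<lambda>w i. y (w, i))" for y
  have fin: "finite {..<a}" "finite S" "finite {..<c}" using W by (auto simp: S_def)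
  have lin: "linmap f" "linmap g"
    by (auto simp: linmap_def f_def g_def lin_add lin_scale wsum_add wsum_scale)
  have gf: "g (f x) = wsum W b c G (\<lambda>w. lin (b w) a (F w) x)" for x
    unfolding g_def f_def by (rule wsum_cong) auto
  have "card S = card {..<a} + card {..<c}"
  proof (rule card_eq_of_exact[OF fin lin])
    fix x :: "nat \<Rightarrow> 'a" assume x: "x \<in> fun_supp {..<a}"
    show "f x \<in> fun_supp S" by (auto simp: f_def fun_supp_def S_def lin_def)
    show "g (f x) = (\<lambda>_. 0)"
      using ex(1) x unfolding mid_exact_def gf V_eq_fun_supp vzero_eq by blast
    assume fx: "f x = (\<lambda>_. 0)"
    have "lin (b w) a (F w) x i = 0" if "w \<in> W" for w i
      using fun_cong[OF fx, of "(w, i)"] that by (simp add: f_def)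
    then have "\<forall>w\<in>W. lin (b w) a (F w) x = vzero" by (auto simp: vzero_def)
    then show "x = (\<lambda>_. 0)" using ex(2) x unfolding left_exact_def V_eq_fun_supp vzero_eq by blast
  next
    fix y :: "'w \<times> nat \<Rightarrow> 'a" assume y: "y \<in> fun_supp S"
    then have yV: "\<forall>w\<in>W. (\<lambda>i. y (w, i)) \<in> V (b w)" by (auto simp: fun_supp_def S_def V_def)
    show "g y \<in> fun_supp {..<c}" by (simp add: g_def flip: V_eq_fun_supp)
    assume "g y = (\<lambda>_. 0)"
    then obtain x where x: "x \<in> V a" "\<forall>w\<in>W. lin (b w) a (F w) x = (\<lambda>i. y (w, i))"
      using ex(1)[unfolded mid_exact_def, THEN conjunct2, rule_format, of "\<lambda>w i. y (w, i)"] yV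
      by (auto simp: g_def vzero_eq)
    have "f x = y"
    proof
      fix p :: "'w \<times> nat"
      obtain w i where p: "p = (w, i)" by (cases p)
      show "f x p = y p"
        using x(2) y unfolding p f_def by (cases "w \<in> W") (auto simp: fun_supp_def S_def dest: fun_cong)
    qed
    then show "\<exists>x\<in>fun_supp {..<a}. f x = y" using x(1) V_eq_fun_supp by blast
  next
    fix z :: "nat \<Rightarrow> 'a" assume "z \<in> fun_supp {..<c}"
    then obtain y where y: "\<forall>w\<in>W. y w \<in> V (b w)" "wsum W b c G y = z"
      using ex(3) unfolding right_exact_def V_eq_fun_supp by blast
    define y' where "y' = (\<lambda>(w, i). if w \<in> W then y w i else 0)"
    have "y' \<in> fun_supp S" using y(1) by (auto simp: y'_def fun_supp_def S_def V_def)
    moreover have "g y' = z" unfolding g_def y(2)[symmetric] y'_def by (rule wsum_cong) auto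
    ultimately show "\<exists>y\<in>fun_supp S. g y = z" by blast
  qed
  then show ?thesis using W by (simp add: S_def)
qed

text \<open>Together with its counterpart for cokernels this keeps supports finite: a reflected
  vertex without neighbours in the support gets the zero space.\<close>

lemma left_exact_zero:
  fixes F :: "'w \<Rightarrow> nat \<Rightarrow> nat \<Rightarrow> 'a::field"
  assumes "left_exact W b a F" "\<And>w. w \<in> W \<Longrightarrow> b w = 0"
  shows "a = 0"
proof -
  have "lin (b w) a (F w) x = vzero" if "w \<in> W" for w x
    using lin_in_V[of "b w" a "F w" x] assms(2)[OF that] by (simp add: V_0)
  then have "x = vzero" if "x \<in> V a" for x :: "nat \<Rightarrow> 'a" using assms(1) that by (simp add: left_exact_def)
  then have "V a = {vzero :: nat \<Rightarrow> 'a}" using vzero_in_V by blast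
  then show ?thesis using V_eq_vzero_iff by blast
qed

lemma right_exact_zero:
  fixes G :: "'w \<Rightarrow> nat \<Rightarrow> nat \<Rightarrow> 'a::field"
  assumes "right_exact W b c G" "\<And>w. w \<in> W \<Longrightarrow> b w = 0"
  shows "c = 0"
proof -
  have "z = vzero" if z: "z \<in> V c" for z :: "nat \<Rightarrow> 'a"
  proof -
    obtain y where y: "\<forall>w\<in>W. y w \<in> V (b w)" "wsum W b c G y = z"
      using assms(1) z unfolding right_exact_def by blast
    then have "\<forall>w\<in>W. y w = vzero" using assms(2) by (auto simp: V_0)
    then have "wsum W b c G y = vzero" by (intro wsum_vzero) blast
    then show ?thesis using y(2) by simp
  qed
  then have "V c = {vzero :: nat \<Rightarrow> 'a}" using vzero_in_V by blast
  then show ?thesis using V_eq_vzero_iff by blast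
qed

text \<open>A basis matrix of the kernel, its rows cut into the blocks \<open>F w\<close>.\<close>

lemma kernel_exists:
  fixes G :: "'w \<Rightarrow> nat \<Rightarrow> nat \<Rightarrow> 'a::field"
  assumes W: "finite W"
  obtains a F where "mid_exact W b a c F G" "left_exact W b a F"
proof -
  define S where "S = Sigma W (\<lambda>w. {..<b w})"
  define U where "U = {y \<in> fun_supp S. wsum W b c G (\<lambda>w i. y (w, i)) = vzero}"
  have S: "finite S" using W by (simp add: S_def)
  have U: "subsp U" "U \<subseteq> fun_supp S"
  proof -
    have "wsum W b c G (\<lambda>w i. 0) = vzero" using wsum_vzero[of W "\<lambda>w i. 0"] by (simp add: vzero_def)
    moreover have "wsum W b c G (\<lambda>w i. x (w, i) + y (w, i)) = vzero"
      if "wsum W b c G (\<lambda>w i. x (w, i)) = vzero" "wsum W b c G (\<lambda>w i. y (w, i)) = vzero" for x y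
      using that by (simp add: wsum_add vzero_def)
    moreover have "wsum W b c G (\<lambda>w i. k * x (w, i)) = vzero"
      if "wsum W b c G (\<lambda>w i. x (w, i)) = vzero" for k x
      using that by (simp add: wsum_scale vzero_def)
    ultimately show "subsp U" by (simp add: subsp_def U_def fun_supp_def)
  qed (simp add: U_def)
  obtain A :: "'w \<times> nat \<Rightarrow> nat \<Rightarrow> 'a" and q where
    A: "\<And>x. (\<lambda>b. \<Sum>j<q. A b j * x j) \<in> U"
    "\<And>u. u \<in> U \<Longrightarrow> \<exists>x\<in>fun_supp {..<q}. u = (\<lambda>b. \<Sum>j<q. A b j * x j)"
    "\<And>x. x \<in> fun_supp {..<q} \<Longrightarrow> (\<lambda>b. \<Sum>j<q. A b j * x j) = (\<lambda>_. 0) \<Longrightarrow> x = (\<lambda>_. 0)"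
    by (rule subspace_basis[OF S U]) (rule that)
  define F where "F w i j = A (w, i) j" for w i j
  have lF: "lin (b w) q (F w) x = (\<lambda>i. \<Sum>j<q. A (w, i) j * x j)" if "w \<in> W" for w x
  proof
    fix i
    have "(\<Sum>j<q. A (w, i) j * x j) = 0" if "\<not> i < b w"
      using A(1)[of x] that unfolding U_def fun_supp_def S_def by auto
    then show "lin (b w) q (F w) x i = (\<Sum>j<q. A (w, i) j * x j)"
      by (auto simp: lin_def F_def)
  qed
  have "mid_exact W b q c F G"
    unfolding mid_exact_def
  proof (intro conjI ballI allI impI)
    fix x :: "nat \<Rightarrow> 'a" assume "x \<in> V q"
    have "wsum W b c G (\<lambda>w. lin (b w) q (F w) x) = wsum W b c G (\<lambda>w i. \<Sum>j<q. A (w, i) j * x j)"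
      by (rule wsum_cong) (rule lF)
    then show "wsum W b c G (\<lambda>w. lin (b w) q (F w) x) = vzero" using A(1)[of x] by (simp add: U_def)
  next
    fix y assume y: "\<forall>w\<in>W. y w \<in> V (b w)" "wsum W b c G y = vzero"
    define u where "u = (\<lambda>(w, i). if w \<in> W then y w i else 0)"
    have "wsum W b c G (\<lambda>w i. u (w, i)) = wsum W b c G y" by (rule wsum_cong) (simp add: u_def)
    then have "u \<in> U" using y by (auto simp: U_def u_def fun_supp_def S_def V_def)
    then obtain x where x: "x \<in> fun_supp {..<q}" "u = (\<lambda>b. \<Sum>j<q. A b j * x j)" using A(2) by blast
    have "lin (b w) q (F w) x = y w" if "w \<in> W" for w
    proof
      fix i show "lin (b w) q (F w) x i = y w i"
        using fun_cong[OF x(2), of "(w, i)"] that unfolding lF[OF that] by (simp add: u_def)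
    qed
    then show "\<exists>x\<in>V q. \<forall>w\<in>W. lin (b w) q (F w) x = y w" using x(1) V_eq_fun_supp by blast
  qed
  moreover have "left_exact W b q F"
    unfolding left_exact_def
  proof (intro ballI impI)
    fix x :: "nat \<Rightarrow> 'a" assume x: "x \<in> V q" "\<forall>w\<in>W. lin (b w) q (F w) x = vzero"
    have "(\<Sum>j<q. A p j * x j) = 0" for p
    proof (cases "fst p \<in> W")
      case True
      then show ?thesis using fun_cong[OF lF[OF True, of x], of "snd p"] x(2) by (simp add: vzero_def)
    next
      case False
      then show ?thesis using A(1)[of x] unfolding U_def fun_supp_def S_def by (cases p) auto
    qed
    then show "x = vzero" using A(3)[of x] x(1) by (simp add: V_eq_fun_supp vzero_eq)
  qed
  ultimately show ?thesis using that by blast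
qed

text \<open>The quotient map by the image of \<open>F\<close>, its columns cut into the blocks
  \<open>G w\<close>.\<close>

lemma cokernel_exists:
  fixes F :: "'w \<Rightarrow> nat \<Rightarrow> nat \<Rightarrow> 'a::field"
  assumes W: "finite W"
  obtains c G where "mid_exact W b a c F G" "right_exact W b c G"
proof -
  define S where "S = Sigma W (\<lambda>w. {..<b w})"
  define f :: "(nat \<Rightarrow> 'a) \<Rightarrow> ('w \<times> nat \<Rightarrow> 'a)"
    where "f x = (\<lambda>(w, i). if w \<in> W then lin (b w) a (F w) x i else 0)" for x
  define U where "U = f ` V a"
  have S: "finite S" using W by (simp add: S_def)
  have lf: "linmap f" by (auto simp: linmap_def f_def lin_add lin_scale)
  have U: "subsp U" "U \<subseteq> fun_supp S"
  proof -
    have "(\<lambda>_. 0) \<in> U" unfolding U_def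
      by (rule image_eqI[of _ f vzero]) (use linmap_zero[OF lf] in \<open>simp_all add: vzero_def V_def\<close>)
    moreover have "(\<lambda>b. x b + y b) \<in> U" if "x \<in> U" "y \<in> U" for x y
    proof -
      obtain u v where uv: "u \<in> V a" "x = f u" "v \<in> V a" "y = f v" using \<open>x \<in> U\<close> \<open>y \<in> U\<close> by (auto simp: U_def)
      show ?thesis unfolding U_def
        by (rule image_eqI[OF _ subsp_add[OF subsp_V uv(1,3)]]) (simp add: uv linmap_add[OF lf])
    qed
    moreover have "(\<lambda>b. k * x b) \<in> U" if "x \<in> U" for k x
    proof -
      obtain u where u: "u \<in> V a" "x = f u" using \<open>x \<in> U\<close> by (auto simp: U_def)
      show ?thesis unfolding U_def
        by (rule image_eqI[OF _ subsp_scale[OF subsp_V u(1)]]) (simp add: u linmap_scale[OF lf])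
    qed
    ultimately show "subsp U" by (simp add: subsp_def)
    show "U \<subseteq> fun_supp S" by (auto simp: U_def f_def fun_supp_def S_def lin_def)
  qed
  obtain B :: "nat \<Rightarrow> 'w \<times> nat \<Rightarrow> 'a" and q where
    B: "\<And>z. \<exists>y\<in>fun_supp S. \<forall>i<q. (\<Sum>b\<in>S. B i b * y b) = z i"
    "\<And>y. y \<in> fun_supp S \<Longrightarrow> y \<in> U \<longleftrightarrow> (\<forall>i<q. (\<Sum>b\<in>S. B i b * y b) = 0)"
    by (rule quotient_map[OF S U]) (rule that)
  define G where "G w i j = B i (w, j)" for w i j
  have tG: "wsum W b q G y = (\<lambda>i. if i < q then \<Sum>p\<in>S. B i p * y (fst p) (snd p) else 0)" for y
  proof
    fix i
    have "(\<Sum>w\<in>W. \<Sum>j<b w. B i (w, j) * y w j) = (\<Sum>p\<in>S. B i p * y (fst p) (snd p))"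
      unfolding S_def using W by (subst sum.Sigma) (auto intro!: sum.cong)
    then show "wsum W b q G y i = (if i < q then \<Sum>p\<in>S. B i p * y (fst p) (snd p) else 0)"
      by (simp add: wsum_def lin_def G_def)
  qed
  have ker: "wsum W b q G y = vzero \<longleftrightarrow> (\<lambda>(w, i). if w \<in> W then y w i else 0) \<in> U"
    if y: "\<And>w. w \<in> W \<Longrightarrow> y w \<in> V (b w)" for y
  proof -
    let ?u = "\<lambda>(w, i). if w \<in> W then y w i else 0"
    have "(\<Sum>p\<in>S. B i p * ?u p) = (\<Sum>p\<in>S. B i p * y (fst p) (snd p))" for i
      by (rule sum.cong) (auto simp: S_def)
    moreover have "?u \<in> fun_supp S" using y by (auto simp: fun_supp_def S_def V_def)
    ultimately have "?u \<in> U \<longleftrightarrow> (\<forall>i<q. (\<Sum>p\<in>S. B i p * y (fst p) (snd p)) = 0)" using B(2) by simp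
    then show ?thesis unfolding tG vzero_def by (auto simp: fun_eq_iff)
  qed
  have "mid_exact W b a q F G"
    unfolding mid_exact_def
  proof (intro conjI ballI allI impI)
    fix x :: "nat \<Rightarrow> 'a" assume "x \<in> V a"
    then show "wsum W b q G (\<lambda>w. lin (b w) a (F w) x) = vzero"
      by (subst ker) (auto simp: U_def f_def)
  next
    fix y assume y: "\<forall>w\<in>W. y w \<in> V (b w)" "wsum W b q G y = vzero"
    then obtain x where x: "x \<in> V a" "(\<lambda>(w, i). if w \<in> W then y w i else 0) = f x"
      using ker[of y] unfolding U_def by blast
    have "lin (b w) a (F w) x = y w" if "w \<in> W" for w
    proof
      fix i show "lin (b w) a (F w) x i = y w i"
        using fun_cong[OF x(2), of "(w, i)"] that by (simp add: f_def)
    qed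
    then show "\<exists>x\<in>V a. \<forall>w\<in>W. lin (b w) a (F w) x = y w" using x(1) by blast
  qed
  moreover have "right_exact W b q G"
    unfolding right_exact_def
  proof
    fix z :: "nat \<Rightarrow> 'a" assume z: "z \<in> V q"
    obtain y where y: "y \<in> fun_supp S" "\<forall>i<q. (\<Sum>b\<in>S. B i b * y b) = z i" using B(1) by blast
    have "wsum W b q G (\<lambda>w i. y (w, i)) = z"
      unfolding tG using y(2) z by (auto simp: V_def fun_eq_iff)
    moreover have "\<forall>w\<in>W. (\<lambda>i. y (w, i)) \<in> V (b w)" using y(1) by (auto simp: fun_supp_def S_def V_def)
    ultimately show "\<exists>y. (\<forall>w\<in>W. y w \<in> V (b w)) \<and> wsum W b q G y = z"
      by (intro exI[of _ "\<lambda>w i. y (w, i)"]) blast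
  qed
  ultimately show ?thesis using that by blast
qed

section \<open>Reflections and direct sum decompositions\<close>

text \<open>A full short exact sequence at every sink of \<open>M\<close>: \<open>N\<close> is a
  shift of \<open>M\<close> and at the same time \<open>M\<close> is an inverse shift of
  \<open>N\<close>. Facts proved once for this relation serve both functors. Words that are not
  vertices have no neighbours, and there the sequence is zero.\<close>

definition reflects :: "nat \<Rightarrow> 'a::field qrep \<Rightarrow> 'a qrep \<Rightarrow> bool" where
  "reflects n M N \<longleftrightarrow> is_rep n M \<and> is_rep n N \<and> rori N = (\<not> rori M) \<and>
     (\<forall>w. \<not> is_sink (rori M) w \<longrightarrow> rdim N w = rdim M w) \<and>
     (\<forall>v. is_sink (rori M) v \<longrightarrow>
        mid_exact (nbrs n v) (rdim M) (rdim N v) (rdim M v) (rmap N v) (\<lambda>w. rmap M w v) \<and>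
        left_exact (nbrs n v) (rdim M) (rdim N v) (rmap N v) \<and>
        right_exact (nbrs n v) (rdim M) (rdim M v) (\<lambda>w. rmap M w v))"

lemma shift_rel_eq:
  "shift_rel n M N \<longleftrightarrow> is_rep n M \<and> is_rep n N \<and> rori N = (\<not> rori M) \<and>
     (\<forall>w. \<not> is_sink (rori M) w \<longrightarrow> rdim N w = rdim M w) \<and>
     (\<forall>v. valid n v \<and> is_sink (rori M) v \<longrightarrow>
        mid_exact (nbrs n v) (rdim M) (rdim N v) (rdim M v) (rmap N v) (\<lambda>w. rmap M w v) \<and>
        left_exact (nbrs n v) (rdim M) (rdim N v) (rmap N v))"
  unfolding shift_rel_def mid_exact_def left_exact_def wsum_def
  by (simp only: conj_ac)

lemma shiftm_rel_eq:
  "shiftm_rel n M N \<longleftrightarrow> is_rep n M \<and> is_rep n N \<and> rori N = (\<not> rori M) \<and>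
     (\<forall>w. is_sink (rori M) w \<longrightarrow> rdim N w = rdim M w) \<and>
     (\<forall>v. valid n v \<and> \<not> is_sink (rori M) v \<longrightarrow>
        mid_exact (nbrs n v) (rdim M) (rdim M v) (rdim N v) (rmap M v) (\<lambda>w. rmap N w v) \<and>
        right_exact (nbrs n v) (rdim M) (rdim N v) (\<lambda>w. rmap N w v))"
  unfolding shiftm_rel_def mid_exact_def right_exact_def wsum_def
  by (simp only: conj_ac)

lemma nbrs_invalid: "\<not> valid n v \<Longrightarrow> nbrs n v = {}"
  by (auto simp: nbrs_def adj_def)

lemma nbrs_is_sink: "w \<in> nbrs n v \<Longrightarrow> is_sink e w \<longleftrightarrow> \<not> is_sink e v"
  using adj_is_sink by (auto simp: nbrs_def)

lemma is_sink_Not: "is_sink (\<not> e) v \<longleftrightarrow> \<not> is_sink e v"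
  by (auto simp: is_sink_def)

lemma mid_exact_cong:
  "W = W' \<Longrightarrow> (\<And>w. w \<in> W' \<Longrightarrow> b w = b' w) \<Longrightarrow> mid_exact W b a c F G = mid_exact W' b' a c F G"
  by (simp add: mid_exact_def wsum_def)

lemma left_exact_cong:
  "W = W' \<Longrightarrow> (\<And>w. w \<in> W' \<Longrightarrow> b w = b' w) \<Longrightarrow> left_exact W b a F = left_exact W' b' a F"
  by (simp add: left_exact_def)

lemma right_exact_cong:
  "W = W' \<Longrightarrow> (\<And>w. w \<in> W' \<Longrightarrow> b w = b' w) \<Longrightarrow> right_exact W b c G = right_exact W' b' c G"
  by (simp add: right_exact_def wsum_def)

lemma exact_invalid:
  fixes F G :: "'w \<Rightarrow> nat \<Rightarrow> nat \<Rightarrow> 'a::field"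
  shows "mid_exact {} b 0 0 F G" "left_exact {} b 0 F" "right_exact {} b 0 G"
  by (simp_all add: mid_exact_def left_exact_def right_exact_def wsum_def V_0 vzero_def)

lemma is_rep_invalid: "is_rep n M \<Longrightarrow> \<not> valid n v \<Longrightarrow> rdim M v = 0"
  by (auto simp: is_rep_def)

lemma reflects_of_shift:
  assumes "shift_rel n M N"
    and "\<And>v. is_sink (rori M) v \<Longrightarrow> right_exact (nbrs n v) (rdim M) (rdim M v) (\<lambda>w. rmap M w v)"
  shows "reflects n M N"
  unfolding reflects_def
proof (intro conjI allI impI)
  fix v assume v: "is_sink (rori M) v"
  have "mid_exact (nbrs n v) (rdim M) (rdim N v) (rdim M v) (rmap N v) (\<lambda>w. rmap M w v) \<and>
     left_exact (nbrs n v) (rdim M) (rdim N v) (rmap N v)"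
  proof (cases "valid n v")
    case True
    then show ?thesis using assms(1) v unfolding shift_rel_eq by blast
  next
    case False
    then have "rdim M v = 0" "rdim N v = 0" using assms(1) is_rep_invalid unfolding shift_rel_eq by blast+
    then show ?thesis using False by (simp add: nbrs_invalid exact_invalid)
  qed
  then show "mid_exact (nbrs n v) (rdim M) (rdim N v) (rdim M v) (rmap N v) (\<lambda>w. rmap M w v)"
    "left_exact (nbrs n v) (rdim M) (rdim N v) (rmap N v)" by blast+
qed (use assms in \<open>auto simp: shift_rel_eq\<close>)

text \<open>The sources of \<open>N\<close> are the sinks of \<open>M\<close>, and next to them both
  modules have the same spaces. So the cokernel sequences of \<open>N\<close>, completed by
  injectivity on the left, are the sequences demanded at the sinks of \<open>M\<close>.\<close>

lemma reflects_of_shiftm: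
  assumes sh: "shiftm_rel n N M"
    and inj: "\<And>v. \<not> is_sink (rori N) v \<Longrightarrow> left_exact (nbrs n v) (rdim N) (rdim N v) (rmap N v)"
  shows "reflects n M N"
proof -
  have ori: "rori M = (\<not> rori N)" and rep: "is_rep n M" "is_rep n N"
    and dim: "\<And>w. is_sink (rori N) w \<Longrightarrow> rdim M w = rdim N w"
    using sh unfolding shiftm_rel_eq by blast+
  have *: "mid_exact (nbrs n v) (rdim N) (rdim N v) (rdim M v) (rmap N v) (\<lambda>w. rmap M w v) \<and>
     left_exact (nbrs n v) (rdim N) (rdim N v) (rmap N v) \<and>
     right_exact (nbrs n v) (rdim N) (rdim M v) (\<lambda>w. rmap M w v)"
    if v: "\<not> is_sink (rori N) v" for v
  proof (cases "valid n v")
    case True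
    then show ?thesis using sh inj[OF v] v unfolding shiftm_rel_eq by blast
  next
    case False
    then have "rdim M v = 0" "rdim N v = 0" using rep is_rep_invalid by blast+
    then show ?thesis using False by (simp add: nbrs_invalid exact_invalid)
  qed
  have nb: "rdim M w = rdim N w" if "\<not> is_sink (rori N) v" "w \<in> nbrs n v" for v w
    using dim that nbrs_is_sink by blast
  have "mid_exact (nbrs n v) (rdim M) (rdim N v) (rdim M v) (rmap N v) (\<lambda>w. rmap M w v) \<and>
     left_exact (nbrs n v) (rdim M) (rdim N v) (rmap N v) \<and>
     right_exact (nbrs n v) (rdim M) (rdim M v) (\<lambda>w. rmap M w v)"
    if v: "\<not> is_sink (rori N) v" for v
    using *[OF v] mid_exact_cong[THEN iffD2, OF HOL.refl nb[OF v]]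
      left_exact_cong[THEN iffD2, OF HOL.refl nb[OF v]]
      right_exact_cong[THEN iffD2, OF HOL.refl nb[OF v]] by fast
  then show ?thesis unfolding reflects_def using rep ori dim by (auto simp: is_sink_Not)
qed

lemma finite_is_rep:
  assumes "is_rep n M" and nz: "\<And>v. d v \<noteq> 0 \<Longrightarrow> rdim M v \<noteq> 0 \<or> (\<exists>w\<in>nbrs n v. rdim M w \<noteq> 0)"
  shows "is_rep n \<lparr>rori = e, rdim = d, rmap = f\<rparr>"
proof -
  let ?S = "{v. rdim M v \<noteq> 0}"
  have "{v. d v \<noteq> 0} \<subseteq> ?S \<union> (\<Union>w\<in>?S. nbrs n w)"
    using nz adj_sym by (fastforce simp: nbrs_def)
  moreover have "finite (?S \<union> (\<Union>w\<in>?S. nbrs n w))" using assms(1) by (auto simp: is_rep_def)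
  ultimately have "finite {v. d v \<noteq> 0}" by (rule finite_subset)
  moreover have "valid n v" if "d v \<noteq> 0" for v
    using nz[OF that] assms(1) by (auto simp: is_rep_def nbrs_def adj_def)
  ultimately show ?thesis by (simp add: is_rep_def)
qed

text \<open>\<open>sig\<close> is a Hilbert choice and has the properties of a shift only through
  this existence statement; \<open>shiftm_exists\<close> does the same for
  \<open>sigm\<close>.\<close>

lemma shift_exists:
  assumes M: "is_rep n M"
  shows "\<exists>N. shift_rel n M N"
proof -
  have "\<forall>v. \<exists>a F. mid_exact (nbrs n v) (rdim M) a (rdim M v) F (\<lambda>w. rmap M w v) \<and>
      left_exact (nbrs n v) (rdim M) a F"
  proof
    fix v
    show "\<exists>a F. mid_exact (nbrs n v) (rdim M) a (rdim M v) F (\<lambda>w. rmap M w v) \<and>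
      left_exact (nbrs n v) (rdim M) a F"
      by (rule kernel_exists[OF finite_nbrs, of n v "rdim M" "rdim M v" "\<lambda>w. rmap M w v"]) blast
  qed
  then obtain a F where aF: "\<And>v. mid_exact (nbrs n v) (rdim M) (a v) (rdim M v) (F v) (\<lambda>w. rmap M w v)"
      "\<And>v. left_exact (nbrs n v) (rdim M) (a v) (F v)"
    unfolding choice_iff by blast
  define N where "N = \<lparr>rori = (\<not> rori M), rdim = (\<lambda>v. if is_sink (rori M) v then a v else rdim M v), rmap = F\<rparr>"
  have "is_rep n N" unfolding N_def
    using left_exact_zero[OF aF(2)] by (intro finite_is_rep[OF M]) (auto split: if_splits)
  then have "shift_rel n M N" unfolding shift_rel_eq using M aF by (simp add: N_def)
  then show ?thesis by blast
qed

lemma shiftm_exists: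
  assumes M: "is_rep n M"
  shows "\<exists>N. shiftm_rel n M N"
proof -
  have "\<forall>v. \<exists>c G. mid_exact (nbrs n v) (rdim M) (rdim M v) c (rmap M v) G \<and>
      right_exact (nbrs n v) (rdim M) c G"
  proof
    fix v
    show "\<exists>c G. mid_exact (nbrs n v) (rdim M) (rdim M v) c (rmap M v) G \<and>
      right_exact (nbrs n v) (rdim M) c G"
      by (rule cokernel_exists[OF finite_nbrs, of n v "rdim M" "rdim M v" "rmap M v"]) blast
  qed
  then obtain c G where cG: "\<And>v. mid_exact (nbrs n v) (rdim M) (rdim M v) (c v) (rmap M v) (G v)"
      "\<And>v. right_exact (nbrs n v) (rdim M) (c v) (G v)"
    unfolding choice_iff by blast
  define N where "N = \<lparr>rori = (\<not> rori M), rdim = (\<lambda>v. if is_sink (rori M) v then rdim M v else c v),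
    rmap = (\<lambda>w v. G v w)\<rparr>"
  have "is_rep n N" unfolding N_def
    using right_exact_zero[OF cG(2)] by (intro finite_is_rep[OF M]) (auto split: if_splits)
  then have "shiftm_rel n M N" unfolding shiftm_rel_eq using M cG by (simp add: N_def)
  then show ?thesis by blast
qed

section \<open>Direct sum decompositions and simple summands\<close>

definition decomposes where
  "decomposes n M U W \<longleftrightarrow> subrep n M U \<and> subrep n M W \<and>
     (\<forall>v. U v \<inter> W v = {vzero} \<and> (\<forall>x\<in>V (rdim M v). \<exists>u\<in>U v. \<exists>w\<in>W v. x = (\<lambda>i. u i + w i)))"

lemma indecomposable_iff:
  "indecomposable n M \<longleftrightarrow> \<not> is_zero M \<and>
     (\<forall>U W. decomposes n M U W \<longrightarrow> (\<forall>v. U v = {vzero}) \<or> (\<forall>v. W v = {vzero}))"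
  by (simp add: indecomposable_def decomposes_def)

lemma subrep_subsp: "subrep n M U \<Longrightarrow> subsp (U v)"
  and subrep_V: "subrep n M U \<Longrightarrow> U v \<subseteq> V (rdim M v)"
  by (auto simp: subrep_def subspace_of_iff)

lemma subrep_arrow:
  "subrep n M U \<Longrightarrow> w \<in> nbrs n v \<Longrightarrow> \<not> is_sink (rori M) v \<Longrightarrow> x \<in> U v
    \<Longrightarrow> lin (rdim M w) (rdim M v) (rmap M v w) x \<in> U w"
  using nbrs_is_sink[of w n v "rori M"] by (auto simp: subrep_def arrow_def nbrs_def)

lemma subsp_vzero: "subsp U \<Longrightarrow> vzero \<in> U"
  by (simp add: subsp_def vzero_def)

lemma direct_unique:
  assumes "subsp A" "subsp B" "A \<inter> B = {vzero}" "u \<in> A" "w \<in> B" "u' \<in> A" "w' \<in> B"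
    "\<And>i. u i + w i = u' i + w' i"
  shows "u = u'" "w = w'"
proof -
  have "u i - u' i = w' i - w i" for i using assms(8)[of i] by (simp add: algebra_simps)
  then have "(\<lambda>i. u i - u' i) = (\<lambda>i. w' i - w i)" by auto
  then have "(\<lambda>i. u i - u' i) \<in> A \<inter> B"
    using subsp_minus[OF assms(1,4,6)] subsp_minus[OF assms(2,7,5)] by auto
  then have "(\<lambda>i. u i - u' i) = vzero" using assms(3) by blast
  then have "u i = u' i" for i by (auto simp: vzero_def dest: fun_cong[of _ _ i])
  then show "u = u'" "w = w'" using assms(8) by auto
qed

text \<open>The arrows leaving \<open>v\<close> kill \<open>x\<close>, and \<open>\<phi>\<close>
  vanishes on whatever enters \<open>v\<close>; so the line through \<open>x\<close> is a summand
  concentrated at \<open>v\<close>. Its complement is the kernel of \<open>\<phi>\<close> at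
  \<open>v\<close> and everything elsewhere, hence nonzero at \<open>w\<close>.\<close>

lemma indecomposable_no_split:
  fixes M :: "'a::field qrep"
  assumes ind: "indecomposable n M" and w: "rdim M w \<noteq> 0" "w \<noteq> v"
    and x: "x \<in> V (rdim M v)" "\<phi> x = 1"
    and \<phi>: "\<And>y z. \<phi> (\<lambda>i. y i + z i) = \<phi> y + \<phi> z" "\<And>c y. \<phi> (\<lambda>i. c * y i) = (c * \<phi> y :: 'a)"
    and U: "\<And>a b. arrow n (rori M) a b \<Longrightarrow> a = v \<Longrightarrow> lin (rdim M b) (rdim M a) (rmap M a b) x = vzero"
    and W: "\<And>a b u. arrow n (rori M) a b \<Longrightarrow> b = v \<Longrightarrow> u \<in> V (rdim M a) \<Longrightarrow>
        \<phi> (lin (rdim M b) (rdim M a) (rmap M a b) u) = 0"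
  shows False
proof -
  define X where "X u = (if u = v then range (\<lambda>c i. c * x i) else {vzero})" for u
  define Y where "Y u = (if u = v then {y \<in> V (rdim M v). \<phi> y = 0} else V (rdim M u))" for u
  have \<phi>0: "\<phi> vzero = 0" using \<phi>(2)[of 0 vzero] by (simp add: vzero_def)
  have irrefl: "\<not> arrow n (rori M) a a" for a by (auto simp: arrow_def adj_def)
  have "subrep n M X"
    unfolding subrep_def
  proof (intro conjI allI impI ballI)
    fix u
    have "subsp (range (\<lambda>c i. c * x i))"
      unfolding subsp_def
    proof (intro conjI ballI allI)
      show "(\<lambda>_. 0) \<in> range (\<lambda>c i. c * x i)" by (rule range_eqI[of _ _ 0]) simp
      show "(\<lambda>i. y i + z i) \<in> range (\<lambda>c i. c * x i)"
        if "y \<in> range (\<lambda>c i. c * x i)" "z \<in> range (\<lambda>c i. c * x i)" for y z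
      proof -
        obtain c c' where "y = (\<lambda>i. c * x i)" "z = (\<lambda>i. c' * x i)" using \<open>y \<in> _\<close> \<open>z \<in> _\<close> by blast
        then have "(\<lambda>i. y i + z i) = (\<lambda>i. (c + c') * x i)" by (simp add: distrib_right)
        then show ?thesis by (rule range_eqI[of _ "\<lambda>c i. c * x i"])
      qed
      show "(\<lambda>i. k * y i) \<in> range (\<lambda>c i. c * x i)" if "y \<in> range (\<lambda>c i. c * x i)" for k y
      proof -
        obtain c where "y = (\<lambda>i. c * x i)" using \<open>y \<in> _\<close> by blast
        then have "(\<lambda>i. k * y i) = (\<lambda>i. (k * c) * x i)" by (simp add: mult.assoc)
        then show ?thesis by (rule range_eqI[of _ "\<lambda>c i. c * x i"])
      qed
    qed
    moreover have "range (\<lambda>c i. c * x i) \<subseteq> V (rdim M v)" using x(1) by (auto simp: V_def)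
    ultimately show "subspace_of (rdim M u) (X u)"
      by (auto simp: subspace_of_iff X_def subsp_def vzero_def V_def)
  next
    fix a b u assume *: "arrow n (rori M) a b" "u \<in> X a"
    have "lin (rdim M b) (rdim M a) (rmap M a b) u = vzero"
    proof (cases "a = v")
      case True
      then obtain c where "u = (\<lambda>i. c * x i)" using * by (auto simp: X_def)
      then show ?thesis using U[OF *(1) True] by (simp add: lin_scale) (simp add: vzero_def)
    next
      case False
      then show ?thesis using * by (simp add: X_def)
    qed
    moreover have "vzero \<in> X b" by (auto simp: X_def vzero_def intro!: range_eqI[of _ _ 0])
    ultimately show "lin (rdim M b) (rdim M a) (rmap M a b) u \<in> X b" by simp
  qed
  moreover have "subrep n M Y"
    unfolding subrep_def
  proof (intro conjI allI impI ballI)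
    fix u
    have "subsp {y \<in> V (rdim M v). \<phi> y = 0}"
      unfolding subsp_def
    proof (intro conjI ballI allI)
      show "(\<lambda>_. 0) \<in> {y \<in> V (rdim M v). \<phi> y = 0}"
        using \<phi>0 subsp_zero[OF subsp_V] by (simp add: vzero_def)
      show "(\<lambda>i. y i + z i) \<in> {y \<in> V (rdim M v). \<phi> y = 0}"
        if "y \<in> {y \<in> V (rdim M v). \<phi> y = 0}" "z \<in> {y \<in> V (rdim M v). \<phi> y = 0}" for y z
        using that subsp_add[OF subsp_V, of y _ z] \<phi>(1)[of y z] by simp
      show "(\<lambda>i. c * y i) \<in> {y \<in> V (rdim M v). \<phi> y = 0}"
        if "y \<in> {y \<in> V (rdim M v). \<phi> y = 0}" for c y
        using that subsp_scale[OF subsp_V, of y _ c] \<phi>(2)[of c y] by simp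
    qed
    then show "subspace_of (rdim M u) (Y u)"
      using subsp_V by (auto simp: subspace_of_iff Y_def)
  next
    fix a b u assume *: "arrow n (rori M) a b" "u \<in> Y a"
    show "lin (rdim M b) (rdim M a) (rmap M a b) u \<in> Y b"
    proof (cases "b = v")
      case True
      then have "a \<noteq> v" using irrefl *(1) by blast
      then have "u \<in> V (rdim M a)" using *(2) by (simp add: Y_def)
      then have "\<phi> (lin (rdim M b) (rdim M a) (rmap M a b) u) = 0" using W[OF *(1) True] by blast
      then show ?thesis using True by (simp add: Y_def)
    next
      case False
      then show ?thesis by (simp add: Y_def)
    qed
  qed
  moreover have "X u \<inter> Y u = {vzero} \<and> (\<forall>z\<in>V (rdim M u). \<exists>a\<in>X u. \<exists>b\<in>Y u. z = (\<lambda>i. a i + b i))" for u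
  proof (cases "u = v")
    case True
    have "X v \<inter> Y v = {vzero}"
    proof (intro set_eqI iffI)
      fix y assume "y \<in> X v \<inter> Y v"
      then obtain c where "y = (\<lambda>i. c * x i)" "\<phi> y = 0" by (auto simp: X_def Y_def)
      then show "y \<in> {vzero}" using \<phi>(2)[of c x] x(2) by (simp add: vzero_def)
    qed (use \<phi>0 in \<open>auto simp: X_def Y_def vzero_def V_def intro!: range_eqI[of _ _ 0]\<close>)
    moreover have "\<exists>a\<in>X v. \<exists>b\<in>Y v. z = (\<lambda>i. a i + b i)" if z: "z \<in> V (rdim M v)" for z
    proof (intro bexI)
      show "z = (\<lambda>i. (\<phi> z * x i) + (z i + (- \<phi> z) * x i))" by simp
      show "(\<lambda>i. \<phi> z * x i) \<in> X v" by (auto simp: X_def)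
      have "\<phi> (\<lambda>i. z i + (- \<phi> z) * x i) = 0"
        using \<phi>(1)[of z "\<lambda>i. (- \<phi> z) * x i"] \<phi>(2)[of "- \<phi> z" x] x(2) by simp
      then show "(\<lambda>i. z i + (- \<phi> z) * x i) \<in> Y v"
        using z x(1) by (simp add: Y_def V_def)
    qed
    ultimately show ?thesis using True by simp
  next
    case False
    then have XY: "X u = {vzero}" "Y u = V (rdim M u)" by (simp_all add: X_def Y_def)
    have "\<exists>a\<in>X u. \<exists>b\<in>Y u. z = (\<lambda>i. a i + b i)" if "z \<in> V (rdim M u)" for z
      unfolding XY using that by (intro bexI[of _ vzero] bexI[of _ z]) (simp_all add: vzero_def)
    then show ?thesis unfolding XY by simp
  qed
  ultimately have "decomposes n M X Y" unfolding decomposes_def by blast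
  then have "(\<forall>u. X u = {vzero}) \<or> (\<forall>u. Y u = {vzero})" using ind unfolding indecomposable_iff by blast
  then show False
  proof
    assume "\<forall>u. X u = {vzero}"
    moreover have "x \<in> X v" by (auto simp: X_def intro!: range_eqI[of _ _ 1])
    ultimately have "x = vzero" by blast
    then show False using x(2) \<phi>0 by simp
  next
    assume "\<forall>u. Y u = {vzero}"
    then have "Y w = {vzero}" by blast
    then have "V (rdim M w) = {vzero :: nat \<Rightarrow> 'a}" using w(2) by (simp add: Y_def)
    then show False using w(1) by (simp add: V_eq_vzero_iff)
  qed
qed

lemma wsum_image_subsp:
  "subsp {wsum W b c G y | y. \<forall>w\<in>W. y w \<in> U w}" if U: "\<And>w. w \<in> W \<Longrightarrow> subsp (U w)"
  unfolding subsp_def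
proof (intro conjI ballI allI)
  have "wsum W b c G (\<lambda>_. vzero) = vzero" by (rule wsum_vzero) simp
  then show "(\<lambda>_. 0) \<in> {wsum W b c G y | y. \<forall>w\<in>W. y w \<in> U w}"
    using subsp_vzero[OF U] unfolding vzero_eq[symmetric] by (auto intro!: exI[of _ "\<lambda>_. vzero"])
next
  fix x x' assume "x \<in> {wsum W b c G y | y. \<forall>w\<in>W. y w \<in> U w}" "x' \<in> {wsum W b c G y | y. \<forall>w\<in>W. y w \<in> U w}"
  then obtain y y' where "x = wsum W b c G y" "\<forall>w\<in>W. y w \<in> U w" "x' = wsum W b c G y'" "\<forall>w\<in>W. y' w \<in> U w"
    by blast
  then show "(\<lambda>i. x i + x' i) \<in> {wsum W b c G y | y. \<forall>w\<in>W. y w \<in> U w}"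
    using subsp_add[OF U] by (auto simp: wsum_add intro!: exI[of _ "\<lambda>w i. y w i + y' w i"])
next
  fix k x assume "x \<in> {wsum W b c G y | y. \<forall>w\<in>W. y w \<in> U w}"
  then obtain y where "x = wsum W b c G y" "\<forall>w\<in>W. y w \<in> U w" by blast
  then show "(\<lambda>i. k * x i) \<in> {wsum W b c G y | y. \<forall>w\<in>W. y w \<in> U w}"
    using subsp_scale[OF U] by (auto simp: wsum_scale intro!: exI[of _ "\<lambda>w i. k * y w i"])
qed

text \<open>A vector outside the image of the incoming maps is separated from it by a functional. As
  nothing leaves a sink, a simple summand would split off.\<close>

lemma indecomposable_right_exact:
  fixes M :: "'a::field qrep"
  assumes ind: "indecomposable n M" and v: "is_sink (rori M) v" and w: "rdim M w \<noteq> 0" "w \<noteq> v"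
  shows "right_exact (nbrs n v) (rdim M) (rdim M v) (\<lambda>w. rmap M w v)"
proof (rule ccontr)
  let ?g = "wsum (nbrs n v) (rdim M) (rdim M v) (\<lambda>w. rmap M w v)"
  define I where "I = {?g y | y. \<forall>w\<in>nbrs n v. y w \<in> V (rdim M w)}"
  assume "\<not> ?thesis"
  then obtain x where x: "x \<in> V (rdim M v)" "x \<notin> I" unfolding right_exact_def I_def by blast
  have I: "subsp I" "I \<subseteq> fun_supp {..<rdim M v}"
    unfolding I_def by (rule wsum_image_subsp[OF subsp_V]) (auto simp flip: V_eq_fun_supp)
  obtain \<phi> where \<phi>: "\<And>u. u \<in> I \<Longrightarrow> (\<Sum>b<rdim M v. \<phi> b * u b) = 0" "(\<Sum>b<rdim M v. \<phi> b * x b) = 1"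
    using separating_functional[OF finite_lessThan I x(1)[unfolded V_eq_fun_supp] x(2)] by blast
  show False
  proof (rule indecomposable_no_split[OF ind w x(1), of "\<lambda>y. \<Sum>b<rdim M v. \<phi> b * y b"])
    show "lin (rdim M b) (rdim M a) (rmap M a b) x = vzero"
      if "arrow n (rori M) a b" "a = v" for a b
      using that v adj_is_sink[of n a b "rori M"] by (auto simp: arrow_def)
    show "(\<Sum>c<rdim M v. \<phi> c * lin (rdim M b) (rdim M a) (rmap M a b) u c) = 0"
      if ab: "arrow n (rori M) a b" "b = v" "u \<in> V (rdim M a)" for a b u
    proof (rule \<phi>(1))
      have a: "a \<in> nbrs n v" using ab adj_sym by (auto simp: arrow_def nbrs_def)
      have "?g (\<lambda>w'. if w' = a then u else vzero) = lin (rdim M v) (rdim M a) (rmap M a v) u"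
        by (rule wsum_single[OF finite_nbrs a])
      then show "lin (rdim M b) (rdim M a) (rmap M a b) u \<in> I"
        using ab unfolding I_def by (auto intro!: exI[of _ "\<lambda>w'. if w' = a then u else vzero"])
    qed
  qed (use \<phi>(2) in \<open>simp_all add: sum.distrib distrib_left sum_distrib_left mult.left_commute\<close>)
qed

text \<open>A vector of the common kernel would span a simple summand: nothing enters a source, and
  the functional is a coordinate in which the vector is nonzero, rescaled.\<close>

lemma indecomposable_left_exact:
  fixes M :: "'a::field qrep"
  assumes ind: "indecomposable n M" and v: "\<not> is_sink (rori M) v" and w: "rdim M w \<noteq> 0" "w \<noteq> v"
  shows "left_exact (nbrs n v) (rdim M) (rdim M v) (rmap M v)"
proof (rule ccontr)
  assume "\<not> ?thesis"
  then obtain x where x: "x \<in> V (rdim M v)" "\<forall>w\<in>nbrs n v. lin (rdim M w) (rdim M v) (rmap M v w) x = vzero"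
    "x \<noteq> vzero" unfolding left_exact_def by blast
  then obtain i where i: "x i \<noteq> 0" by (auto simp: vzero_def fun_eq_iff)
  show False
  proof (rule indecomposable_no_split[OF ind w x(1), of "\<lambda>y. y i / x i"])
    show "lin (rdim M b) (rdim M a) (rmap M a b) x = vzero"
      if "arrow n (rori M) a b" "a = v" for a b
      using that x(2) by (auto simp: arrow_def nbrs_def)
    show "lin (rdim M b) (rdim M a) (rmap M a b) u i / x i = 0"
      if ab: "arrow n (rori M) a b" "b = v" "u \<in> V (rdim M a)" for a b u
      using ab v by (auto simp: arrow_def)
  qed (use i in \<open>simp_all add: add_divide_distrib\<close>)
qed

section \<open>Transfer of decompositions along a reflection\<close>

lemma reflects_mid:
  assumes "reflects n M N" "is_sink (rori M) v"
  shows "x \<in> V (rdim N v) \<Longrightarrow>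
      wsum (nbrs n v) (rdim M) (rdim M v) (\<lambda>w. rmap M w v) (\<lambda>w. lin (rdim M w) (rdim N v) (rmap N v w) x) = vzero"
    and "(\<And>w. w \<in> nbrs n v \<Longrightarrow> y w \<in> V (rdim M w)) \<Longrightarrow>
      wsum (nbrs n v) (rdim M) (rdim M v) (\<lambda>w. rmap M w v) y = vzero \<Longrightarrow>
      \<exists>x\<in>V (rdim N v). \<forall>w\<in>nbrs n v. lin (rdim M w) (rdim N v) (rmap N v w) x = y w"
  using assms by (auto simp: reflects_def mid_exact_def)

lemma reflects_left:
  "reflects n M N \<Longrightarrow> is_sink (rori M) v \<Longrightarrow> x \<in> V (rdim N v) \<Longrightarrow>
    (\<And>w. w \<in> nbrs n v \<Longrightarrow> lin (rdim M w) (rdim N v) (rmap N v w) x = vzero) \<Longrightarrow> x = vzero"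
  by (auto simp: reflects_def left_exact_def)

lemma reflects_right:
  "reflects n M N \<Longrightarrow> is_sink (rori M) v \<Longrightarrow> z \<in> V (rdim M v) \<Longrightarrow>
    \<exists>y. (\<forall>w\<in>nbrs n v. y w \<in> V (rdim M w)) \<and> wsum (nbrs n v) (rdim M) (rdim M v) (\<lambda>w. rmap M w v) y = z"
  by (auto simp: reflects_def right_exact_def)

lemma reflects_nbr_dim:
  "reflects n M N \<Longrightarrow> is_sink (rori M) v \<Longrightarrow> w \<in> nbrs n v \<Longrightarrow> rdim N w = rdim M w"
  using nbrs_is_sink by (auto simp: reflects_def)

lemma wsum_subrep:
  assumes X: "subrep n M X" and v: "is_sink (rori M) v" and y: "\<And>w. w \<in> nbrs n v \<Longrightarrow> y w \<in> X w"
  shows "wsum (nbrs n v) (rdim M) (rdim M v) (\<lambda>w. rmap M w v) y \<in> X v"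
proof -
  have l: "lin (rdim M v) (rdim M w) (rmap M w v) (y w) \<in> X v" if "w \<in> nbrs n v" for w
  proof (rule subrep_arrow[OF X _ _ y[OF that]])
    show "v \<in> nbrs n w" using that adj_sym by (auto simp: nbrs_def)
    show "\<not> is_sink (rori M) w" using nbrs_is_sink[OF that] v by blast
  qed
  have "(\<lambda>i. \<Sum>w\<in>W. lin (rdim M v) (rdim M w) (rmap M w v) (y w) i) \<in> X v"
    if "finite W" "W \<subseteq> nbrs n v" for W
    using that
  proof (induction W rule: finite_induct)
    case empty
    then show ?case using subsp_zero[OF subrep_subsp[OF X]] by simp
  next
    case (insert w W)
    then have "(\<lambda>i. lin (rdim M v) (rdim M w) (rmap M w v) (y w) i +
        (\<Sum>w\<in>W. lin (rdim M v) (rdim M w) (rmap M w v) (y w) i)) \<in> X v"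
      using l by (intro subsp_add[OF subrep_subsp[OF X]]) auto
    then show ?case using insert by simp
  qed
  then show ?thesis unfolding wsum_def using finite_nbrs by blast
qed

lemma decomposes_unique:
  assumes "decomposes n M U X" "u \<in> U v" "x \<in> X v" "u' \<in> U v" "x' \<in> X v" "\<And>i. u i + x i = u' i + x' i"
  shows "u = u'" "x = x'"
  using direct_unique[of "U v" "X v" u x u' x'] assms subrep_subsp unfolding decomposes_def by blast+

lemma decomposes_split:
  assumes "decomposes n M U X" "z \<in> V (rdim M v)"
  obtains u x where "u \<in> U v" "x \<in> X v" "z = (\<lambda>i. u i + x i)"
  using assms unfolding decomposes_def by blast

lemma decomposes_split_diff:
  assumes "decomposes n M U X" "z \<in> V (rdim M v)"
  shows "\<exists>u. u \<in> U v \<and> (\<lambda>i. z i - u i) \<in> X v"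
proof -
  obtain u x where "u \<in> U v" "x \<in> X v" "z = (\<lambda>i. u i + x i)"
    using decomposes_split[OF assms] .
  then show ?thesis by (intro exI[of _ u]) simp
qed

text \<open>The two transfers of direct sum decompositions along a reflection: from the reflected module one
takes images, from the original one preimages.\<close>

lemma decomposes_push:
  assumes R: "reflects n M N" and D: "decomposes n N U X"
  defines "push Y v \<equiv> if is_sink (rori M) v
      then {wsum (nbrs n v) (rdim M) (rdim M v) (\<lambda>w. rmap M w v) y | y. \<forall>w\<in>nbrs n v. y w \<in> Y w} else Y v"
  shows "decomposes n M (push U) (push X)"
proof -
  have ori: "rori N = (\<not> rori M)" using R by (simp add: reflects_def)
  have subU: "subrep n N U" and subX: "subrep n N X" using D by (simp_all add: decomposes_def)
  have sub: "subrep n M (push Y)" if Y: "subrep n N Y" for Y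
    unfolding subrep_def
  proof (intro conjI allI impI ballI)
    fix v
    show "subspace_of (rdim M v) (push Y v)"
    proof (cases "is_sink (rori M) v")
      case True
      then show ?thesis using wsum_image_subsp[OF subrep_subsp[OF Y]]
        by (auto simp: subspace_of_iff push_def)
    next
      case False
      then have "rdim N v = rdim M v" "push Y v = Y v" using R by (simp_all add: push_def reflects_def)
      then show ?thesis using Y unfolding subrep_def by metis
    qed
  next
    fix a b u assume *: "arrow n (rori M) a b" "u \<in> push Y a"
    then have ab: "adj n a b" "is_sink (rori M) b" "\<not> is_sink (rori M) a"
      using adj_is_sink by (auto simp: arrow_def)
    then have a: "a \<in> nbrs n b" using adj_sym by (auto simp: nbrs_def)
    have "u \<in> Y a" using *(2) ab by (simp add: push_def)
    then have "\<forall>w\<in>nbrs n b. (if w = a then u else vzero) \<in> Y w"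
      using subsp_vzero[OF subrep_subsp[OF Y]] by auto
    then show "lin (rdim M b) (rdim M a) (rmap M a b) u \<in> push Y b"
      using wsum_single[OF finite_nbrs a, of "rdim M" "rdim M b" "\<lambda>w. rmap M w b" u, symmetric] ab(2)
      by (auto simp: push_def intro!: exI[of _ "\<lambda>w. if w = a then u else vzero"])
  qed
  have "push U v \<inter> push X v = {vzero} \<and> (\<forall>z\<in>V (rdim M v). \<exists>u\<in>push U v. \<exists>x\<in>push X v. z = (\<lambda>i. u i + x i))" for v
  proof (cases "is_sink (rori M) v")
    case v: True
    let ?g = "wsum (nbrs n v) (rdim M) (rdim M v) (\<lambda>w. rmap M w v)"
    have dim: "rdim N w = rdim M w" if "w \<in> nbrs n v" for w using reflects_nbr_dim[OF R v that] .
    have "push U v \<inter> push X v \<subseteq> {vzero}"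
    proof
      fix z assume "z \<in> push U v \<inter> push X v"
      then have "z \<in> {?g y | y. \<forall>w\<in>nbrs n v. y w \<in> U w}" "z \<in> {?g y | y. \<forall>w\<in>nbrs n v. y w \<in> X w}"
        using v by (simp_all add: push_def)
      then obtain y y' where yy: "z = ?g y" "\<forall>w\<in>nbrs n v. y w \<in> U w" "z = ?g y'" "\<forall>w\<in>nbrs n v. y' w \<in> X w"
        unfolding mem_Collect_eq by (elim exE conjE) (rule that)
      note y = yy(1)[symmetric] yy(2)[rule_format] yy(3)[symmetric] yy(4)[rule_format]
      \<comment> \<open>Two preimages of \<open>z\<close>, one in \<open>U\<close> and one in
        \<open>X\<close>, differ by the image of some \<open>p\<close> in the kernel space. The
        \<open>U\<close> component of \<open>p\<close> maps onto \<open>y\<close>, so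
        \<open>y\<close> itself comes from the kernel and \<open>z\<close> is zero.\<close>
      have g0: "?g (\<lambda>w i. y w i - y' w i) = vzero" unfolding wsum_diff y(1,3) by (simp add: vzero_def)
      have "(\<lambda>i. y w i - y' w i) \<in> V (rdim M w)" if w: "w \<in> nbrs n v" for w
      proof (rule subsp_minus[OF subsp_V])
        show "y w \<in> V (rdim M w)" using y(2)[OF w] subrep_V[OF subU, of w] unfolding dim[OF w] by blast
        show "y' w \<in> V (rdim M w)" using y(4)[OF w] subrep_V[OF subX, of w] unfolding dim[OF w] by blast
      qed
      from reflects_mid(2)[OF R v this g0] obtain p where p: "p \<in> V (rdim N v)"
        "\<forall>w\<in>nbrs n v. lin (rdim M w) (rdim N v) (rmap N v w) p = (\<lambda>i. y w i - y' w i)"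
        by blast
      obtain a b where ab: "a \<in> U v" "b \<in> X v" "p = (\<lambda>i. a i + b i)"
        using decomposes_split[OF D p(1)] .
      have "lin (rdim M w) (rdim N v) (rmap N v w) a = y w" if w: "w \<in> nbrs n v" for w
      proof (rule decomposes_unique(1)[OF D])
        let ?l = "lin (rdim M w) (rdim N v) (rmap N v w)"
        have nv: "\<not> is_sink (rori N) v" using v ori by (simp add: is_sink_Not)
        show "?l a \<in> U w" using subrep_arrow[OF subU w nv ab(1)] dim[OF w] by simp
        have "?l b \<in> X w" using subrep_arrow[OF subX w nv ab(2)] dim[OF w] by simp
        then have "(\<lambda>i. y' w i + ?l b i) \<in> X w" using subsp_add[OF subrep_subsp[OF subX]] y(4)[OF w] by blast
        then show "(\<lambda>i. y' w i + ?l b i) \<in> X w" .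
        show "y w \<in> U w" "vzero \<in> X w" using y(2)[OF w] subsp_vzero[OF subrep_subsp[OF subX]] by auto
        fix i
        have "?l a i + ?l b i = y w i - y' w i"
          using fun_cong[OF p(2)[rule_format, OF w], of i] unfolding ab(3) lin_add .
        then show "?l a i + (y' w i + ?l b i) = y w i + vzero i" by (simp add: vzero_def algebra_simps)
      qed
      then have "?g y = ?g (\<lambda>w. lin (rdim M w) (rdim N v) (rmap N v w) a)" by (intro wsum_cong) simp
      also have "\<dots> = vzero" using ab(1) subrep_V[OF subU] by (intro reflects_mid(1)[OF R v]) blast
      finally show "z \<in> {vzero}" unfolding y(1) by simp
    qed
    moreover have "vzero \<in> push U v \<inter> push X v"
      using subsp_vzero[OF subrep_subsp[OF sub[OF subU]]] subsp_vzero[OF subrep_subsp[OF sub[OF subX]]] by blast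
    moreover have "\<exists>u\<in>push U v. \<exists>x\<in>push X v. z = (\<lambda>i. u i + x i)" if z: "z \<in> V (rdim M v)" for z
    proof -
      obtain y where y: "\<forall>w\<in>nbrs n v. y w \<in> V (rdim M w)" "?g y = z" using reflects_right[OF R v z] by blast
      have "\<forall>w\<in>nbrs n v. \<exists>u. u \<in> U w \<and> (\<lambda>i. y w i - u i) \<in> X w"
      proof
        fix w assume w: "w \<in> nbrs n v"
        then have "y w \<in> V (rdim N w)" using y(1) dim by simp
        then show "\<exists>u. u \<in> U w \<and> (\<lambda>i. y w i - u i) \<in> X w" by (rule decomposes_split_diff[OF D])
      qed
      then have "\<exists>u. \<forall>w\<in>nbrs n v. u w \<in> U w \<and> (\<lambda>i. y w i - u w i) \<in> X w" by (rule bchoice)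
      then obtain u where u: "\<forall>w\<in>nbrs n v. u w \<in> U w \<and> (\<lambda>i. y w i - u w i) \<in> X w" by blast
      define x where "x = (\<lambda>w i. y w i - u w i)"
      have ux: "\<forall>w\<in>nbrs n v. u w \<in> U w" "\<forall>w\<in>nbrs n v. x w \<in> X w" using u by (simp_all add: x_def)
      have "z = ?g (\<lambda>w i. u w i + x w i)" unfolding y(2)[symmetric] x_def by (intro wsum_cong) simp
      then have "z = (\<lambda>i. ?g u i + ?g x i)" by (simp only: wsum_add)
      moreover have "?g u \<in> push U v" "?g x \<in> push X v" using ux v by (auto simp: push_def)
      ultimately show ?thesis by blast
    qed
    ultimately show ?thesis by blast
  next
    case False
    then show ?thesis using D R by (simp add: push_def decomposes_def reflects_def)
  qed
  then show ?thesis using sub[OF subU] sub[OF subX] by (simp add: decomposes_def)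
qed

lemma decomposes_pull:
  assumes R: "reflects n M N" and D: "decomposes n M U X"
  defines "pull Y v \<equiv> if is_sink (rori M) v
      then {x \<in> V (rdim N v). \<forall>w\<in>nbrs n v. lin (rdim M w) (rdim N v) (rmap N v w) x \<in> Y w} else Y v"
  shows "decomposes n N (pull U) (pull X)"
proof -
  have ori: "rori N = (\<not> rori M)" using R by (simp add: reflects_def)
  have subU: "subrep n M U" and subX: "subrep n M X" using D by (simp_all add: decomposes_def)
  have sub: "subrep n N (pull Y)" if Y: "subrep n M Y" for Y
    unfolding subrep_def
  proof (intro conjI allI impI ballI)
    fix v
    show "subspace_of (rdim N v) (pull Y v)"
    proof (cases "is_sink (rori M) v")
      case True
      have "vzero \<in> Y w" for w using subsp_vzero[OF subrep_subsp[OF Y]] .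
      then have "(\<lambda>_. 0) \<in> pull Y v" using True unfolding vzero_eq[symmetric] by (simp add: pull_def)
      moreover have "(\<lambda>i. x i + y i) \<in> pull Y v" if "x \<in> pull Y v" "y \<in> pull Y v" for x y
        using that True subsp_add[OF subrep_subsp[OF Y]] subsp_add[OF subsp_V]
        by (auto simp: pull_def lin_add)
      moreover have "(\<lambda>i. k * x i) \<in> pull Y v" if "x \<in> pull Y v" for k x
        using that True subsp_scale[OF subrep_subsp[OF Y]] subsp_scale[OF subsp_V]
        by (auto simp: pull_def lin_scale)
      ultimately have "subsp (pull Y v)" by (simp add: subsp_def)
      moreover have "pull Y v \<subseteq> V (rdim N v)" using True by (auto simp: pull_def)
      ultimately show ?thesis by (simp add: subspace_of_iff)
    next
      case False
      then have "rdim N v = rdim M v" "pull Y v = Y v" using R by (simp_all add: pull_def reflects_def)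
      then show ?thesis using Y unfolding subrep_def by metis
    qed
  next
    fix a b u assume *: "arrow n (rori N) a b" "u \<in> pull Y a"
    then have ab: "adj n a b" "\<not> is_sink (rori M) b" "is_sink (rori M) a"
      using adj_is_sink ori by (auto simp: arrow_def is_sink_Not)
    then have b: "b \<in> nbrs n a" by (auto simp: nbrs_def)
    then show "lin (rdim N b) (rdim N a) (rmap N a b) u \<in> pull Y b"
      using *(2) ab reflects_nbr_dim[OF R ab(3) b] by (simp add: pull_def)
  qed
  have "pull U v \<inter> pull X v = {vzero} \<and> (\<forall>z\<in>V (rdim N v). \<exists>u\<in>pull U v. \<exists>x\<in>pull X v. z = (\<lambda>i. u i + x i))" for v
  proof (cases "is_sink (rori M) v")
    case v: True
    let ?g = "wsum (nbrs n v) (rdim M) (rdim M v) (\<lambda>w. rmap M w v)"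
    let ?l = "\<lambda>w. lin (rdim M w) (rdim N v) (rmap N v w)"
    have "pull U v \<inter> pull X v \<subseteq> {vzero}"
    proof
      fix z assume z: "z \<in> pull U v \<inter> pull X v"
      then have "?l w z \<in> U w \<inter> X w" if "w \<in> nbrs n v" for w using that v by (auto simp: pull_def)
      then have "?l w z = vzero" if "w \<in> nbrs n v" for w using that D by (auto simp: decomposes_def)
      then show "z \<in> {vzero}" using reflects_left[OF R v, of z] z v by (simp add: pull_def)
    qed
    moreover have "vzero \<in> pull U v \<inter> pull X v"
      using subsp_vzero[OF subrep_subsp[OF sub[OF subU]]] subsp_vzero[OF subrep_subsp[OF sub[OF subX]]] by blast
    moreover have "\<exists>u\<in>pull U v. \<exists>x\<in>pull X v. z = (\<lambda>i. u i + x i)" if z: "z \<in> V (rdim N v)" for z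
    proof -
      have "\<forall>w. \<exists>u. u \<in> U w \<and> (\<lambda>i. ?l w z i - u i) \<in> X w"
        using decomposes_split_diff[OF D lin_in_V] by blast
      then have "\<exists>u. \<forall>w. u w \<in> U w \<and> (\<lambda>i. ?l w z i - u w i) \<in> X w" by (rule choice)
      then obtain u where u: "\<forall>w. u w \<in> U w \<and> (\<lambda>i. ?l w z i - u w i) \<in> X w" by blast
      define x where "x = (\<lambda>w i. ?l w z i - u w i)"
      have ux: "u w \<in> U w" "x w \<in> X w" "?l w z = (\<lambda>i. u w i + x w i)" for w
        using u by (simp_all add: x_def)
      \<comment> \<open>The images of the two component families lie in \<open>U v\<close> and
        \<open>X v\<close> and add up to zero. So both vanish, and each family lifts to the kernel
        separately.\<close>
      have "?g (\<lambda>w. ?l w z) = vzero" using reflects_mid(1)[OF R v z] .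
      then have "?g (\<lambda>w i. u w i + x w i) = vzero" using ux(3) by simp
      then have gsum: "?g u i + ?g x i = 0" for i unfolding wsum_add by (simp add: vzero_def fun_eq_iff)
      have gUX: "?g u \<in> U v" "?g x \<in> X v" "vzero \<in> U v" "vzero \<in> X v"
        using wsum_subrep[OF subU v ux(1)] wsum_subrep[OF subX v ux(2)]
          subsp_vzero[OF subrep_subsp[OF subU]] subsp_vzero[OF subrep_subsp[OF subX]] by blast+
      have "?g u i + ?g x i = vzero i + vzero i" for i using gsum by (simp add: vzero_def)
      from decomposes_unique[OF D gUX this] have g0: "?g u = vzero" "?g x = vzero" .
      have "u w \<in> V (rdim M w)" "x w \<in> V (rdim M w)" for w
        using ux subrep_V[OF subU, of w] subrep_V[OF subX, of w] by blast+
      from reflects_mid(2)[OF R v this(1) g0(1)] reflects_mid(2)[OF R v this(2) g0(2)]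
      obtain a b where a: "a \<in> V (rdim N v)" "\<forall>w\<in>nbrs n v. ?l w a = u w"
        and b: "b \<in> V (rdim N v)" "\<forall>w\<in>nbrs n v. ?l w b = x w"
        by blast
      have ab: "a \<in> pull U v" "b \<in> pull X v" using a b ux v by (auto simp: pull_def)
      define d where "d = (\<lambda>i. z i - (a i + b i))"
      have d0: "d = vzero"
      proof (rule reflects_left[OF R v])
        show "d \<in> V (rdim N v)" unfolding d_def using z a(1) b(1) by (auto simp: V_def)
        fix w assume w: "w \<in> nbrs n v"
        show "?l w d = vzero" unfolding d_def lin_diff lin_add
          using a(2) b(2) ux(3)[of w] w by (simp add: vzero_def)
      qed
      have "z i = a i + b i" for i using fun_cong[OF d0, of i] by (simp add: d_def vzero_def)
      then show ?thesis using ab by blast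
    qed
    ultimately show ?thesis by blast
  next
    case False
    then show ?thesis using D R by (simp add: pull_def decomposes_def reflects_def)
  qed
  then show ?thesis using sub[OF subU] sub[OF subX] by (simp add: decomposes_def)
qed

lemma decomposes_commute:
  fixes M :: "'a::field qrep"
  assumes D: "decomposes n M U X"
  shows "decomposes n M X U"
  unfolding decomposes_def
proof (intro conjI allI ballI)
  show "subrep n M X" "subrep n M U" using D by (simp_all add: decomposes_def)
  fix v
  show "X v \<inter> U v = {vzero}" using D by (simp add: decomposes_def inf_commute)
  fix z :: "nat \<Rightarrow> 'a" assume "z \<in> V (rdim M v)"
  then obtain u x where "u \<in> U v" "x \<in> X v" "z = (\<lambda>i. u i + x i)"
    using decomposes_split[OF D] by blast
  then show "\<exists>x\<in>X v. \<exists>u\<in>U v. z = (\<lambda>i. x i + u i)"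
    by (intro bexI[of _ x] bexI[of _ u]) (auto simp: add.commute)
qed

lemma reflects_dim_sum:
  assumes "reflects n M N" "is_sink (rori M) v"
  shows "(\<Sum>w\<in>nbrs n v. rdim M w) = rdim N v + rdim M v"
  using assms exact_dims[OF finite_nbrs] unfolding reflects_def by blast

lemma reflects_is_zero:
  assumes R: "reflects n M N"
  shows "is_zero M \<longleftrightarrow> is_zero N"
proof
  assume Z: "is_zero M"
  have "rdim N v = 0" for v
    using reflects_dim_sum[OF R, of v] Z R by (cases "is_sink (rori M) v") (auto simp: is_zero_def reflects_def)
  then show "is_zero N" by (simp add: is_zero_def)
next
  assume Z: "is_zero N"
  then have src: "rdim M v = 0" if "\<not> is_sink (rori M) v" for v
    using R that by (auto simp: is_zero_def reflects_def)
  have "rdim M v = 0" for v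
  proof (cases "is_sink (rori M) v")
    case True
    then have "(\<Sum>w\<in>nbrs n v. rdim M w) = 0" using nbrs_is_sink src by (intro sum.neutral) blast
    then show ?thesis using reflects_dim_sum[OF R True] by simp
  qed (rule src)
  then show "is_zero M" by (simp add: is_zero_def)
qed

text \<open>Decompositions transfer both ways; it remains to see that a summand with zero transfer
  is zero. For images this is injectivity of the maps from a reflected vertex into its neighbours.
  For preimages, surjectivity writes a vector of \<open>Y v\<close> through the neighbours;
  \<open>Y\<close> is zero there, so the vector also lies in the complement
  \<open>Z v\<close>.\<close>

lemma reflects_indecomposable:
  assumes R: "reflects n M N"
  shows "indecomposable n M \<longleftrightarrow> indecomposable n N"
proof
  assume ind: "indecomposable n M"
  have "(\<forall>v. U v = {vzero}) \<or> (\<forall>v. X v = {vzero})" if D: "decomposes n N U X" for U X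
  proof -
    define push where "push Y v = (if is_sink (rori M) v
      then {wsum (nbrs n v) (rdim M) (rdim M v) (\<lambda>w. rmap M w v) y | y. \<forall>w\<in>nbrs n v. y w \<in> Y w} else Y v)" for Y v
    have "decomposes n M (push U) (push X)" using decomposes_push[OF R D] unfolding push_def .
    then have "(\<forall>v. push U v = {vzero}) \<or> (\<forall>v. push X v = {vzero})" using ind unfolding indecomposable_iff by blast
    moreover have "Y v = {vzero}" if Y: "\<forall>v. push Y v = {vzero}" "subrep n N Y" for Y v
    proof (cases "is_sink (rori M) v")
      case v: True
      have nv: "\<not> is_sink (rori N) v" using v R by (simp add: reflects_def is_sink_Not)
      have "z = vzero" if z: "z \<in> Y v" for z
      proof (rule reflects_left[OF R v])
        show "z \<in> V (rdim N v)" using subrep_V[OF Y(2)] z by blast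
        fix w assume w: "w \<in> nbrs n v"
        have "Y w = {vzero}" using Y(1)[rule_format, of w] nbrs_is_sink[OF w] v by (simp add: push_def)
        then show "lin (rdim M w) (rdim N v) (rmap N v w) z = vzero"
          using subrep_arrow[OF Y(2) w nv z] reflects_nbr_dim[OF R v w] by simp
      qed
      then show ?thesis using subsp_vzero[OF subrep_subsp[OF Y(2), of v]] by blast
    next
      case False
      then show ?thesis using Y(1)[rule_format, of v] by (simp add: push_def)
    qed
    ultimately show ?thesis using D unfolding decomposes_def by blast
  qed
  then show "indecomposable n N" using ind reflects_is_zero[OF R] unfolding indecomposable_iff by blast
next
  assume ind: "indecomposable n N"
  have "(\<forall>v. U v = {vzero}) \<or> (\<forall>v. X v = {vzero})" if D: "decomposes n M U X" for U X
  proof -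
    define pull where "pull Y v = (if is_sink (rori M) v
      then {x \<in> V (rdim N v). \<forall>w\<in>nbrs n v. lin (rdim M w) (rdim N v) (rmap N v w) x \<in> Y w} else Y v)" for Y v
    have "decomposes n N (pull U) (pull X)" using decomposes_pull[OF R D] unfolding pull_def .
    then have "(\<forall>v. pull U v = {vzero}) \<or> (\<forall>v. pull X v = {vzero})" using ind unfolding indecomposable_iff by blast
    moreover have "\<forall>v. Y v = {vzero}" if Y: "\<forall>v. pull Y v = {vzero}" and YZ: "decomposes n M Y Z" for Y Z
    proof
      fix v
      have subY: "subrep n M Y" and subZ: "subrep n M Z" using YZ by (auto simp: decomposes_def)
      have src: "Y v = {vzero}" if "\<not> is_sink (rori M) v" for v
        using Y[rule_format, of v] that by (simp add: pull_def)
      show "Y v = {vzero}"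
      proof (cases "is_sink (rori M) v")
        case v: True
        let ?g = "wsum (nbrs n v) (rdim M) (rdim M v) (\<lambda>w. rmap M w v)"
        have "z = vzero" if z: "z \<in> Y v" for z
        proof -
          obtain y where y: "\<forall>w\<in>nbrs n v. y w \<in> V (rdim M w)" "?g y = z"
            using reflects_right[OF R v, of z] subrep_V[OF subY] z by blast
          have "y w \<in> Z w" if w: "w \<in> nbrs n v" for w
          proof -
            obtain a b where ab: "a \<in> Y w" "b \<in> Z w" "y w = (\<lambda>i. a i + b i)"
              using decomposes_split[OF YZ y(1)[rule_format, OF w]] .
            then have "a = vzero" using src nbrs_is_sink[OF w] v by blast
            then show ?thesis using ab by (simp add: vzero_def)
          qed
          then have "z \<in> Z v" using wsum_subrep[OF subZ v, of y] y(2) by simp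
          then show ?thesis using z YZ unfolding decomposes_def by blast
        qed
        then show ?thesis using subsp_vzero[OF subrep_subsp[OF subY, of v]] by blast
      qed (rule src)
    qed
    ultimately show ?thesis using D decomposes_commute[OF D] by blast
  qed
  then show "indecomposable n M" using ind reflects_is_zero[OF R] unfolding indecomposable_iff by blast
qed

text \<open>The maps between a connected component of the support and the rest are zero, so the
  restrictions to the two parts are complementary summands.\<close>

lemma indecomposable_connected:
  fixes M :: "'a::field qrep"
  assumes ind: "indecomposable n M" and u: "u \<in> supp M" and v: "v \<in> supp M"
  shows "(u, v) \<in> {(x, y). adj n x y \<and> x \<in> supp M \<and> y \<in> supp M}\<^sup>*"
proof (rule ccontr)
  let ?E = "{(x, y). adj n x y \<and> x \<in> supp M \<and> y \<in> supp M}"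
  assume uv: "(u, v) \<notin> ?E\<^sup>*"
  define C where "C = {x. (u, x) \<in> ?E\<^sup>*}"
  define U where "U = (\<lambda>x. if x \<in> C then V (rdim M x) else {vzero :: nat \<Rightarrow> 'a})"
  define X where "X = (\<lambda>x. if x \<in> C then {vzero :: nat \<Rightarrow> 'a} else V (rdim M x))"
  have CE: "a \<in> C \<longleftrightarrow> b \<in> C" if "adj n a b" "rdim M a \<noteq> 0" "rdim M b \<noteq> 0" for a b
  proof -
    have "(a, b) \<in> ?E" "(b, a) \<in> ?E" using that adj_sym by (auto simp: supp_def)
    then show ?thesis unfolding C_def by (auto intro: rtrancl_into_rtrancl)
  qed
  have sv: "subspace_of d {vzero :: nat \<Rightarrow> 'a}" "subspace_of d (V d :: (nat \<Rightarrow> 'a) set)" for d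
    using subsp_V[of d] by (auto simp: subspace_of_iff subsp_def vzero_def V_def)
  have arr: "lin (rdim M b) (rdim M a) (rmap M a b) x = vzero"
    if "adj n a b" "x \<in> V (rdim M a)" "a \<in> C \<longleftrightarrow> b \<notin> C" for a b and x :: "nat \<Rightarrow> 'a"
  proof -
    have "rdim M a = 0 \<or> rdim M b = 0" using CE that by blast
    then show ?thesis using that(2) by (auto simp: V_0 lin_def vzero_def)
  qed
  have "subrep n M U" "subrep n M X"
    unfolding subrep_def arrow_def using sv arr by (auto simp: U_def X_def)
  moreover have "U x \<inter> X x = {vzero} \<and> (\<forall>z\<in>V (rdim M x). \<exists>a\<in>U x. \<exists>b\<in>X x. z = (\<lambda>i. a i + b i))" for x
    by (auto simp: U_def X_def vzero_def V_def)
  ultimately have "decomposes n M U X" by (simp add: decomposes_def)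
  then have "(\<forall>x. U x = {vzero}) \<or> (\<forall>x. X x = {vzero})" using ind unfolding indecomposable_iff by blast
  moreover have "u \<in> C" "v \<notin> C" using uv by (auto simp: C_def)
  ultimately have "V (rdim M u) = {vzero :: nat \<Rightarrow> 'a} \<or> V (rdim M v) = {vzero :: nat \<Rightarrow> 'a}"
    by (auto simp: U_def X_def dest: spec[of _ u] spec[of _ v])
  then show False using u v by (simp add: V_eq_vzero_iff supp_def)
qed

section \<open>Dimension vectors and explicit indecomposable modules\<close>

lemma tdist_parity: "even (tdist u v) \<longleftrightarrow> (even (length u) \<longleftrightarrow> even (length v))"
  by (induction u v rule: tdist.induct) auto

definition idim :: "'a::field qrep \<Rightarrow> nat list \<Rightarrow> int" where
  "idim M v = int (rdim M v)"

text \<open>The action of both shifts on dimension vectors. It is integer valued because the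
  dimension vector of a simple module at a sink is sent to its negative.\<close>

definition reflect :: "nat \<Rightarrow> bool \<Rightarrow> (nat list \<Rightarrow> int) \<Rightarrow> nat list \<Rightarrow> int" where
  "reflect n e f v = (if valid n v \<and> is_sink e v then (\<Sum>w\<in>nbrs n v. f w) - f v else f v)"

text \<open>Neighbours of a reflected vertex are not reflected, so both reflections use the same
  neighbour sum. Hence one operator describes shift and inverse shift.\<close>

lemma reflect_reflect [simp]: "reflect n e (reflect n e f) = f"
proof
  fix v
  show "reflect n e (reflect n e f) v = f v"
  proof (cases "valid n v \<and> is_sink e v")
    case True
    then have "(\<Sum>w\<in>nbrs n v. reflect n e f w) = (\<Sum>w\<in>nbrs n v. f w)"
      using nbrs_is_sink by (intro sum.cong) (auto simp: reflect_def)
    then show ?thesis using True by (simp add: reflect_def)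
  next
    case False
    then have "reflect n e g v = g v" for g by (auto simp: reflect_def)
    then show ?thesis by simp
  qed
qed

lemma reflect_add: "reflect n e (\<lambda>v. f v + g v) = (\<lambda>v. reflect n e f v + reflect n e g v)"
  by (auto simp: reflect_def sum.distrib fun_eq_iff)

lemma reflect_sum: "reflect n e (\<lambda>v. \<Sum>y\<in>Y. f y v) = (\<lambda>v. \<Sum>y\<in>Y. reflect n e (f y) v)"
proof (induction Y rule: infinite_finite_induct)
  case (insert y Y)
  then show ?case using reflect_add[of n e "f y" "\<lambda>v. \<Sum>y\<in>Y. f y v"] by simp
qed (auto simp: reflect_def fun_eq_iff)

lemma reflects_idim:
  assumes R: "reflects n M N"
  shows "idim N = reflect n (rori M) (idim M)"
proof
  fix v
  show "idim N v = reflect n (rori M) (idim M) v"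
  proof (cases "is_sink (rori M) v")
    case True
    then have "int (\<Sum>w\<in>nbrs n v. rdim M w) = int (rdim N v) + int (rdim M v)"
      using reflects_dim_sum[OF R True] by simp
    moreover have "rdim M v = 0 \<and> rdim N v = 0" if "\<not> valid n v"
      using that R is_rep_invalid unfolding reflects_def by blast
    ultimately show ?thesis using True by (auto simp: reflect_def idim_def)
  next
    case False
    then show ?thesis using R by (simp add: reflect_def idim_def reflects_def)
  qed
qed

text \<open>All that is remembered about a module along its orbit; the maps are forgotten.\<close>

definition indec_rep :: "nat \<Rightarrow> bool \<Rightarrow> (nat list \<Rightarrow> int) \<Rightarrow> 'a::field qrep \<Rightarrow> bool" where
  "indec_rep n e f M \<longleftrightarrow> is_rep n M \<and> indecomposable n M \<and> rori M = e \<and> idim M = f"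

lemma indec_repD:
  "indec_rep n e f M \<Longrightarrow> is_rep n M" "indec_rep n e f M \<Longrightarrow> indecomposable n M"
  "indec_rep n e f M \<Longrightarrow> rori M = e" "indec_rep n e f M \<Longrightarrow> idim M = f"
  by (simp_all add: indec_rep_def)

lemma indec_rep_rdim: "indec_rep n e f M \<Longrightarrow> int (rdim M v) = f v"
  by (auto simp: indec_rep_def idim_def)

text \<open>\<open>nc\<close> excludes a module concentrated at a reflected vertex. By
  indecomposability the sequences are then exact on the right as well, which gives the
  dimensions.\<close>

lemma indec_rep_sig:
  fixes M :: "'a::field qrep"
  assumes M: "indec_rep n e f M" and nc: "\<And>v. is_sink e v \<Longrightarrow> \<exists>w. w \<noteq> v \<and> f w \<noteq> 0"
  shows "indec_rep n (\<not> e) (reflect n e f) (sig n M)"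
proof -
  have "shift_rel n M (sig n M)"
    unfolding sig_def by (rule someI_ex[OF shift_exists[OF indec_repD(1)[OF M]]])
  moreover have "right_exact (nbrs n v) (rdim M) (rdim M v) (\<lambda>w. rmap M w v)" if v: "is_sink (rori M) v" for v
  proof -
    obtain w where w: "w \<noteq> v" "f w \<noteq> 0" using nc[of v] v indec_repD(3)[OF M] by blast
    then have "rdim M w \<noteq> 0" using indec_rep_rdim[OF M, of w] by simp
    then show ?thesis using indecomposable_right_exact[OF indec_repD(2)[OF M] v _ w(1)] by blast
  qed
  ultimately have R: "reflects n M (sig n M)" by (rule reflects_of_shift)
  show ?thesis
    unfolding indec_rep_def
  proof (intro conjI)
    show "is_rep n (sig n M)" using R unfolding reflects_def by blast
    show "indecomposable n (sig n M)" using reflects_indecomposable[OF R] indec_repD(2)[OF M] by blast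
    show "rori (sig n M) = (\<not> e)" using R indec_repD(3)[OF M] unfolding reflects_def by blast
    show "idim (sig n M) = reflect n e f" unfolding reflects_idim[OF R] indec_repD(3,4)[OF M] ..
  qed
qed

text \<open>Here the reflected vertices are the sources of \<open>M\<close>, that is, the sinks for
  \<open>\<not> e\<close>. The relation \<open>reflects\<close> leads from \<open>sigm n M\<close>
  back to \<open>M\<close>, and the dimension formula is inverted by the involution.\<close>

lemma indec_rep_sigm:
  fixes M :: "'a::field qrep"
  assumes M: "indec_rep n e f M" and nc: "\<And>v. \<not> is_sink e v \<Longrightarrow> \<exists>w. w \<noteq> v \<and> f w \<noteq> 0"
  shows "indec_rep n (\<not> e) (reflect n (\<not> e) f) (sigm n M)"
proof -
  have "shiftm_rel n M (sigm n M)"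
    unfolding sigm_def by (rule someI_ex[OF shiftm_exists[OF indec_repD(1)[OF M]]])
  moreover have "left_exact (nbrs n v) (rdim M) (rdim M v) (rmap M v)" if v: "\<not> is_sink (rori M) v" for v
  proof -
    obtain w where w: "w \<noteq> v" "f w \<noteq> 0" using nc[of v] v indec_repD(3)[OF M] by blast
    then have "rdim M w \<noteq> 0" using indec_rep_rdim[OF M, of w] by simp
    then show ?thesis using indecomposable_left_exact[OF indec_repD(2)[OF M] v _ w(1)] by blast
  qed
  ultimately have R: "reflects n (sigm n M) M" by (rule reflects_of_shiftm)
  have ori: "rori (sigm n M) = (\<not> e)" using R indec_repD(3)[OF M] unfolding reflects_def by blast
  show ?thesis
    unfolding indec_rep_def
  proof (intro conjI)
    show "is_rep n (sigm n M)" using R unfolding reflects_def by blast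
    show "indecomposable n (sigm n M)" using reflects_indecomposable[OF R] indec_repD(2)[OF M] by blast
    have "f = reflect n (\<not> e) (idim (sigm n M))" using reflects_idim[OF R] unfolding ori indec_repD(4)[OF M] .
    then show "idim (sigm n M) = reflect n (\<not> e) f" using reflect_reflect by metis
  qed (rule ori)
qed

section \<open>Indecomposable modules given by matrices\<close>

lemma decomposes_line:
  fixes M :: "'a::field qrep"
  assumes D: "decomposes n M U X" and v: "rdim M v = 1"
  shows "U v = {vzero} \<and> X v = V 1 \<or> U v = V 1 \<and> X v = {vzero}"
proof -
  have U: "subsp (U v)" "U v \<subseteq> V 1" and X: "subsp (X v)" "X v \<subseteq> V 1"
    using D subrep_subsp subrep_V v unfolding decomposes_def by metis+
  have full: "Y = V 1" if Y: "subsp Y" "Y \<subseteq> V 1" "y \<in> Y" "y \<noteq> vzero" for Y and y :: "nat \<Rightarrow> 'a"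
  proof
    have ys: "y (Suc k) = 0" for k using Y(2,3) by (auto simp: V_def)
    have y0: "y 0 \<noteq> 0"
    proof
      assume "y 0 = 0"
      then have "y i = 0" for i using ys by (cases i) auto
      then show False using Y(4) by (auto simp: vzero_def)
    qed
    show "V 1 \<subseteq> Y"
    proof
      fix z :: "nat \<Rightarrow> 'a" assume z: "z \<in> V 1"
      have "(\<lambda>i. (z 0 / y 0) * y i) i = z i" for i
      proof (cases i)
        case 0
        then show ?thesis using y0 by simp
      next
        case (Suc k)
        then have "y i = 0" "z i = 0" using ys z by (auto simp: V_def)
        then show ?thesis by simp
      qed
      then have "z = (\<lambda>i. (z 0 / y 0) * y i)" by auto
      then show "z \<in> Y" using subsp_scale[OF Y(1,3), of "z 0 / y 0"] by simp
    qed
  qed (use Y in auto)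
  have UX: "U v \<inter> X v = {vzero}" using D by (simp add: decomposes_def)
  have ne: "V 1 \<noteq> {vzero :: nat \<Rightarrow> 'a}" by (simp add: V_eq_vzero_iff)
  have "U v = {vzero} \<or> U v = V 1"
    using full[OF U] subsp_vzero[OF U(1)] by blast
  moreover have "X v = {vzero} \<or> X v = V 1"
    using full[OF X] subsp_vzero[OF X(1)] by blast
  moreover have "\<not> (U v = V 1 \<and> X v = V 1)" using UX ne by auto
  moreover have "\<not> (U v = {vzero} \<and> X v = {vzero})"
  proof
    assume *: "U v = {vzero} \<and> X v = {vzero}"
    have "z = vzero" if z: "z \<in> V 1" for z :: "nat \<Rightarrow> 'a"
    proof -
      obtain u x where "u \<in> U v" "x \<in> X v" "z = (\<lambda>i. u i + x i)"
        by (rule decomposes_split[OF D z[folded v]])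
      then show ?thesis using * by (simp add: vzero_def)
    qed
    then have "V 1 = {vzero :: nat \<Rightarrow> 'a}" using vzero_in_V by blast
    then show False using ne by blast
  qed
  ultimately show ?thesis by blast
qed

lemma decomposes_dim0:
  assumes "decomposes n M U X" "rdim M v = 0"
  shows "U v = {vzero}" "X v = {vzero}"
proof -
  have "U v \<subseteq> V 0" "X v \<subseteq> V 0" using assms subrep_V unfolding decomposes_def by metis+
  moreover have "vzero \<in> U v" "vzero \<in> X v" using assms(1) subsp_vzero subrep_subsp unfolding decomposes_def by metis+
  ultimately show "U v = {vzero}" "X v = {vzero}" by (auto simp: V_0)
qed

definition simple_rep :: "bool \<Rightarrow> nat list \<Rightarrow> 'a::field qrep" where
  "simple_rep e a = \<lparr>rori = e, rdim = (\<lambda>v. if v = a then 1 else 0), rmap = (\<lambda>_ _ _ _. 0)\<rparr>"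

lemma indec_rep_simple_rep:
  assumes "valid n a"
  shows "indec_rep n e (\<lambda>v. if v = a then 1 else 0) (simple_rep e a :: 'a::field qrep)"
proof -
  have "(\<forall>v. U v = {vzero}) \<or> (\<forall>v. X v = {vzero})"
    if D: "decomposes n (simple_rep e a :: 'a qrep) U X" for U X
  proof -
    have "U v = {vzero}" "X v = {vzero}" if "v \<noteq> a" for v
      using decomposes_dim0[OF D] that by (simp_all add: simple_rep_def)
    moreover have "U a = {vzero} \<or> X a = {vzero}"
      using decomposes_line[OF D, of a] by (auto simp: simple_rep_def)
    ultimately show ?thesis by metis
  qed
  then have "indecomposable n (simple_rep e a :: 'a qrep)"
    unfolding indecomposable_iff by (auto simp: is_zero_def simple_rep_def)
  then show ?thesis using assms by (auto simp: indec_rep_def idim_def simple_rep_def is_rep_def)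
qed

text \<open>All entries are 1, so that each new line maps injectively into every nonzero space next
  to it.\<close>

definition attach :: "'a::field qrep \<Rightarrow> nat list set \<Rightarrow> 'a qrep" where
  "attach P Y = \<lparr>rori = rori P, rdim = (\<lambda>v. if v \<in> Y then 1 else rdim P v),
     rmap = (\<lambda>x y. if x \<in> Y then (\<lambda>_ _. 1) else rmap P x y)\<rparr>"

text \<open>The new vertices are sources, so a decomposition restricts to \<open>P\<close>, where
  one summand vanishes. At a new vertex that summand is mapped into zero spaces, although the map to
  some neighbour in the support of \<open>P\<close> is injective; so it vanishes there too.\<close>

lemma indec_rep_attach:
  fixes P :: "'a::field qrep"
  assumes P: "indec_rep n e f P" and Y: "finite Y"
    and y: "\<And>y. y \<in> Y \<Longrightarrow> \<not> is_sink e y \<and> f y = 0 \<and> (\<exists>w\<in>nbrs n y. f w \<noteq> 0)"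
  shows "indec_rep n e (\<lambda>v. f v + (\<Sum>y\<in>Y. if v = y then 1 else 0)) (attach P Y)"
proof -
  let ?A = "attach P Y"
  have sel: "rori ?A = e" "rori P = e" "\<And>v. v \<in> Y \<Longrightarrow> rdim ?A v = 1" "\<And>v. v \<notin> Y \<Longrightarrow> rdim ?A v = rdim P v"
    "\<And>x w. x \<in> Y \<Longrightarrow> rmap ?A x w = (\<lambda>_ _. 1)" "\<And>x w. x \<notin> Y \<Longrightarrow> rmap ?A x w = rmap P x w"
    "\<And>v. f v = int (rdim P v)"
    using P by (auto simp: attach_def indec_rep_def idim_def)
  have yP: "rdim P v = 0" if "v \<in> Y" for v using y[OF that] sel(7) by simp
  have "valid n v" if v: "v \<in> Y" for v
  proof -
    have "nbrs n v \<noteq> {}" using y[OF v] by blast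
    then show ?thesis using nbrs_invalid by blast
  qed
  moreover have "{v. rdim ?A v \<noteq> 0} \<subseteq> Y \<union> {v. rdim P v \<noteq> 0}" by (auto simp: attach_def)
  then have "finite {v. rdim ?A v \<noteq> 0}"
    by (rule finite_subset) (use Y indec_repD(1)[OF P] in \<open>simp add: is_rep_def\<close>)
  ultimately have rep: "is_rep n ?A"
    using indec_repD(1)[OF P] by (auto simp: is_rep_def attach_def split: if_splits)
  have idim: "idim ?A = (\<lambda>v. f v + (\<Sum>y\<in>Y. if v = y then 1 else 0))"
    using Y yP by (auto simp: fun_eq_iff idim_def sel attach_def)
  have "(\<forall>v. U v = {vzero}) \<or> (\<forall>v. X v = {vzero})" if D: "decomposes n ?A U X" for U X
  proof -
    define res where "res Z v = (if v \<in> Y then {vzero :: nat \<Rightarrow> 'a} else Z v)" for Z v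
    have subU: "subrep n ?A U" and subX: "subrep n ?A X" using D by (auto simp: decomposes_def)
    have sub: "subrep n P (res Z)" if Z: "subrep n ?A Z" for Z
      unfolding subrep_def
    proof (intro conjI allI impI ballI)
      fix v show "subspace_of (rdim P v) (res Z v)"
      proof (cases "v \<in> Y")
        case True
        then show ?thesis by (simp add: res_def subspace_of_iff subsp_def vzero_def V_def)
      next
        case False
        have "subspace_of (rdim ?A v) (Z v)" using Z unfolding subrep_def by blast
        then show ?thesis using False sel(4)[OF False] by (simp add: res_def)
      qed
    next
      fix a b u assume *: "arrow n (rori P) a b" "u \<in> res Z a"
      then have "b \<notin> Y" using y sel by (auto simp: arrow_def)
      show "lin (rdim P b) (rdim P a) (rmap P a b) u \<in> res Z b"
      proof (cases "a \<in> Y")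
        case True
        then show ?thesis using *(2) \<open>b \<notin> Y\<close> subsp_vzero[OF subrep_subsp[OF Z]] by (simp add: res_def)
      next
        case False
        then have "u \<in> Z a" using *(2) by (simp add: res_def)
        then have "lin (rdim ?A b) (rdim ?A a) (rmap ?A a b) u \<in> Z b"
          using Z *(1) sel by (auto simp: subrep_def)
        then show ?thesis using False \<open>b \<notin> Y\<close> sel by (simp add: res_def)
      qed
    qed
    have "res U v \<inter> res X v = {vzero} \<and> (\<forall>z\<in>V (rdim P v). \<exists>u\<in>res U v. \<exists>x\<in>res X v. z = (\<lambda>i. u i + x i))" for v
    proof (cases "v \<in> Y")
      case True
      then show ?thesis using yP[OF True] by (simp add: res_def V_0) (simp add: vzero_def)
    next
      case False
      then show ?thesis using D sel(4)[OF False] by (simp add: res_def decomposes_def)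
    qed
    then have "decomposes n P (res U) (res X)" using sub[OF subU] sub[OF subX] by (simp add: decomposes_def)
    then have "(\<forall>v. res U v = {vzero}) \<or> (\<forall>v. res X v = {vzero})"
      using P unfolding indec_rep_def indecomposable_iff by blast
    moreover have "\<forall>v. Z v = {vzero}" if Z: "subrep n ?A Z" "\<forall>v. res Z v = {vzero}" for Z
    proof
      fix v
      have out: "Z w = {vzero}" if "w \<notin> Y" for w using Z(2)[rule_format, of w] that by (simp add: res_def)
      show "Z v = {vzero}"
      proof (cases "v \<in> Y")
        case v: True
        obtain w where w: "w \<in> nbrs n v" "f w \<noteq> 0" using y[OF v] by blast
        have wY: "w \<notin> Y" using w(2) y by blast
        have "z = vzero" if z: "z \<in> Z v" for z
        proof -
          have "lin (rdim ?A w) (rdim ?A v) (rmap ?A v w) z \<in> Z w"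
            using y[OF v] sel(1) by (intro subrep_arrow[OF Z(1) w(1) _ z]) simp
          then have l: "lin (rdim P w) 1 (\<lambda>_ _. 1) z = vzero"
            using out[OF wY] v wY by (simp add: sel)
          have "z 0 = 0" using fun_cong[OF l, of 0] w(2) sel(7)[of w] by (simp add: lin_def vzero_def)
          moreover have "z \<in> V 1" using subrep_V[OF Z(1), of v] z v by (auto simp: sel)
          ultimately have "z i = 0" for i by (cases i) (auto simp: V_def)
          then show ?thesis by (auto simp: vzero_def)
        qed
        then show ?thesis using subsp_vzero[OF subrep_subsp[OF Z(1), of v]] by blast
      qed (rule out)
    qed
    ultimately show ?thesis using subU subX by blast
  qed
  moreover have "\<not> is_zero ?A"
  proof -
    obtain v where "rdim P v \<noteq> 0" using P by (auto simp: indec_rep_def indecomposable_def is_zero_def)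
    then have "rdim ?A v \<noteq> 0" by (auto simp: attach_def)
    then show ?thesis by (auto simp: is_zero_def)
  qed
  ultimately have "indecomposable n ?A" unfolding indecomposable_iff by blast
  then show ?thesis using rep idim sel by (simp add: indec_rep_def)
qed

text \<open>The lines have images spanned by \<open>e0\<close>, \<open>e1\<close> and
  \<open>e0 + e1\<close>, which are pairwise independent over every field.\<close>

definition star :: "bool \<Rightarrow> nat list \<Rightarrow> nat list \<Rightarrow> nat list \<Rightarrow> nat list \<Rightarrow> 'a::field qrep" where
  "star e a y1 y2 y3 = \<lparr>rori = e, rdim = (\<lambda>v. if v = a then 2 else if v \<in> {y1, y2, y3} then 1 else 0),
     rmap = (\<lambda>x _ i _. if x = y1 then (if i = 0 then 1 else 0) else if x = y2 then (if i = 1 then 1 else 0) else 1)\<rparr>"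

text \<open>Each line lies entirely in one summand, so two of the three lie in the same one. Their
  images span the plane; the other summand vanishes at \<open>a\<close> and, by injectivity, at the
  three sources.\<close>

lemma indec_rep_star:
  fixes e a y1 y2 y3
  defines "S \<equiv> star e a y1 y2 y3 :: 'a::field qrep"
  assumes a: "is_sink e a" and y: "y1 \<in> nbrs n a" "y2 \<in> nbrs n a" "y3 \<in> nbrs n a" "y1 \<noteq> y2" "y1 \<noteq> y3" "y2 \<noteq> y3"
  shows "indec_rep n e (\<lambda>v. if v = a then 2 else if v \<in> {y1, y2, y3} then 1 else 0) S"
proof -
  have ya: "z \<noteq> a" "\<not> is_sink e z" "a \<in> nbrs n z" "valid n z" "valid n a" if "z \<in> {y1, y2, y3}" for z
    using that y a nbrs_is_sink adj_sym adj_valid by (auto simp: nbrs_def)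
  have d: "rdim S a = 2" "\<And>z. z \<in> {y1, y2, y3} \<Longrightarrow> rdim S z = 1" "rori S = e"
    using ya by (auto simp: S_def star_def)
  have d0: "rdim S v = 0" if "v \<notin> {a, y1, y2, y3}" for v using that by (auto simp: S_def star_def)
  define l where "l z = lin 2 1 (rmap S z a) (\<lambda>i. if i = 0 then 1 else 0)" for z
  have arrow: "l z \<in> Z a" if "subrep n S Z" "z \<in> {y1, y2, y3}" "Z z = V 1" for Z z
  proof -
    have "(\<lambda>i. if i = 0 then 1 else 0) \<in> Z z" unfolding that(3) by (simp add: V_def)
    then have "lin (rdim S a) (rdim S z) (rmap S z a) (\<lambda>i. if i = 0 then 1 else 0) \<in> Z a"
      using ya[OF that(2)] d(3) by (intro subrep_arrow[OF that(1)]) auto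
    then show ?thesis by (simp add: l_def d(1) d(2)[OF that(2)])
  qed
  have l: "l y1 = (\<lambda>i. if i = 0 then 1 else 0)" "l y2 = (\<lambda>i. if i = 1 then 1 else 0)"
    "l y3 = (\<lambda>i. if i < 2 then 1 else 0)"
    using y by (auto simp: l_def lin_def S_def star_def fun_eq_iff)
  have gen: "Z = V 2" if Z: "subsp Z" "Z \<subseteq> V 2" and two: "l z \<in> Z" "l z' \<in> Z" "z \<noteq> z'" "z \<in> {y1, y2, y3}" "z' \<in> {y1, y2, y3}" for Z z z'
  proof -
    have m: "(\<lambda>i. k * u i + k' * v i) \<in> Z" if "u \<in> Z" "v \<in> Z" for u v :: "nat \<Rightarrow> 'a" and k k'
      using subsp_add[OF Z(1) subsp_scale[OF Z(1) that(1)] subsp_scale[OF Z(1) that(2)]] .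
    have "l y1 \<in> Z \<and> l y2 \<in> Z"
    proof -
      have 1: "l y2 \<in> Z" if "l y1 \<in> Z" "l y3 \<in> Z"
      proof -
        have "l y2 = (\<lambda>i. (- 1) * l y1 i + 1 * l y3 i)" unfolding l by auto
        then show ?thesis using m[OF that, of "-1" 1] by simp
      qed
      have 2: "l y1 \<in> Z" if "l y2 \<in> Z" "l y3 \<in> Z"
      proof -
        have "l y1 = (\<lambda>i. (- 1) * l y2 i + 1 * l y3 i)" unfolding l by auto
        then show ?thesis using m[OF that, of "-1" 1] by simp
      qed
      show ?thesis using two 1 2 by auto
    qed
    then have m12: "(\<lambda>i. x 0 * l y1 i + x 1 * l y2 i) \<in> Z" for x :: "nat \<Rightarrow> 'a" using m by blast
    have "x \<in> Z" if x: "x \<in> V 2" for x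
    proof -
      have "x 0 * l y1 i + x 1 * l y2 i = x i" for i
        using x by (cases "i = 0"; cases "i = 1") (auto simp: l V_def)
      then show ?thesis using m12[of x] by simp
    qed
    then have "V 2 \<subseteq> Z" by blast
    then show ?thesis using Z(2) by blast
  qed
  have "(\<forall>v. U v = {vzero}) \<or> (\<forall>v. X v = {vzero})" if D: "decomposes n S U X" for U X
  proof -
    have subU: "subrep n S U" and subX: "subrep n S X" and I: "U a \<inter> X a = {vzero}"
      using D by (auto simp: decomposes_def)
    have line: "U z = {vzero} \<and> X z = V 1 \<or> U z = V 1 \<and> X z = {vzero}" if "z \<in> {y1, y2, y3}" for z
      using decomposes_line[OF D d(2)[OF that]] .
    have triv: "\<forall>v. Z' v = {vzero}" if Z: "subrep n S Z" "subrep n S Z'" "Z a \<inter> Z' a = {vzero}"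
      and two: "Z z = V 1" "Z z' = V 1" "z \<noteq> z'" "z \<in> {y1, y2, y3}" "z' \<in> {y1, y2, y3}"
      and ln: "\<And>z. z \<in> {y1, y2, y3} \<Longrightarrow> Z' z = {vzero} \<or> Z' z = V 1"
      for Z Z' z z'
    proof
      have "Z a = V 2"
        using gen[OF subrep_subsp[OF Z(1)] _ arrow[OF Z(1) two(4,1)] arrow[OF Z(1) two(5,2)] two(3-5)]
          subrep_V[OF Z(1), of a] d(1) by simp
      moreover have "Z' a \<subseteq> V 2" using subrep_V[OF Z(2), of a] d(1) by simp
      ultimately have Z'a: "Z' a = {vzero}" using Z(3) by blast
      fix v
      consider "v = a" | "v \<in> {y1, y2, y3}" | "v \<notin> {a, y1, y2, y3}" by blast
      then show "Z' v = {vzero}"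
      proof cases
        case 1
        then show ?thesis using Z'a by simp
      next
        case 2
        have "l v \<noteq> vzero"
        proof
          assume "l v = vzero"
          then have "l v 0 = 0 \<and> l v 1 = 0" by (simp add: vzero_def)
          then show False using 2 l by auto
        qed
        then have "Z' v \<noteq> V 1" using arrow[OF Z(2) 2] Z'a by blast
        then show ?thesis using ln[OF 2] by blast
      next
        case 3
        then show ?thesis using subrep_V[OF Z(2), of v] d0[OF 3] subsp_vzero[OF subrep_subsp[OF Z(2), of v]]
          by (auto simp: V_0)
      qed
    qed
    have cases: "\<exists>z z'. z \<noteq> z' \<and> z \<in> {y1, y2, y3} \<and> z' \<in> {y1, y2, y3} \<and> (U z = V 1 \<and> U z' = V 1 \<or> X z = V 1 \<and> X z' = V 1)"
      using line[of y1] line[of y2] line[of y3] y(4-6) by auto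
    have lnU: "U z = {vzero} \<or> U z = V 1" and lnX: "X z = {vzero} \<or> X z = V 1" if "z \<in> {y1, y2, y3}" for z
      using line[OF that] by blast+
    obtain z z' where z: "z \<noteq> z'" "z \<in> {y1, y2, y3}" "z' \<in> {y1, y2, y3}" "U z = V 1 \<and> U z' = V 1 \<or> X z = V 1 \<and> X z' = V 1"
      using cases by blast
    from z(4) show ?thesis
    proof
      assume *: "U z = V 1 \<and> U z' = V 1"
      have "\<forall>v. X v = {vzero}"
        using triv[OF subU subX I conjunct1[OF *] conjunct2[OF *] z(1-3) lnX] .
      then show ?thesis by blast
    next
      assume *: "X z = V 1 \<and> X z' = V 1"
      have "X a \<inter> U a = {vzero}" using I by (simp add: inf_commute)
      then have "\<forall>v. U v = {vzero}"
        using triv[OF subX subU _ conjunct1[OF *] conjunct2[OF *] z(1-3) lnU] by blast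
      then show ?thesis by blast
    qed
  qed
  moreover have "\<not> is_zero S"
  proof
    assume "is_zero S"
    then have "rdim S a = 0" by (simp add: is_zero_def)
    then show False using d(1) by simp
  qed
  ultimately have "indecomposable n S" unfolding indecomposable_iff by blast
  moreover have "is_rep n S"
  proof -
    have "v \<in> {a, y1, y2, y3}" if "rdim S v \<noteq> 0" for v using d0[of v] that by argo
    then have "{v. rdim S v \<noteq> 0} \<subseteq> {a, y1, y2, y3}" by (intro subsetI) simp
    then have "finite {v. rdim S v \<noteq> 0}" by (rule finite_subset) simp
    moreover have "valid n v" if "rdim S v \<noteq> 0" for v using ya[of v] ya(5)[of y1] d0[of v] that by auto
    ultimately show ?thesis unfolding is_rep_def by blast
  qed
  ultimately show ?thesis using d(3) by (auto simp: indec_rep_def idim_def S_def star_def fun_eq_iff)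
qed

section \<open>Centers of supports\<close>

text \<open>The dimension vector of \<open>P j a\<close>. The step to \<open>Suc j\<close> reflects
  at the vertices whose distance from \<open>a\<close> has the parity of \<open>Suc j\<close>; the
  sphere just outside the ball is among them.\<close>

primrec orbit_dim :: "nat \<Rightarrow> nat list \<Rightarrow> nat \<Rightarrow> nat list \<Rightarrow> int" where
  "orbit_dim n a 0 = (\<lambda>v. if v = a then 1 else 0)"
| "orbit_dim n a (Suc j) = reflect n (even (length a) = even (Suc j)) (orbit_dim n a j)"

lemma reflect_nonzero:
  "reflect n e f v \<noteq> 0 \<Longrightarrow> f v \<noteq> 0 \<or> (\<exists>w. adj n v w \<and> f w \<noteq> 0)"
  unfolding reflect_def nbrs_def by (auto split: if_splits intro: ccontr dest!: sum.not_neutral_contains_not_neutral)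

lemma reflect_support:
  assumes "\<And>v. f v \<noteq> 0 \<Longrightarrow> tdist c v \<le> \<rho>" "reflect n e f v \<noteq> 0"
  shows "tdist c v \<le> Suc \<rho>"
proof -
  consider "f v \<noteq> 0" | w where "adj n v w" "f w \<noteq> 0" using reflect_nonzero[OF assms(2)] by blast
  then show ?thesis
  proof cases
    case 1
    then show ?thesis using assms(1) le_SucI by blast
  next
    case 2
    then show ?thesis using assms(1)[OF 2(2)] tdist_adj[OF 2(1), of c] by auto
  qed
qed

text \<open>A vertex just outside the ball has only one neighbour inside, the next vertex towards
  \<open>c\<close>, and takes over its value. This keeps the dimension one on the boundary of
  growing balls.\<close>

lemma reflect_leaf:
  assumes f: "\<And>v. f v \<noteq> 0 \<Longrightarrow> tdist c v \<le> \<rho>" and ux: "adj n u x" "tdist c u = \<rho>" "tdist c x = Suc \<rho>" and e: "is_sink e x"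
  shows "reflect n e f x = f u"
proof -
  have "f x = 0" using f[of x] ux(3) by auto
  have "(\<Sum>w\<in>nbrs n x. f w) = (\<Sum>w\<in>nbrs n x. if w = u then f u else 0)"
  proof (rule sum.cong)
    fix w assume w: "w \<in> nbrs n x"
    show "f w = (if w = u then f u else 0)"
    proof (cases "f w = 0")
      case True
      then show ?thesis by auto
    next
      case False
      have xw: "adj n x w" using w by (simp add: nbrs_def)
      have "tdist c x = Suc (tdist c w)" using f[OF False] tdist_adj[OF xw, of c] ux(3) by auto
      then have "w = u" using tdist_descent_unique[OF xw adj_sym[OF ux(1)]] ux(2,3) by simp
      then show ?thesis by simp
    qed
  qed simp
  also have "\<dots> = f u" using adj_sym[OF ux(1)] by (simp add: nbrs_def[symmetric] sum.delta) (simp add: nbrs_def)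
  finally show ?thesis using \<open>f x = 0\<close> e adj_valid[OF ux(1)] by (simp add: reflect_def)
qed

text \<open>\<open>c\<close> is arbitrary because balls around several points will be measured from
  a common center.\<close>

lemma orbit_dim_support:
  "orbit_dim n a j v \<noteq> 0 \<Longrightarrow> tdist c v \<le> tdist c a + j"
proof (induction j arbitrary: v)
  case (Suc j)
  then show ?case using reflect_support[of "orbit_dim n a j" c "tdist c a + j" n "even (length a) = even (Suc j)" v] by simp
qed (auto split: if_splits)

lemma orbit_dim_leaf:
  assumes "valid n a" "valid n x" "tdist a x = j"
  shows "orbit_dim n a j x = 1"
  using assms(2,3)
proof (induction j arbitrary: x)
  case 0
  then show ?case by (simp add: tdist_eq_0)
next
  case (Suc j)
  then have "x \<noteq> a" by auto
  then obtain u where u: "adj n x u" "tdist a x = Suc (tdist a u)"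
    using tdist_descent_exists[of n x a] Suc.prems assms(1) by blast
  have "orbit_dim n a (Suc j) x = orbit_dim n a j u"
    unfolding orbit_dim.simps
  proof (rule reflect_leaf[of _ a j])
    show "tdist a v \<le> j" if "orbit_dim n a j v \<noteq> 0" for v using orbit_dim_support[OF that, of a] by simp
    show "is_sink (even (length a) = even (Suc j)) x"
      using tdist_parity[of a x] Suc.prems(2) by (auto simp: is_sink_def)
  qed (use u Suc.prems adj_sym in auto)
  then show ?case using Suc u adj_valid[OF u(1)] by simp
qed

text \<open>Iterated inverse shifts of a simple module. The sinks are at distances of the parity of
  \<open>j\<close> from \<open>a\<close>, so the boundary of the ball consists of sinks.\<close>

lemma orbit_dim_module:
  assumes n: "n \<ge> 3" and a: "valid n a"
  shows "\<exists>M :: 'a::field qrep. indec_rep n (even (length a) = even j) (orbit_dim n a j) M"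
proof (induction j)
  case 0
  then show ?case using indec_rep_simple_rep[OF a, of True] indec_rep_simple_rep[OF a, of "even (length a)"] by auto
next
  case (Suc j)
  let ?e = "even (length a) = even j"
  from Suc obtain M :: "'a qrep" where M: "indec_rep n ?e (orbit_dim n a j) M" by blast
  have "\<exists>w. w \<noteq> v \<and> orbit_dim n a j w \<noteq> 0" if v: "\<not> is_sink ?e v" for v
  \<comment> \<open>Only for \<open>j = 0\<close> is the support a single vertex, and that vertex is
    then a sink and is not reflected.\<close>
  proof (cases "j = 0")
    case True
    then have "v \<noteq> a" using v by (auto simp: is_sink_def)
    then show ?thesis using True by (intro exI[of _ a]) auto
  next
    case False
    obtain x where x: "valid n x" "tdist a x = j" using tdist_extend[OF n a a a, of j] by metis
    obtain y where y: "valid n y" "tdist a y = j" "tdist x y = tdist x a + j" using tdist_extend[OF n a x(1) a, of j] by metis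
    have "x \<noteq> y" using y(3) False by auto
    moreover have "orbit_dim n a j x = 1" "orbit_dim n a j y = 1" using orbit_dim_leaf a x y by auto
    ultimately show ?thesis by (metis zero_neq_one)
  qed
  then have "indec_rep n (\<not> ?e) (reflect n (\<not> ?e) (orbit_dim n a j)) (sigm n M)" by (rule indec_rep_sigm[OF M])
  moreover have e: "(\<not> ?e) = (even (length a) = even (Suc j))" by auto
  ultimately show ?case unfolding orbit_dim.simps e[symmetric] by blast
qed

text \<open>The values are dimensions of a module. The statement mentions no field, so a concrete
  one is chosen.\<close>

lemma orbit_dim_nonneg:
  assumes "n \<ge> 3" "valid n a"
  shows "orbit_dim n a j v \<ge> 0"
proof -
  obtain M :: "rat qrep" where "indec_rep n (even (length a) = even j) (orbit_dim n a j) M"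
    using orbit_dim_module[OF assms] by blast
  then show ?thesis using indec_rep_rdim by (metis of_nat_0_le_iff)
qed

text \<open>A property of the function alone that fixes diameter and center of every indecomposable
  module with this dimension vector: the two distant vertices give a path of length
  \<open>2 * \<rho>\<close>, and the ball admits no longer one.\<close>

definition centered :: "nat \<Rightarrow> nat list \<Rightarrow> nat \<Rightarrow> (nat list \<Rightarrow> int) \<Rightarrow> bool" where
  "centered n c \<rho> f \<longleftrightarrow> valid n c \<and> (\<forall>v. f v \<noteq> 0 \<longrightarrow> tdist c v \<le> \<rho>) \<and>
     (\<exists>u v. valid n u \<and> valid n v \<and> tdist u v = 2 * \<rho> \<and> f u \<noteq> 0 \<and> f v \<noteq> 0)"

text \<open>As distances from \<open>c\<close> and \<open>c'\<close> differ by one, the two bounds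
  say that the support is within \<open>\<rho>\<close> of the edge.\<close>

definition edge_centered :: "nat \<Rightarrow> nat list \<Rightarrow> nat list \<Rightarrow> nat \<Rightarrow> (nat list \<Rightarrow> int) \<Rightarrow> bool" where
  "edge_centered n c c' \<rho> f \<longleftrightarrow> adj n c c' \<and> (\<forall>v. f v \<noteq> 0 \<longrightarrow> tdist c v \<le> Suc \<rho> \<and> tdist c' v \<le> Suc \<rho>) \<and>
     (\<exists>u v. valid n u \<and> valid n v \<and> tdist u v = Suc (2 * \<rho>) \<and> f u \<noteq> 0 \<and> f v \<noteq> 0)"

section \<open>Diameter and center of a module from its dimension vector\<close>

lemma centered_spread:
  assumes "centered n c \<rho> f" "\<rho> > 0"
  shows "\<exists>w. w \<noteq> v \<and> f w \<noteq> 0"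
proof -
  obtain x y where "tdist x y = 2 * \<rho>" "f x \<noteq> 0" "f y \<noteq> 0" using assms(1) unfolding centered_def by blast
  moreover from this have "x \<noteq> y" using assms(2) by auto
  ultimately show ?thesis by metis
qed

lemma edge_centered_spread:
  assumes "edge_centered n c c' \<rho> f"
  shows "\<exists>w. w \<noteq> v \<and> f w \<noteq> 0"
proof -
  obtain x y where "tdist x y = Suc (2 * \<rho>)" "f x \<noteq> 0" "f y \<noteq> 0" using assms(1) unfolding edge_centered_def by blast
  moreover from this have "x \<noteq> y" by auto
  ultimately show ?thesis by metis
qed

text \<open>Connectedness of the support provides a path inside it, and in a tree the length of a
  path is the distance of its ends.\<close>

lemma indec_rep_path:
  assumes M: "indec_rep n e f M" and uv: "f u \<noteq> 0" "f v \<noteq> 0"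
  obtains p where "p \<in> spaths n M" "plen p = tdist u v"
proof -
  have s: "u \<in> supp M" "v \<in> supp M" using indec_rep_rdim[OF M, of u] indec_rep_rdim[OF M, of v] uv by (auto simp: supp_def)
  then have "valid n v" using indec_repD(1)[OF M] by (simp add: is_rep_def supp_def)
  then obtain p where p: "is_path n p" "set p \<subseteq> supp M" "hd p = u" "last p = v"
    using path_of_rtrancl[OF indecomposable_connected[OF indec_repD(2)[OF M] s] s(2)] by blast
  then show ?thesis using that[of p] path_plen[OF p(1)] by (simp add: spaths_def)
qed

lemma spaths_ends:
  assumes M: "indec_rep n e f M" and p: "p \<in> spaths n M"
  shows "is_path n p" "f (hd p) \<noteq> 0" "f (last p) \<noteq> 0"
proof -
  show path: "is_path n p" using p by (simp add: spaths_def)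
  then have "p \<noteq> []" by (simp add: is_path_def)
  then have "hd p \<in> supp M" "last p \<in> supp M" using p by (auto simp: spaths_def)
  then show "f (hd p) \<noteq> 0" "f (last p) \<noteq> 0"
    using indec_rep_rdim[OF M, of "hd p"] indec_rep_rdim[OF M, of "last p"] by (auto simp: supp_def)
qed

lemma diam_eqI:
  assumes "\<And>p. p \<in> spaths n M \<Longrightarrow> plen p \<le> L" "q \<in> spaths n M" "plen q = L"
  shows "diam n M = L"
  unfolding diam_def
proof (rule Max_eqI)
  show "finite (plen ` spaths n M)" by (rule finite_subset[of _ "{..L}"]) (use assms(1) in auto)
  show "L \<in> plen ` spaths n M" using assms(2,3) by blast
qed (use assms(1) in auto)

lemma centered_diam:
  assumes M: "indec_rep n e f M" and c: "centered n c \<rho> f"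
  shows "diam n M = 2 * \<rho>" "has_center n M {c}" "\<exists>p. diam_path n M p"
    "\<And>p. diam_path n M p \<Longrightarrow> tdist c (hd p) = \<rho> \<and> tdist c (last p) = \<rho>"
proof -
  have sup: "\<And>v. f v \<noteq> 0 \<Longrightarrow> tdist c v \<le> \<rho>" using c by (simp add: centered_def)
  obtain u v where uv: "tdist u v = 2 * \<rho>" "f u \<noteq> 0" "f v \<noteq> 0" using c unfolding centered_def by blast
  obtain q where q: "q \<in> spaths n M" "plen q = 2 * \<rho>" using indec_rep_path[OF M uv(2,3)] uv(1) by metis
  note ball = path_ball[OF spaths_ends(1)[OF M] sup[OF spaths_ends(2)[OF M]] sup[OF spaths_ends(3)[OF M]]]
  show d: "diam n M = 2 * \<rho>" using diam_eqI[OF _ q] ball(1) by blast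
  then show "\<exists>p. diam_path n M p" using q by (auto simp: diam_path_def)
  show "has_center n M {c}" using ball(2) d by (auto simp: has_center_def diam_path_def)
  show "tdist c (hd p) = \<rho> \<and> tdist c (last p) = \<rho>" if "diam_path n M p" for p
    using ball(2)[of p] that d by (auto simp: diam_path_def)
qed

lemma edge_centered_diam:
  assumes M: "indec_rep n e f M" and c: "edge_centered n c c' \<rho> f"
  shows "diam n M = Suc (2 * \<rho>)" "has_center n M {c, c'}" "\<exists>p. diam_path n M p"
proof -
  have sup: "\<And>v. f v \<noteq> 0 \<Longrightarrow> tdist c v \<le> Suc \<rho>" "\<And>v. f v \<noteq> 0 \<Longrightarrow> tdist c' v \<le> Suc \<rho>" and cc: "adj n c c'"
    using c by (auto simp: edge_centered_def)
  obtain u v where uv: "tdist u v = Suc (2 * \<rho>)" "f u \<noteq> 0" "f v \<noteq> 0" using c unfolding edge_centered_def by blast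
  obtain q where q: "q \<in> spaths n M" "plen q = Suc (2 * \<rho>)" using indec_rep_path[OF M uv(2,3)] uv(1) by metis
  note ends = spaths_ends(2)[OF M] spaths_ends(3)[OF M]
  note ball = path_edge_ball[OF spaths_ends(1)[OF M] cc sup(1)[OF ends(1)] sup(1)[OF ends(2)]
      sup(2)[OF ends(1)] sup(2)[OF ends(2)]]
  show d: "diam n M = Suc (2 * \<rho>)" using diam_eqI[OF _ q] ball(1) by blast
  then show "\<exists>p. diam_path n M p" using q by (auto simp: diam_path_def)
  show "has_center n M {c, c'}" using ball(2) d by (auto simp: has_center_def diam_path_def)
qed

text \<open>By the parity of \<open>e\<close> the sphere just outside the ball is reflected and
  copies the boundary values. The antipodal pair is prolonged at both ends: \<open>x\<close> leads
  away from \<open>v\<close> and \<open>c\<close>, then \<open>y\<close> away from \<open>x\<close>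
  and \<open>c\<close>.\<close>

lemma centered_grow:
  assumes n: "n \<ge> 3" and c: "centered n c \<rho> f" and e: "e = (even (length c) = even (Suc \<rho>))"
  shows "centered n c (Suc \<rho>) (reflect n e f)"
proof -
  have sup: "\<And>v. f v \<noteq> 0 \<Longrightarrow> tdist c v \<le> \<rho>" and vc: "valid n c" using c by (simp_all add: centered_def)
  obtain u v where uv: "valid n u" "valid n v" "tdist u v = 2 * \<rho>" "f u \<noteq> 0" "f v \<noteq> 0"
    using c unfolding centered_def by blast
  have r: "tdist c u = \<rho>" "tdist c v = \<rho>"
    using tdist_triangle[OF vc uv(2), of u] sup[OF uv(4)] sup[OF uv(5)] uv(3) tdist_sym[of u c] by auto
  obtain x where x: "adj n u x" "tdist v x = Suc (tdist v u)" "tdist c x = Suc (tdist c u)" using tdist_extend1[OF n uv(1)] .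
  obtain y where y: "adj n v y" "tdist x y = Suc (tdist x v)" "tdist c y = Suc (tdist c v)" using tdist_extend1[OF n uv(2)] .
  have snk: "is_sink e z" if "tdist c z = Suc \<rho>" for z
    using tdist_parity[of c z] that e by (auto simp: is_sink_def)
  have "reflect n e f x = f u" using reflect_leaf[OF sup x(1) r(1) _ snk] x(3) r(1) by simp
  moreover have "reflect n e f y = f v" using reflect_leaf[OF sup y(1) r(2) _ snk] y(3) r(2) by simp
  moreover have "tdist x y = 2 * Suc \<rho>" using y(2) x(2) uv(3) tdist_sym[of x v] tdist_sym[of v u] by simp
  moreover have "valid n x" "valid n y" using adj_valid x(1) y(1) by blast+
  ultimately show ?thesis
    unfolding centered_def using vc reflect_support[OF sup] uv(4,5) by metis
qed

text \<open>The equation for \<open>e\<close> says that boundary vertices of the ball are sources.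
  It persists, since orientation and parity of the radius change together. The orientation
  \<open>e = even t\<close> is \<open>e\<close> negated \<open>t\<close> times.\<close>

lemma sig_growth:
  fixes M :: "'a::field qrep"
  assumes n: "n \<ge> 3" and M: "indec_rep n e f M" and c: "centered n c \<rho> f" "\<rho> > 0"
    and e: "e = (even (length c) = even (Suc \<rho>))"
  shows "\<exists>f'. indec_rep n (e = even t) f' ((sig n ^^ t) M) \<and> centered n c (\<rho> + t) f'"
proof (induction t)
  case 0
  then show ?case using M c by auto
next
  case (Suc t)
  then obtain f' where f': "indec_rep n (e = even t) f' ((sig n ^^ t) M)" "centered n c (\<rho> + t) f'" by blast
  have "(e = even t) = (even (length c) = even (Suc (\<rho> + t)))" unfolding e by auto
  then have "centered n c (Suc (\<rho> + t)) (reflect n (e = even t) f')" by (rule centered_grow[OF n f'(2)])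
  moreover have "indec_rep n (\<not> (e = even t)) (reflect n (e = even t) f') (sig n ((sig n ^^ t) M))"
    using indec_rep_sig[OF f'(1)] centered_spread[OF f'(2)] c(2) by simp
  moreover have "(\<not> (e = even t)) = (e = even (Suc t))" by auto
  ultimately show ?case by (intro exI[of _ "reflect n (e = even t) f'"]) simp
qed

text \<open>The mirror image, with sinks on the boundary of the ball.\<close>

lemma sigm_growth:
  fixes M :: "'a::field qrep"
  assumes n: "n \<ge> 3" and M: "indec_rep n e f M" and c: "centered n c \<rho> f" "\<rho> > 0"
    and e: "e = (even (length c) = even \<rho>)"
  shows "\<exists>f'. indec_rep n (e = even t) f' ((sigm n ^^ t) M) \<and> centered n c (\<rho> + t) f'"
proof (induction t)
  case 0
  then show ?case using M c by auto
next
  case (Suc t)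
  then obtain f' where f': "indec_rep n (e = even t) f' ((sigm n ^^ t) M)" "centered n c (\<rho> + t) f'" by blast
  have "(\<not> (e = even t)) = (even (length c) = even (Suc (\<rho> + t)))" unfolding e by auto
  then have "centered n c (Suc (\<rho> + t)) (reflect n (\<not> (e = even t)) f')" by (rule centered_grow[OF n f'(2)])
  moreover have "indec_rep n (\<not> (e = even t)) (reflect n (\<not> (e = even t)) f') (sigm n ((sigm n ^^ t) M))"
    using indec_rep_sigm[OF f'(1)] centered_spread[OF f'(2)] c(2) by simp
  moreover have "(\<not> (e = even t)) = (e = even (Suc t))" by auto
  ultimately show ?case by (intro exI[of _ "reflect n (\<not> (e = even t)) f'"]) simp
qed

section \<open>Shift orbits\<close>

text \<open>Reduces the theorem to dimension vectors. \<open>h t\<close> belongs to the shift of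
  \<open>M\<close> by \<open>t + 1\<close>, because the module given by matrices is
  \<open>M1\<close> and \<open>M\<close> is its inverse shift. \<open>c0\<close>, \<open>ce\<close>
  and \<open>cb\<close> cover the shifts by 0 to \<open>plen p + 1\<close>; outside this range the
  growth lemmas take over.\<close>

lemma orbit_realizes:
  fixes M1 :: "'k::field qrep"
  assumes n: "n \<ge> 3" and r: "r > 0" and p: "is_path n p"
    and \<Omega>: "\<Omega> = (even (length (p ! 0)) = even r)"
    and M1: "indec_rep n (\<not> \<Omega>) (h 0) M1"
    and h: "\<And>t. h (Suc t) = reflect n (\<Omega> = odd t) (h t)"
    and c0: "centered n (p ! 0) r (reflect n \<Omega> (h 0))"
    and ce: "\<And>t. t < plen p \<Longrightarrow> edge_centered n (p ! t) (p ! Suc t) (r - 1) (h t)"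
    and cb: "centered n (p ! plen p) r (h (plen p))"
  shows "\<exists>M :: 'k qrep. is_rep n M \<and> rori M = \<Omega> \<and> regular n M \<and>
           is_M0 n M \<and> radius n M = r \<and> center_path n M p"
proof -
  let ?b = "plen p"
  define M where "M = sigm n M1"
  define f0 where "f0 = reflect n \<Omega> (h 0)"
  have spread: "\<exists>w. w \<noteq> v \<and> h t w \<noteq> 0" if "t \<le> ?b" for t v
    using that edge_centered_spread[OF ce] centered_spread[OF cb r] by (cases "t = ?b") auto
  have c0': "centered n (p ! 0) r f0" using c0 by (simp add: f0_def)
  have M: "indec_rep n \<Omega> f0 M"
    using indec_rep_sigm[OF M1] spread[of 0] by (simp add: M_def f0_def)
  \<comment> \<open>\<open>\<Omega> = odd t\<close> is \<open>\<Omega>\<close> negated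
    \<open>t + 1\<close> times.\<close>
  have pos: "indec_rep n (\<Omega> = odd t) (h t) ((sig n ^^ Suc t) M)" if "t \<le> ?b" for t
    using that
  proof (induction t)
    case 0
    have "indec_rep n (\<not> \<Omega>) (reflect n \<Omega> f0) (sig n M)"
      using indec_rep_sig[OF M] centered_spread[OF c0' r] by blast
    then show ?case by (simp add: f0_def)
  next
    case (Suc t)
    have "indec_rep n (\<not> (\<Omega> = odd t)) (reflect n (\<Omega> = odd t) (h t)) (sig n ((sig n ^^ Suc t) M))"
      using Suc spread[of t] by (intro indec_rep_sig) auto
    moreover have "(\<not> (\<Omega> = odd t)) = (\<Omega> = odd (Suc t))" by auto
    ultimately show ?case unfolding h by simp
  qed
  have ne: "p \<noteq> []" using p by (simp add: is_path_def)
  have len: "length p = Suc ?b" using ne by (simp add: plen_def)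
  have "tdist (p ! 0) (p ! ?b) = ?b" using path_tdist[OF p, of 0 ?b] len by simp
  then have parb: "even (length (p ! ?b)) = (even (length (p ! 0)) = even ?b)"
    using tdist_parity[of "p ! 0" "p ! ?b"] by auto
  have late: "\<exists>f'. indec_rep n ((\<Omega> = odd ?b) = even t) f' ((sig n ^^ (t + Suc ?b)) M) \<and> centered n (p ! ?b) (r + t) f'" for t
  proof -
    have "(\<Omega> = odd ?b) = (even (length (p ! ?b)) = even (Suc r))"
      unfolding \<Omega> parb by auto
    from sig_growth[OF n pos[OF order_refl] cb r this, of t]
    show ?thesis by (simp only: funpow_add o_apply)
  qed
  have early: "\<exists>f'. indec_rep n (\<Omega> = even t) f' ((sigm n ^^ t) M) \<and> centered n (p ! 0) (r + t) f'" for t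
    using sigm_growth[OF n M c0' r \<Omega>] .
  have nz: "\<not> is_zero N" if "indec_rep n e f N" for e f and N :: "'k qrep"
    using indec_repD(2)[OF that] by (simp add: indecomposable_def)
  \<comment> \<open>The ends of a path of odd length have different parity, so one of them is a
    source.\<close>
  have not_sink: "\<not> sink_module n N" if N: "indec_rep n e f N" "edge_centered n c c' \<rho> f" for e f c c' \<rho> and N :: "'k qrep"
  proof
    assume s: "sink_module n N"
    obtain q where q: "diam_path n N q" using edge_centered_diam(3)[OF N] by blast
    then have "is_sink (rori N) (hd q)" "is_sink (rori N) (last q)" using s by (auto simp: sink_module_def)
    moreover have "tdist (hd q) (last q) = Suc (2 * \<rho>)"
      using q edge_centered_diam(1)[OF N] path_plen[of n q] by (simp add: diam_path_def spaths_def)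
    ultimately show False using tdist_parity[of "hd q" "last q"] by (auto simp: is_sink_def)
  qed
  have source: "source_module n N \<and> \<not> sink_module n N"
    if N: "indec_rep n e f N" "centered n c \<rho> f" and e: "e = (even (length c) = even (Suc \<rho>))" for e f c \<rho> and N :: "'k qrep"
  proof -
    have "\<not> is_sink (rori N) v" if "tdist c v = \<rho>" for v
      using tdist_parity[of c v] that e indec_repD(3)[OF N(1)] by (auto simp: is_sink_def)
    then have "\<not> is_sink (rori N) (hd q) \<and> \<not> is_sink (rori N) (last q)" if "diam_path n N q" for q
      using centered_diam(4)[OF N that] by blast
    then show ?thesis using centered_diam(3)[OF N] unfolding source_module_def sink_module_def by blast
  qed
  have times: "thesis" if
    neg: "\<And>t. T = - int t \<Longrightarrow> sigt n T M = (sigm n ^^ t) M \<Longrightarrow> thesis" and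
    mid: "\<And>t. t < ?b \<Longrightarrow> T = int (Suc t) \<Longrightarrow> sigt n T M = (sig n ^^ Suc t) M \<Longrightarrow> thesis" and
    pos: "\<And>t. T = int (t + Suc ?b) \<Longrightarrow> sigt n T M = (sig n ^^ (t + Suc ?b)) M \<Longrightarrow> thesis" for T thesis
  proof (cases "T \<le> 0")
    case True
    then have "T = - int (nat (- T))" by simp
    moreover have "sigt n T M = (sigm n ^^ nat (- T)) M" using True by (cases "T = 0") (auto simp: sigt_def)
    ultimately show ?thesis by (rule neg)
  next
    case False
    then have s: "sigt n T M = (sig n ^^ nat T) M" by (simp add: sigt_def)
    show ?thesis
    proof (cases "nat T \<le> ?b")
      case True
      then show ?thesis using False s by (intro mid[of "nat T - 1"]) auto
    next
      case F: False
      then have "nat T = (nat T - Suc ?b) + Suc ?b" by simp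
      then show ?thesis using F s False by (intro pos[of "nat T - Suc ?b"]) auto
    qed
  qed
  have parity_late: "((\<Omega> = odd ?b) = even t) = (even (length (p ! ?b)) = even (Suc (r + t)))" for t
    unfolding \<Omega> parb by auto
  have "\<not> is_zero (sigt n T M)" for T
  proof (rule times[of T])
    show "\<not> is_zero (sigt n T M)" if "sigt n T M = (sigm n ^^ t) M" for t
      unfolding that using early[of t] nz by blast
    show "\<not> is_zero (sigt n T M)" if "t < ?b" "sigt n T M = (sig n ^^ Suc t) M" for t
      unfolding that(2) using pos[of t] that(1) nz by (meson less_imp_le)
    show "\<not> is_zero (sigt n T M)" if "sigt n T M = (sig n ^^ (t + Suc ?b)) M" for t
      unfolding that using late[of t] nz by blast
  qed
  then have reg: "regular n M" using indec_repD[OF M] by (simp add: regular_def)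
  have rad: "radius n M = r" using centered_diam(1)[OF M c0'] by (simp add: radius_def)
  have snk: "sink_module n M"
    unfolding sink_module_def
  proof (intro allI impI)
    fix q assume q: "diam_path n M q"
    have "is_sink (rori M) v" if "tdist (p ! 0) v = r" for v
      using tdist_parity[of "p ! 0" v] that \<Omega> indec_repD(3)[OF M] by (auto simp: is_sink_def)
    then show "is_sink (rori M) (hd q) \<and> is_sink (rori M) (last q)"
      using centered_diam(4)[OF M c0' q] by blast
  qed
  \<comment> \<open>The shifts by positive amounts are flow or source modules, and the shift by
    \<open>- int t\<close> has radius \<open>r + t\<close>.\<close>
  have "radius n M \<le> radius n (sigt n T M)" if sT: "sink_module n (sigt n T M)" for T
  proof (rule times[of T])
    show "radius n M \<le> radius n (sigt n T M)" if s: "sigt n T M = (sigm n ^^ t) M" for t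
    proof -
      obtain f' where "indec_rep n (\<Omega> = even t) f' ((sigm n ^^ t) M)" "centered n (p ! 0) (r + t) f'"
        using early[of t] by blast
      then have "diam n (sigt n T M) = 2 * (r + t)" unfolding s by (rule centered_diam(1))
      then show ?thesis using rad by (simp add: radius_def)
    qed
    show "radius n M \<le> radius n (sigt n T M)" if "t < ?b" "sigt n T M = (sig n ^^ Suc t) M" for t
      using not_sink[OF pos ce[OF that(1)]] that sT by simp
    show "radius n M \<le> radius n (sigt n T M)" if s: "sigt n T M = (sig n ^^ (t + Suc ?b)) M" for t
      using late[of t] source[OF _ _ parity_late[of t]] sT unfolding s by blast
  qed
  then have isM0: "is_M0 n M" using snk by (simp add: is_M0_def)
  have sigt_pos: "sigt n (int t) M = (sig n ^^ t) M" for t by (simp add: sigt_def)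
  have "center_path n M p"
    unfolding center_path_def
  proof (intro conjI allI impI)
    show "p \<noteq> []" by (rule ne)
    show "has_center n M {p ! 0}" by (rule centered_diam(2)[OF M c0'])
    fix i assume i: "1 \<le> i \<and> i \<le> ?b"
    then obtain t where t: "i = Suc t" "t < ?b" by (cases i) auto
    have g: "indec_rep n (\<Omega> = odd t) (h t) (sigt n (int i) M)"
      unfolding sigt_pos t(1) using t(2) by (intro pos) simp
    show "flow_module n (sigt n (int i) M)" using edge_centered_diam(1)[OF g ce[OF t(2)]] by (simp add: flow_module_def)
    show "has_center n (sigt n (int i) M) {p ! (i - 1), p ! i}"
      using edge_centered_diam(2)[OF g ce[OF t(2)]] t(1) by simp
  next
    have g: "indec_rep n (\<Omega> = odd ?b) (h ?b) (sigt n (int (?b + 1)) M)"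
      unfolding sigt_pos Suc_eq_plus1[symmetric] by (rule pos[OF order_refl])
    have "(\<Omega> = odd ?b) = (even (length (p ! ?b)) = even (Suc r))" unfolding \<Omega> parb by auto
    then show "source_module n (sigt n (int (?b + 1)) M)" using source[OF g cb] by blast
    show "\<not> flow_module n (sigt n (int (?b + 1)) M)"
      using centered_diam(1)[OF g cb] by (simp add: flow_module_def)
  qed
  then show ?thesis using indec_repD(1,3)[OF M] reg isM0 rad by blast
qed

text \<open>No neighbour sum at a reflected vertex sees \<open>a\<close>, which is itself reflected.
  The functor kills the simple module at a sink, but the formula returns its negative; this accounts
  for the correction terms at the two ends of the orbit segment.\<close>

lemma reflect_delta:
  assumes "valid n a" "is_sink e a"
  shows "reflect n e (orbit_dim n a 0) = (\<lambda>v. - orbit_dim n a 0 v)"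
proof
  fix v
  show "reflect n e (orbit_dim n a 0) v = - orbit_dim n a 0 v"
  proof (cases "valid n v \<and> is_sink e v")
    case True
    then have "a \<notin> nbrs n v" using nbrs_is_sink assms(2) by blast
    then have "(\<Sum>w\<in>nbrs n v. orbit_dim n a 0 w) = 0" by (intro sum.neutral) auto
    then show ?thesis using True by (simp add: reflect_def)
  next
    case False
    then show ?thesis using assms by (auto simp: reflect_def)
  qed
qed

text \<open>Modules in the middle of the orbit: a preprojective part shrinking towards \<open>a\<close> glued to
preinjective parts growing from the attached leaves \<open>Y\<close>.\<close>

definition profile :: "nat \<Rightarrow> nat list \<Rightarrow> nat list set \<Rightarrow> nat \<Rightarrow> nat \<Rightarrow> nat list \<Rightarrow> int" where
  "profile n a Y i j v = orbit_dim n a i v + (\<Sum>y\<in>Y. orbit_dim n y j v)"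

text \<open>The distance from \<open>a\<close> to each \<open>y\<close> has the parity of
  \<open>i + j\<close>, so the reflected vertices have the parity of \<open>Suc i\<close> seen from
  \<open>a\<close> and of \<open>Suc j\<close> seen from \<open>y\<close>. One reflection thus
  undoes a step around \<open>a\<close> and performs a step around each \<open>y\<close>.\<close>

lemma reflect_profile:
  assumes Y: "\<And>y. y \<in> Y \<Longrightarrow> even (length y) = (even (length a) = even (i + j))"
    and e: "e = (even (length a) = even (Suc i))"
  shows "reflect n e (profile n a Y (Suc i) j) = profile n a Y i (Suc j)"
proof -
  have "reflect n e (orbit_dim n y j) = orbit_dim n y (Suc j)" if "y \<in> Y" for y
  proof -
    have "e = (even (length y) = even (Suc j))" using Y[OF that] e by auto
    then show ?thesis by simp
  qed
  moreover have "reflect n e (orbit_dim n a (Suc i)) = orbit_dim n a i" using e by simp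
  ultimately show ?thesis
    unfolding profile_def reflect_add reflect_sum by (auto simp: fun_eq_iff)
qed

text \<open>All summands are nonnegative, so nothing cancels.\<close>

lemma profile_pos:
  assumes n: "n \<ge> 3" and v: "valid n a" "\<And>y. y \<in> Y \<Longrightarrow> valid n y" "finite Y"
  shows "orbit_dim n a i x > 0 \<Longrightarrow> profile n a Y i j x \<noteq> 0"
    and "y \<in> Y \<Longrightarrow> orbit_dim n y j x > 0 \<Longrightarrow> profile n a Y i j x \<noteq> 0"
proof -
  have nn: "orbit_dim n y j x \<ge> 0" if "y \<in> Y" for y using orbit_dim_nonneg[OF n v(2)[OF that]] .
  show "profile n a Y i j x \<noteq> 0" if "orbit_dim n a i x > 0"
    using that sum_nonneg[of Y "\<lambda>y. orbit_dim n y j x"] nn by (simp add: profile_def)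
  show "profile n a Y i j x \<noteq> 0" if "y \<in> Y" "orbit_dim n y j x > 0"
    using that sum_pos2[OF v(3) that(1), of "\<lambda>y. orbit_dim n y j x"] nn orbit_dim_nonneg[OF n v(1), of i x] by (simp add: profile_def)
qed

lemma profile_support:
  assumes "profile n a Y i j v \<noteq> 0" "tdist c a + i \<le> \<rho>" "\<And>y. y \<in> Y \<Longrightarrow> tdist c y + j \<le> \<rho>"
  shows "tdist c v \<le> \<rho>"
proof -
  have "orbit_dim n a i v \<noteq> 0 \<or> (\<exists>y\<in>Y. orbit_dim n y j v \<noteq> 0)"
    using assms(1) unfolding profile_def by (metis add.right_neutral sum.neutral)
  then show ?thesis using orbit_dim_support assms(2,3) by (meson le_trans)
qed

text \<open>In the dimension vector of \<open>M\<close> the vertices of \<open>Y\<close> cancel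
  against the boundary of the ball of radius \<open>r\<close>; the antipodal pair \<open>x\<close>,
  \<open>x'\<close> outside \<open>Y\<close> keeps the diameter at \<open>2 * r\<close>. The
  condition at the end of \<open>p\<close> stays a hypothesis, since its form depends on whether
  \<open>p\<close> has length \<open>r\<close>.\<close>

lemma profile_realizes:
  assumes n: "n \<ge> 3" and r: "r > 0" and p: "is_path n p" and b: "plen p \<le> r"
    and \<Omega>: "\<Omega> = (even (length (p ! 0)) = even r)"
    and Y: "finite Y" "Y \<noteq> {}" "\<And>y. y \<in> Y \<Longrightarrow> valid n y"
      "\<And>y. y \<in> Y \<Longrightarrow> tdist (p ! 0) y = r" "\<And>y. y \<in> Y \<Longrightarrow> tdist (p ! plen p) y = r - plen p"
    and x: "valid n x" "valid n x'" "x \<notin> Y" "x' \<notin> Y" "tdist (p ! 0) x = r" "tdist (p ! 0) x' = r" "tdist x x' = 2 * r"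
    and cb: "\<And>h. (\<And>t. t < r \<Longrightarrow> h t = profile n (p ! 0) Y (r - 1 - t) t) \<Longrightarrow>
       (\<And>t. h (Suc t) = reflect n (\<Omega> = odd t) (h t)) \<Longrightarrow> centered n (p ! plen p) r (h (plen p))"
  shows "\<exists>M :: 'k::field qrep. is_rep n M \<and> rori M = \<Omega> \<and> regular n M \<and>
           is_M0 n M \<and> radius n M = r \<and> center_path n M p"
proof -
  let ?a = "p ! 0" and ?b = "plen p"
  have ne: "p \<noteq> []" using p by (simp add: is_path_def)
  have len: "length p = Suc ?b" using ne by (simp add: plen_def)
  have vp: "valid n (p ! t)" if "t \<le> ?b" for t using p that len by (simp add: is_path_def)
  have parY: "even (length y) = (even (length ?a) = even r)" if "y \<in> Y" for y
    using tdist_parity[of ?a y] Y(4)[OF that] by auto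
  \<comment> \<open>Defined by recursion: step \<open>r\<close> may be reached, where the ball
    around \<open>p ! 0\<close> has disappeared and the vector is no longer a profile.\<close>
  define h where "h = rec_nat (profile n ?a Y (r - 1) 0) (\<lambda>t. reflect n (\<Omega> = odd t))"
  have h0: "h 0 = profile n ?a Y (r - 1) 0" and hS: "\<And>t. h (Suc t) = reflect n (\<Omega> = odd t) (h t)"
    by (simp_all add: h_def)
  have h: "h t = profile n ?a Y (r - 1 - t) t" if "t < r" for t
    using that
  proof (induction t)
    case (Suc t)
    then have i: "r - 1 - t = Suc (r - 1 - Suc t)" by simp
    have "h (Suc t) = reflect n (\<Omega> = odd t) (profile n ?a Y (Suc (r - 1 - Suc t)) t)"
      using Suc hS i by simp
    also have "\<dots> = profile n ?a Y (r - 1 - Suc t) (Suc t)"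
    proof (rule reflect_profile)
      have r': "r = Suc (Suc (r - 1 - Suc t + t))" using Suc.prems by simp
      then have "even r = even (r - 1 - Suc t + t)" by (metis even_Suc)
      then show "even (length y) = (even (length ?a) = even (r - 1 - Suc t + t))" if "y \<in> Y" for y
        using parY[OF that] by simp
      show "(\<Omega> = odd t) = (even (length ?a) = even (Suc (r - 1 - Suc t)))"
        using \<open>even r = even (r - 1 - Suc t + t)\<close> unfolding \<Omega> by auto
    qed
    finally show ?case .
  qed (simp add: h0)
  have Ys: "orbit_dim n y 0 = (\<lambda>v. if v = y then 1 else 0)" for y by simp
  have \<Omega>': "(\<not> \<Omega>) = (even (length ?a) = even (r - 1))" using r unfolding \<Omega> by (cases r) auto
  have a: "valid n ?a" using vp by simp
  obtain P :: "'k qrep" where P: "indec_rep n (\<not> \<Omega>) (orbit_dim n ?a (r - 1)) P"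
    using orbit_dim_module[OF n a, of "r - 1"] unfolding \<Omega>' by blast
  have "\<not> is_sink (\<not> \<Omega>) y \<and> orbit_dim n ?a (r - 1) y = 0 \<and> (\<exists>w\<in>nbrs n y. orbit_dim n ?a (r - 1) w \<noteq> 0)" if y: "y \<in> Y" for y
  proof (intro conjI)
    show "\<not> is_sink (\<not> \<Omega>) y" using parY[OF y] unfolding \<Omega> by (simp add: is_sink_def)
    show "orbit_dim n ?a (r - 1) y = 0" using orbit_dim_support[of n ?a "r - 1" y ?a] Y(4)[OF y] r by force
    have "y \<noteq> ?a" using Y(4)[OF y] r by auto
    then obtain w where w: "adj n y w" "tdist ?a y = Suc (tdist ?a w)"
      using tdist_descent_exists[of n y ?a] Y(3)[OF y] a by blast
    then have "orbit_dim n ?a (r - 1) w = 1" using orbit_dim_leaf[OF a, of w "r - 1"] adj_valid[OF w(1)] Y(4)[OF y] by simp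
    then show "\<exists>w\<in>nbrs n y. orbit_dim n ?a (r - 1) w \<noteq> 0" using w(1) by (intro bexI[of _ w]) (auto simp: nbrs_def)
  qed
  from indec_rep_attach[OF P Y(1) this]
  have M1: "indec_rep n (\<not> \<Omega>) (h 0) (attach P Y)" unfolding h0 profile_def Ys .
  have "reflect n \<Omega> (orbit_dim n y 0) = (\<lambda>v. - orbit_dim n y 0 v)" if y: "y \<in> Y" for y
    using parY[OF y] by (intro reflect_delta Y(3)[OF y]) (simp add: is_sink_def \<Omega>)
  moreover have "reflect n \<Omega> (orbit_dim n ?a (r - 1)) = orbit_dim n ?a r"
    using r \<Omega> by (cases r) simp_all
  ultimately have f0: "reflect n \<Omega> (h 0) = (\<lambda>v. orbit_dim n ?a r v + (\<Sum>y\<in>Y. - orbit_dim n y 0 v))"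
    unfolding h0 profile_def reflect_add reflect_sum by (auto simp: fun_eq_iff)
  have c0: "centered n ?a r (reflect n \<Omega> (h 0))"
    unfolding centered_def f0
  proof (intro conjI allI impI)
    fix v assume v: "orbit_dim n ?a r v + (\<Sum>y\<in>Y. - orbit_dim n y 0 v) \<noteq> 0"
    show "tdist ?a v \<le> r"
    proof (cases "v \<in> Y")
      case False
      then have "(\<Sum>y\<in>Y. - orbit_dim n y 0 v) = 0" by (intro sum.neutral) auto
      then show ?thesis using v orbit_dim_support[of n ?a r v ?a] by simp
    qed (use Y(4) in simp)
  next
    have "orbit_dim n ?a r z + (\<Sum>y\<in>Y. - orbit_dim n y 0 z) \<noteq> 0" if z: "valid n z" "tdist ?a z = r" "z \<notin> Y" for z
    proof -
      have "(\<Sum>y\<in>Y. - orbit_dim n y 0 z) = 0" using z(3) by (intro sum.neutral) auto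
      then show ?thesis using orbit_dim_leaf[OF a z(1,2)] by simp
    qed
    then show "\<exists>u v. valid n u \<and> valid n v \<and> tdist u v = 2 * r \<and> orbit_dim n ?a r u + (\<Sum>y\<in>Y. - orbit_dim n y 0 u) \<noteq> 0 \<and>
        orbit_dim n ?a r v + (\<Sum>y\<in>Y. - orbit_dim n y 0 v) \<noteq> 0" using x by blast
  qed (rule a)
  have dist_Y: "tdist (p ! t) y \<le> r - t" if "t \<le> ?b" "y \<in> Y" for t y
    using tdist_triangle[OF vp[OF order_refl] Y(3)[OF that(2)], of "p ! t"] path_tdist[OF p that(1)] len
      Y(5)[OF that(2)] b that(1) by simp
  have dist_a: "tdist (p ! t) ?a = t" if "t \<le> ?b" for t
    using path_tdist[OF p, of 0 t] that len tdist_sym[of "p ! t"] by simp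
  have ce: "edge_centered n (p ! t) (p ! Suc t) (r - 1) (h t)" if t: "t < ?b" for t
    unfolding edge_centered_def
  proof (intro conjI allI impI)
    have tr: "t < r" using t b by simp
    show "adj n (p ! t) (p ! Suc t)" using p t len by (simp add: is_path_def)
    fix v assume v: "h t v \<noteq> 0"
    note v' = v[unfolded h[OF tr]]
    show "tdist (p ! t) v \<le> Suc (r - 1)"
    proof (rule profile_support[OF v'])
      show "tdist (p ! t) y + t \<le> Suc (r - 1)" if "y \<in> Y" for y
        using dist_Y[OF _ that, of t] t tr by simp
    qed (use dist_a[of t] t tr in simp)
    show "tdist (p ! Suc t) v \<le> Suc (r - 1)"
    proof (rule profile_support[OF v'])
      show "tdist (p ! Suc t) y + t \<le> Suc (r - 1)" if "y \<in> Y" for y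
        using dist_Y[OF _ that, of "Suc t"] t tr by simp
    qed (use dist_a[of "Suc t"] t tr in simp)
  next
    have tr: "t < r" using t b by simp
    obtain y where y: "y \<in> Y" using Y(2) by blast
    note vy = Y(3)[OF y]
    \<comment> \<open>\<open>u\<close> lies beyond \<open>p ! 0\<close> as seen from
      \<open>y\<close>, and \<open>v\<close> beyond \<open>y\<close> as seen from \<open>u\<close>;
      their distance is \<open>(r - 1 - t) + r + t\<close>.\<close>
    obtain u where u: "valid n u" "tdist ?a u = r - 1 - t" "tdist y u = tdist y ?a + (r - 1 - t)"
      using tdist_extend[OF n a vy vy] by metis
    obtain v where v: "valid n v" "tdist y v = t" "tdist u v = tdist u y + t"
      using tdist_extend[OF n vy u(1) u(1)] by metis
    have "tdist u v = Suc (2 * (r - 1))"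
      using u(3) v(3) tdist_sym[of u y] tdist_sym[of y ?a] Y(4)[OF y] tr by simp
    moreover have "h t u \<noteq> 0" unfolding h[OF tr]
      using orbit_dim_leaf[OF a u(1,2)] by (intro profile_pos(1)[OF n a Y(3,1)]) auto
    moreover have "h t v \<noteq> 0" unfolding h[OF tr]
      using orbit_dim_leaf[OF vy v(1,2)] y by (intro profile_pos(2)[OF n a Y(3,1)]) auto
    ultimately show "\<exists>u v. valid n u \<and> valid n v \<and> tdist u v = Suc (2 * (r - 1)) \<and> h t u \<noteq> 0 \<and> h t v \<noteq> 0"
      using u(1) v(1) by blast
  qed
  show ?thesis using orbit_realizes[OF n r p \<Omega> M1 hS c0 ce cb[OF h hS]] .
qed

text \<open>Four vertices at distance \<open>r\<close> from \<open>p ! 0\<close> are needed: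
  \<open>y\<close>, \<open>y'\<close> branching at the end of \<open>p\<close>, and an antipodal
  pair \<open>x\<close>, \<open>x'\<close> different from them. For a path of length 0 both pairs
  must be antipodal around the same vertex, which may have only three directions.\<close>

lemma realizes_short:
  assumes n: "n \<ge> 3" and r: "r > 0" and p: "is_path n p" and b: "plen p < r" and rb: "r > 1 \<or> plen p > 0"
    and \<Omega>: "\<Omega> = (even (length (p ! 0)) = even r)"
  shows "\<exists>M :: 'k::field qrep. is_rep n M \<and> rori M = \<Omega> \<and> regular n M \<and>
           is_M0 n M \<and> radius n M = r \<and> center_path n M p"
proof -
  let ?a = "p ! 0" and ?b = "plen p"
  let ?c = "p ! ?b"
  have ne: "p \<noteq> []" using p by (simp add: is_path_def)
  have len: "length p = Suc ?b" using ne by (simp add: plen_def)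
  have va: "valid n ?a" and vc: "valid n ?c" using p len by (simp_all add: is_path_def)
  have ac: "tdist ?a ?c = ?b" using path_tdist[OF p, of 0 ?b] len by simp
  have "\<exists>y y' x x'. valid n y \<and> valid n y' \<and> valid n x \<and> valid n x' \<and>
      tdist ?c y = r - ?b \<and> tdist ?c y' = r - ?b \<and> tdist ?a y = r \<and> tdist ?a y' = r \<and> tdist y y' = 2 * (r - ?b) \<and>
      x \<noteq> y \<and> x \<noteq> y' \<and> x' \<noteq> y \<and> x' \<noteq> y' \<and> tdist ?a x = r \<and> tdist ?a x' = r \<and> tdist x x' = 2 * r"
  proof (cases "?b = 0")
    case False
    obtain y where y: "valid n y" "tdist ?c y = r - ?b" "tdist ?a y = tdist ?a ?c + (r - ?b)"
      using tdist_extend[OF n vc va va] by metis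
    obtain y' where y': "valid n y'" "tdist ?c y' = r - ?b" "tdist ?a y' = tdist ?a ?c + (r - ?b)" "tdist y y' = tdist y ?c + (r - ?b)"
      using tdist_extend[OF n vc va y(1)] by metis
    obtain x where x: "valid n x" "tdist ?a x = r" "tdist y x = tdist y ?a + r" "tdist y' x = tdist y' ?a + r"
      using tdist_extend[OF n va y(1) y'(1)] .
    \<comment> \<open>\<open>x'\<close> differs from \<open>y'\<close> although it is chosen away
      from \<open>y\<close> only: its distance from \<open>y\<close> is \<open>2 * r\<close>, that
      of \<open>y'\<close> is \<open>2 * (r - plen p)\<close>.\<close>
    obtain x' where x': "valid n x'" "tdist ?a x' = r" "tdist x x' = tdist x ?a + r" "tdist y x' = tdist y ?a + r"
      using tdist_extend[OF n va x(1) y(1)] .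
    have ya: "tdist y ?a = r" "tdist y' ?a = r" "tdist x ?a = r" "tdist y ?c = r - ?b"
      using tdist_sym y y' x ac b by (metis add_diff_inverse_nat not_less_iff_gr_or_eq less_imp_le not_le)+
    have yy: "tdist y y' = 2 * (r - ?b)" using y'(4) ya(4) by simp
    have "x \<noteq> y" "x \<noteq> y'" "x' \<noteq> y" using x(3,4) x'(4) r by auto
    moreover have "x' \<noteq> y'"
    proof
      assume "x' = y'"
      then have "2 * (r - ?b) = 2 * r" using yy x'(4) ya(1) by simp
      then show False using False b by simp
    qed
    moreover have "tdist ?a y = r" "tdist ?a y' = r" "tdist x x' = 2 * r" using y(3) y'(3) ac b x'(3) ya(3) by auto
    ultimately show ?thesis using y y' x x' yy by metis
  next
    case True
    then have r2: "r \<ge> 2" and c: "?c = ?a" using rb by auto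
    obtain y where y: "valid n y" "tdist ?a y = r" using tdist_extend[OF n va va va] by metis
    obtain x where x: "valid n x" "tdist ?a x = r" "tdist y x = tdist y ?a + r" using tdist_extend[OF n va y(1) y(1)] by metis
    \<comment> \<open>\<open>y'\<close> and \<open>x'\<close> share the third direction and part
      only at the last step, from \<open>w\<close>. This takes \<open>r \<ge> 2\<close>; for
      \<open>r = 1\<close> the vertex \<open>w\<close> would be \<open>p ! 0\<close> itself and
      \<open>x'\<close> could be \<open>y\<close>.\<close>
    obtain w where w: "valid n w" "tdist ?a w = r - 1" "tdist y w = tdist y ?a + (r - 1)" "tdist x w = tdist x ?a + (r - 1)"
      using tdist_extend[OF n va y(1) x(1)] by metis
    obtain y' where y': "valid n y'" "tdist w y' = 1" "tdist y y' = tdist y w + 1" "tdist x y' = tdist x w + 1"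
      using tdist_extend[OF n w(1) y(1) x(1)] by metis
    obtain x' where x': "valid n x'" "tdist w x' = 1" "tdist y' x' = tdist y' w + 1" "tdist x x' = tdist x w + 1"
      using tdist_extend[OF n w(1) y'(1) x(1)] by metis
    have ya: "tdist y ?a = r" "tdist x ?a = r" "tdist y' w = 1" using tdist_sym y x y' by metis+
    have yw: "tdist y w = 2 * r - 1" "tdist x w = 2 * r - 1" using w ya r2 by simp_all
    have ay': "tdist ?a y' = r" using tdist_triangle[OF va y'(1), of y] tdist_triangle[OF w(1) y'(1), of ?a] y' ya yw w r2 by simp
    have ax': "tdist ?a x' = r" using tdist_triangle[OF va x'(1), of x] tdist_triangle[OF w(1) x'(1), of ?a] x' ya yw w r2 by simp
    have "x \<noteq> y" "x \<noteq> y'" "x' \<noteq> y'" using x(3) y'(4) x'(3) r yw by auto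
    moreover have "x' \<noteq> y"
    proof
      assume "x' = y"
      then have "tdist y y' = 2" using x'(3) ya(3) tdist_sym[of y' y] by simp
      then show False using y'(3) yw r2 by simp
    qed
    moreover have "tdist y y' = 2 * r" "tdist x x' = 2 * r" using y'(3) x'(4) yw r2 by simp_all
    ultimately show ?thesis unfolding c True using y y' x x' ay' ax' by (metis diff_zero)
  qed
  then obtain y y' x x' where v: "valid n y" "valid n y'" "valid n x" "valid n x'"
    and y: "tdist ?c y = r - ?b" "tdist ?c y' = r - ?b" "tdist ?a y = r" "tdist ?a y' = r" "tdist y y' = 2 * (r - ?b)"
    and x: "x \<noteq> y" "x \<noteq> y'" "x' \<noteq> y" "x' \<noteq> y'" "tdist ?a x = r" "tdist ?a x' = r" "tdist x x' = 2 * r"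
    by blast
  let ?Y = "{y, y'}"
  show ?thesis
  proof (rule profile_realizes[OF n r p _ \<Omega>, of ?Y x x'])
    fix h assume h: "\<And>t. t < r \<Longrightarrow> h t = profile n ?a ?Y (r - 1 - t) t"
    have hb: "h ?b = profile n ?a ?Y (r - 1 - ?b) ?b" using h b by simp
    show "centered n ?c r (h ?b)"
      unfolding centered_def hb
    proof (intro conjI allI impI)
      fix z assume "profile n ?a ?Y (r - 1 - ?b) ?b z \<noteq> 0"
      then show "tdist ?c z \<le> r"
      proof (rule profile_support)
        show "tdist ?c ?a + (r - 1 - ?b) \<le> r" using ac tdist_sym[of ?c ?a] b by simp
        show "tdist ?c w + ?b \<le> r" if "w \<in> ?Y" for w using that y b by auto
      qed
    next
      \<comment> \<open>Far ends of the balls of radius \<open>plen p\<close> around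
        \<open>y\<close> and \<open>y'\<close>; their distance is
        \<open>2 * (r - plen p) + 2 * plen p\<close>.\<close>
      obtain z where z: "valid n z" "tdist y z = ?b" "tdist y' z = tdist y' y + ?b"
        using tdist_extend[OF n v(1) v(2) v(2)] by metis
      obtain z' where z': "valid n z'" "tdist y' z' = ?b" "tdist z z' = tdist z y' + ?b"
        using tdist_extend[OF n v(2) z(1) z(1)] by metis
      have "tdist z z' = 2 * r" using z(3) z'(3) y(5) tdist_sym[of z y'] tdist_sym[of y y'] b by simp
      moreover have "profile n ?a ?Y (r - 1 - ?b) ?b z \<noteq> 0"
        using orbit_dim_leaf[OF v(1) z(1,2)] v by (intro profile_pos(2)[OF n va, of _ y]) auto
      moreover have "profile n ?a ?Y (r - 1 - ?b) ?b z' \<noteq> 0"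
        using orbit_dim_leaf[OF v(2) z'(1,2)] v by (intro profile_pos(2)[OF n va, of _ y']) auto
      ultimately show "\<exists>u v. valid n u \<and> valid n v \<and> tdist u v = 2 * r \<and>
          profile n ?a ?Y (r - 1 - ?b) ?b u \<noteq> 0 \<and> profile n ?a ?Y (r - 1 - ?b) ?b v \<noteq> 0"
        using z(1) z'(1) by blast
    qed (rule vc)
  qed (use v x y b in auto)
qed

text \<open>At step \<open>r - 1\<close> the ball around \<open>p ! 0\<close> has shrunk to this
  vertex, which is then a sink. The next reflection makes its contribution negative, and it cancels
  the value one that the ball of radius \<open>r\<close> around \<open>p ! r\<close> has on its
  boundary vertex \<open>p ! 0\<close>. Two antipodal boundary vertices away from
  \<open>p ! 0\<close> remain.\<close>

lemma realizes_full:
  assumes n: "n \<ge> 3" and r: "r > 0" and p: "is_path n p" and b: "plen p = r"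
    and \<Omega>: "\<Omega> = (even (length (p ! 0)) = even r)"
  shows "\<exists>M :: 'k::field qrep. is_rep n M \<and> rori M = \<Omega> \<and> regular n M \<and>
           is_M0 n M \<and> radius n M = r \<and> center_path n M p"
proof -
  let ?a = "p ! 0" and ?c = "p ! r"
  have ne: "p \<noteq> []" using p by (simp add: is_path_def)
  have len: "length p = Suc r" using ne b by (cases p) (auto simp: plen_def)
  have va: "valid n ?a" and vc: "valid n ?c" using p len by (simp_all add: is_path_def)
  have ac: "tdist ?a ?c = r" using path_tdist[OF p, of 0 r] len by simp
  have ca: "tdist ?c ?a = r" using ac tdist_sym by metis
  obtain x where x: "valid n x" "tdist ?a x = r" "tdist ?c x = tdist ?c ?a + r" using tdist_extend[OF n va vc vc] by metis
  obtain x' where x': "valid n x'" "tdist ?a x' = r" "tdist x x' = tdist x ?a + r" "tdist ?c x' = tdist ?c ?a + r"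
    using tdist_extend[OF n va x(1) vc] by metis
  have xx: "tdist x x' = 2 * r" using x' x tdist_sym[of x ?a] by simp
  show ?thesis
  proof (rule profile_realizes[OF n r p _ \<Omega>, of "{?c}" x x'])
    fix h assume h: "\<And>t. t < r \<Longrightarrow> h t = profile n ?a {?c} (r - 1 - t) t"
      and hS: "\<And>t. h (Suc t) = reflect n (\<Omega> = odd t) (h t)"
    obtain k where k: "r = Suc k" using r by (cases r) auto
    have hk: "h k = (\<lambda>v. orbit_dim n ?a 0 v + orbit_dim n ?c k v)" using h[of k] k by (simp add: profile_def fun_eq_iff)
    have e: "(\<Omega> = odd k) = even (length ?a)" unfolding \<Omega> k by auto
    have e': "even (length ?a) = (even (length ?c) = even (Suc k))"
      using tdist_parity[of ?a ?c] ac k by auto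
    have "h r = (\<lambda>v. reflect n (even (length ?a)) (orbit_dim n ?a 0) v + reflect n (even (length ?a)) (orbit_dim n ?c k) v)"
      unfolding k hS hk e by (rule reflect_add)
    moreover have "reflect n (even (length ?a)) (orbit_dim n ?a 0) = (\<lambda>v. - orbit_dim n ?a 0 v)"
      by (rule reflect_delta[OF va]) (simp add: is_sink_def)
    moreover have "reflect n (even (length ?a)) (orbit_dim n ?c k) = orbit_dim n ?c r" unfolding k orbit_dim.simps(2) using e' k by simp
    ultimately have hr: "h r = (\<lambda>v. orbit_dim n ?c r v - orbit_dim n ?a 0 v)" by (simp add: fun_eq_iff)
    show "centered n (p ! plen p) r (h (plen p))"
      unfolding centered_def b hr
    proof (intro conjI allI impI)
      fix v assume "orbit_dim n ?c r v - orbit_dim n ?a 0 v \<noteq> 0"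
      then have "orbit_dim n ?c r v \<noteq> 0 \<or> v = ?a" by (auto split: if_splits)
      then show "tdist ?c v \<le> r" using orbit_dim_support[of n ?c r v ?c] ca by auto
    next
      obtain u where u: "valid n u" "tdist ?c u = r" "tdist ?a u = tdist ?a ?c + r" using tdist_extend[OF n vc va va] by metis
      obtain w where w: "valid n w" "tdist ?c w = r" "tdist ?a w = tdist ?a ?c + r" "tdist u w = tdist u ?c + r"
        using tdist_extend[OF n vc va u(1)] .
      have "u \<noteq> ?a" "w \<noteq> ?a" using u(3) w(3) r by auto
      then have "orbit_dim n ?c r u - orbit_dim n ?a 0 u = 1" "orbit_dim n ?c r w - orbit_dim n ?a 0 w = 1"
        using orbit_dim_leaf[OF vc u(1,2)] orbit_dim_leaf[OF vc w(1,2)] by simp_all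
      moreover have "tdist u w = 2 * r" using w(4) u(2) tdist_sym[of u ?c] by simp
      ultimately show "\<exists>u v. valid n u \<and> valid n v \<and> tdist u v = 2 * r \<and> orbit_dim n ?c r u - orbit_dim n ?a 0 u \<noteq> 0 \<and>
          orbit_dim n ?c r v - orbit_dim n ?a 0 v \<noteq> 0"
        using u(1) w(1) by (metis zero_neq_one)
    qed (rule vc)
  qed (use x x' xx vc ac b r ca in auto)
qed

text \<open>The plane at \<open>p ! 0\<close> has dimension 2, so the inverse shift keeps dimension
  2 - 1 at the three attached vertices instead of losing them. There are no flow modules: the star
  is already the source module following \<open>M\<close>.\<close>

lemma realizes_point:
  assumes n: "n \<ge> 3" and p: "is_path n p" and b: "plen p = 0"
    and \<Omega>: "\<Omega> = (even (length (p ! 0)) = even (1::nat))"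
  shows "\<exists>M :: 'k::field qrep. is_rep n M \<and> rori M = \<Omega> \<and> regular n M \<and>
           is_M0 n M \<and> radius n M = 1 \<and> center_path n M p"
proof -
  let ?a = "p ! 0"
  have va: "valid n ?a" using p by (simp add: is_path_def)
  obtain y1 where y1: "adj n ?a y1" "tdist ?a y1 = Suc (tdist ?a ?a)" using tdist_extend1[OF n va] by metis
  obtain y2 where y2: "adj n ?a y2" "tdist y1 y2 = Suc (tdist y1 ?a)" using tdist_extend1[OF n va] by metis
  obtain y3 where y3: "adj n ?a y3" "tdist y1 y3 = Suc (tdist y1 ?a)" "tdist y2 y3 = Suc (tdist y2 ?a)" using tdist_extend1[OF n va] .
  have t1: "tdist y1 ?a = 1" "tdist y2 ?a = 1" "tdist y3 ?a = 1" "tdist ?a y2 = 1" "tdist ?a y3 = 1" "tdist ?a y1 = 1"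
    using tdist_adj_1 adj_sym y1(1) y2(1) y3(1) by blast+
  have ne: "y1 \<noteq> y2" "y1 \<noteq> y3" "y2 \<noteq> y3" using y2(2) y3(2,3) by auto
  have nb: "y1 \<in> nbrs n ?a" "y2 \<in> nbrs n ?a" "y3 \<in> nbrs n ?a" using y1 y2 y3 by (auto simp: nbrs_def)
  have vy: "valid n y1" "valid n y2" using adj_valid y1(1) y2(1) by blast+
  define f :: "nat list \<Rightarrow> int" where "f v = (if v = ?a then 2 else if v \<in> {y1, y2, y3} then 1 else 0)" for v
  define h where "h = rec_nat f (\<lambda>t. reflect n (\<Omega> = odd t))"
  have h0: "h 0 = f" and hS: "\<And>t. h (Suc t) = reflect n (\<Omega> = odd t) (h t)" by (simp_all add: h_def)
  have ya: "y1 \<noteq> ?a" "y2 \<noteq> ?a" "y3 \<noteq> ?a" using t1 by auto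
  have "is_sink (\<not> \<Omega>) ?a" using \<Omega> by (simp add: is_sink_def)
  from indec_rep_star[OF this nb ne] have M1: "indec_rep n (\<not> \<Omega>) (h 0) (star (\<not> \<Omega>) ?a y1 y2 y3 :: 'k qrep)"
    unfolding h0 f_def .
  have sup: "tdist ?a v \<le> 1" if "f v \<noteq> 0" for v using that t1 by (auto simp: f_def split: if_splits)
  have "tdist y1 y2 = 2 * 1" using y2(2) t1 by simp
  then have c: "centered n ?a 1 f" unfolding centered_def using va sup vy ne ya
    by (intro conjI exI[of _ y1] exI[of _ y2]) (auto simp: f_def)
  have f0: "reflect n \<Omega> f y = 1" if y: "y \<in> {y1, y2}" for y
  proof -
    have ay: "adj n y ?a" using y y1 y2 adj_sym by blast
    have "is_sink \<Omega> y" using adj_parity[OF ay] \<Omega> by (auto simp: is_sink_def)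
    moreover have "(\<Sum>w\<in>nbrs n y. f w) = (\<Sum>w\<in>nbrs n y. if w = ?a then 2 else 0)"
    proof (rule sum.cong)
      fix w assume w: "w \<in> nbrs n y"
      have "w \<notin> {y1, y2, y3}"
      proof
        assume "w \<in> {y1, y2, y3}"
        then have "adj n ?a w" using y1 y2 y3 by blast
        then show False using adj_parity[OF ay] adj_parity[of n ?a w] adj_parity[of n y w] w by (auto simp: nbrs_def)
      qed
      then show "f w = (if w = ?a then 2 else 0)" by (simp add: f_def)
    qed simp
    moreover have "\<dots> = 2" using ay by (simp add: sum.delta nbrs_def[symmetric]) (simp add: nbrs_def)
    moreover have "f y = 1" using y ya by (auto simp: f_def)
    ultimately show ?thesis using adj_valid[OF ay] by (simp add: reflect_def)
  qed
  \<comment> \<open>Reflected vertices have odd distance from \<open>p ! 0\<close>, which improves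
    the general bound 2 to 1.\<close>
  have "tdist ?a v \<le> 1" if "reflect n \<Omega> f v \<noteq> 0" for v
  proof (cases "is_sink \<Omega> v")
    case True
    have "odd (tdist ?a v)" using tdist_parity[of ?a v] True \<Omega> by (auto simp: is_sink_def)
    moreover have "tdist ?a v \<le> Suc 1" using reflect_support[OF sup that] .
    ultimately show ?thesis by (cases "tdist ?a v = 2") auto
  next
    case False
    then show ?thesis using sup that by (simp add: reflect_def)
  qed
  then have c0: "centered n ?a 1 (reflect n \<Omega> f)" unfolding centered_def
    using va vy f0 \<open>tdist y1 y2 = 2 * 1\<close> by (intro conjI exI[of _ y1] exI[of _ y2]) auto
  have M: "centered n (p ! plen p) 1 (h (plen p))" unfolding b h0 by (rule c)
  have ce: "edge_centered n (p ! t) (p ! Suc t) (1 - 1) (h t)" if "t < plen p" for t using that b by simp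
  show ?thesis
    by (rule orbit_realizes[OF n zero_less_one p \<Omega> M1 hS c0[folded h0] ce M])
qed

theorem theorem2:
  fixes n r :: nat and \<Omega> :: bool and p :: "nat list list"
  assumes "n \<ge> 3" and "r > 0"
    and "is_path n p" and "plen p \<le> r"
    and "is_sink \<Omega> (p ! 0) \<longleftrightarrow> even r"
  shows "\<exists>M :: ('k::field) qrep. is_rep n M \<and> rori M = \<Omega> \<and> regular n M \<and>
           is_M0 n M \<and> radius n M = r \<and> center_path n M p"
proof -
  have \<Omega>: "\<Omega> = (even (length (p ! 0)) = even r)" using assms(5) by (auto simp: is_sink_def)
  consider "plen p = r" | "plen p < r" "r > 1 \<or> plen p > 0" | "plen p = 0" "r = 1"
    using assms(2,4) by linarith
  then show ?thesis
  proof cases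
    case 1
    then show ?thesis using realizes_full[OF assms(1-3) _ \<Omega>] by blast
  next
    case 2
    then show ?thesis using realizes_short[OF assms(1-3) _ _ \<Omega>] by blast
  next
    case 3
    then show ?thesis using realizes_point[OF assms(1,3)] \<Omega> by blast
  qed
qed

end
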